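(* Let $F$ be a T$_0$-space and let $\mathcal{U}_F\colon Q\mathrm{Aut}(F)\to\mathrm{Aut}(F)$ be the cofibrant replacement of $\mathrm{Aut}(F)$ in $\mathbf{Cat}$. Then, for every non-empty cofibrant object $X$ of $\mathbf{Cat}$ there exists a canonical bijection between isomorphism classes of fiber bundles over $X$ with fiber $F$ and equivalence classes of continuous maps from $X$ to $Q\mathrm{Aut}(F)$.
   Context: An Alexandroff space is a topological space in which arbitrary intersections of open sets are open. In an Alexandroff space $X$ each $x$ has a minimal open neighbourhood $U_x$, and $x\leq y \iff U_x\subseteq U_y$ defines a preorder; the open sets are exactly the lower sets and $U_x=\{y\in X : y\leq x\}$. Alexandroff spaces are thereby identified with preordered sets (T$_0$ ones with posets), continuous maps between them with order-preserving maps, and each is regarded as a thin category with a unique arrow (denoted $x\leq y$) from $x$ to $y$ whenever $x\leq y$. $\mathbf{Top}$ is the category of topological spaces and continuous maps. $\mathrm{Aut}(F)$ is the subcategory of $\mathbf{Top}$ with single object $F$ and arrows the self-homeomorphisms of $F$; it is regarded both as a category and as a group. $\mathrm{Inn}(\mathrm{Aut}(F))$ is the group of inner automorphisms of the group $\mathrm{Aut}(F)$. $\mathbf{Cat}$, the category of small categories, carries Thomason's model structure, in which a functor is a weak equivalence iff it induces a homotopy equivalence of classifying spaces, a fibration iff $\mathrm{Ex}^2$ of its nerve is a Kan fibration, and the cofibrations are the functors with the left lifting property against trivial fibrations. Cofibrant objects and cofibrant replacement in $\mathbf{Cat}$ refer to this model structure. Every cofibrant object is a poset. The cofibrant replacement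 $\mathcal{U}_F\colon Q\mathrm{Aut}(F)\to\mathrm{Aut}(F)$ is a trivial fibration with $Q\mathrm{Aut}(F)$ cofibrant (hence a poset, viewed also as an Alexandroff T$_0$-space). A fiber bundle over $B$ with fiber $F$ is a continuous map $p\colon E\to B$ such that every $b\in B$ has an open neighbourhood $U$ with a homeomorphism $p^{-1}(U)\to U\times F$ commuting with the maps to $U$. Two fiber bundles $p\colon E\to B$, $q\colon E'\to B$ are isomorphic if there is a homeomorphism $\alpha\colon E\to E'$ with $q\alpha=p$. Induced homomorphism: let $X$ be an Alexandroff space, $\mathcal{E}\colon X\to\mathrm{Aut}(F)$ a functor and $x_0\in X$. For $a\leq b$ in $X$ let $\eta(a\leq b)$ be the path equal to $a$ on $[0,1)$ and to $b$ at $1$. The fundamental groupoid $\Pi_1(X)$ (composition $[\beta][\alpha]=[\alpha*\beta]$) is the localization of the category $X$ at all its arrows via $(a\leq b)\mapsto[\eta(a\leq b)]$, so $\mathcal{E}$ extends uniquely to a functor $\Pi_1(X)\to\mathrm{Aut}(F)$; its restriction to $\pi_1(X,x_0)$ is the induced homomorphism $\mathcal{E}_\ast\colon\pi_1(X,x_0)\to\pi_1(\mathrm{Aut}(F),F)\cong\mathrm{Aut}(F)$. Equivalence of maps: let $X$ be an Alexandroff T$_0$-space and let $A\subseteq X$ contain exactly one point of each connected component of $X$. Continuous maps $f,g\colon X\to Q\mathrm{Aut}(F)$ are equivalent if for each $x_0\in A$ there exists $\nu_{x_0}\in\mathrm{Inn}(\mathrm{Aut}(F))$ such that $(\mathcal{U}_F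 g)_\ast=\nu_{x_0}(\mathcal{U}_F f)_\ast\colon\pi_1(X,x_0)\to\pi_1(\mathrm{Aut}(F),F)\cong\mathrm{Aut}(F)$. This does not depend on the choice of $A$. *)

theory Defs
  imports "HOL-Analysis.Analysis" "HOL-Homology.Simplices" "HOL-Algebra.Group"
begin

section \<open>Small categories\<close>

text \<open>
  A category has its objects in a type \<open>'o\<close> and its arrows labelled by a type \<open>'m\<close>. Labels may be
  reused in different hom-sets, so composition takes the three objects as arguments:
  \<open>Comp C x y z g f\<close> is the composite of \<open>f \<in> Hom C x y\<close> followed by \<open>g \<in> Hom C y z\<close>.
\<close>

record ('o, 'm) cat =
  Obj :: "'o set"
  Hom :: "'o \<Rightarrow> 'o \<Rightarrow> 'm set"
  Ident :: "'o \<Rightarrow> 'm"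
  Comp :: "'o \<Rightarrow> 'o \<Rightarrow> 'o \<Rightarrow> 'm \<Rightarrow> 'm \<Rightarrow> 'm"

definition category :: "('o, 'm) cat \<Rightarrow> bool" where
  "category C \<longleftrightarrow>
     (\<forall>x y. Hom C x y \<noteq> {} \<longrightarrow> x \<in> Obj C \<and> y \<in> Obj C) \<and>
     (\<forall>x\<in>Obj C. Ident C x \<in> Hom C x x) \<and>
     (\<forall>x y z. \<forall>f\<in>Hom C x y. \<forall>g\<in>Hom C y z. Comp C x y z g f \<in> Hom C x z) \<and>
     (\<forall>x y. \<forall>f\<in>Hom C x y. Comp C x x y f (Ident C x) = f \<and> Comp C x y y (Ident C y) f = f) \<and>
     (\<forall>w x y z. \<forall>f\<in>Hom C w x. \<forall>g\<in>Hom C x y. \<forall>h\<in>Hom C y z.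
        Comp C w x z (Comp C x y z h g) f = Comp C w y z h (Comp C w x y g f))"

record ('o, 'm, 'p, 'n) cfunctor =
  omap :: "'o \<Rightarrow> 'p"
  amap :: "'o \<Rightarrow> 'o \<Rightarrow> 'm \<Rightarrow> 'n"

text \<open>
  Functors are extensional on objects and on hom-sets, so that equality of functors is equality
  in the logic.
\<close>

definition funct :: "('o, 'm) cat \<Rightarrow> ('p, 'n) cat \<Rightarrow> ('o, 'm, 'p, 'n) cfunctor set" where
  "funct C D = {T.
     omap T \<in> Obj C \<rightarrow>\<^sub>E Obj D \<and>
     (\<forall>x y. amap T x y \<in> Hom C x y \<rightarrow>\<^sub>E Hom D (omap T x) (omap T y)) \<and>
     (\<forall>x\<in>Obj C. amap T x x (Ident C x) = Ident D (omap T x)) \<and>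
     (\<forall>x y z. \<forall>f\<in>Hom C x y. \<forall>g\<in>Hom C y z.
        amap T x z (Comp C x y z g f) =
        Comp D (omap T x) (omap T y) (omap T z) (amap T y z g) (amap T x y f))}"

text \<open>\<open>func_comp C S T\<close> is the composite of \<open>T\<close>, whose domain is \<open>C\<close>, followed by \<open>S\<close>.\<close>

definition func_comp ::
  "('o, 'm) cat \<Rightarrow> ('p, 'n, 'q, 'k) cfunctor \<Rightarrow> ('o, 'm, 'p, 'n) cfunctor \<Rightarrow>
   ('o, 'm, 'q, 'k) cfunctor" where
  "func_comp C S T =
     \<lparr>omap = (\<lambda>x\<in>Obj C. omap S (omap T x)),
      amap = (\<lambda>x y. \<lambda>f\<in>Hom C x y. amap S (omap T x) (omap T y) (amap T x y f))\<rparr>"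

text \<open>The label carried by every arrow of a thin category; which one it is does not matter.\<close>

definition arr :: "'m" where
  "arr = undefined"

text \<open>A preordered set \<open>(A, r)\<close>, where \<open>r x y\<close> means \<open>x \<le> y\<close>, as a thin category.\<close>

definition thin_cat :: "'a set \<Rightarrow> ('a \<Rightarrow> 'a \<Rightarrow> bool) \<Rightarrow> ('a, 'm) cat" where
  "thin_cat A r =
     \<lparr>Obj = A, Hom = (\<lambda>x y. if x \<in> A \<and> y \<in> A \<and> r x y then {arr} else {}),
      Ident = (\<lambda>_. arr), Comp = (\<lambda>_ _ _ _ _. arr)\<rparr>"

text \<open>The functor from \<open>C\<close> to a thin category which is \<open>h\<close> on objects.\<close>

definition thin_functor :: "('o, 'm) cat \<Rightarrow> ('o \<Rightarrow> 'p) \<Rightarrow> ('o, 'm, 'p, 'n) cfunctor" where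
  "thin_functor C h = \<lparr>omap = restrict h (Obj C), amap = (\<lambda>x y. \<lambda>_\<in>Hom C x y. arr)\<rparr>"

definition empty_cat :: "('o, 'm) cat" where
  "empty_cat = thin_cat {} (\<lambda>_ _. True)"

text \<open>
  A group (or monoid) as a category with a single object. The name of this object is immaterial.
\<close>

definition group_cat :: "'m monoid \<Rightarrow> ('o, 'm) cat" where
  "group_cat G =
     \<lparr>Obj = {undefined},
      Hom = (\<lambda>x y. if x = undefined \<and> y = undefined then carrier G else {}),
      Ident = (\<lambda>_. \<one>\<^bsub>G\<^esub>), Comp = (\<lambda>_ _ _ g f. g \<otimes>\<^bsub>G\<^esub> f)\<rparr>"


section \<open>Simplicial sets\<close>

definition mono_maps :: "nat \<Rightarrow> nat \<Rightarrow> (nat \<Rightarrow> nat) set" where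
  "mono_maps m n = {\<theta> \<in> {..m} \<rightarrow>\<^sub>E {..n}. mono_on {..m} \<theta>}"

text \<open>\<open>sact S m n \<theta>\<close> is the map from the \<open>n\<close>-simplices to the \<open>m\<close>-simplices induced by \<open>\<theta> \<in> mono_maps m n\<close>.\<close>

record 's sset =
  simp :: "nat \<Rightarrow> 's set"
  sact :: "nat \<Rightarrow> nat \<Rightarrow> (nat \<Rightarrow> nat) \<Rightarrow> 's \<Rightarrow> 's"

definition smaps :: "'s sset \<Rightarrow> 't sset \<Rightarrow> (nat \<Rightarrow> 's \<Rightarrow> 't) set" where
  "smaps S T = {\<phi>.
     (\<forall>n. \<phi> n \<in> simp S n \<rightarrow>\<^sub>E simp T n) \<and>
     (\<forall>m n. \<forall>\<theta>\<in>mono_maps m n. \<forall>s\<in>simp S n. \<phi> m (sact S m n \<theta> s) = sact T m n \<theta> (\<phi> n s))}"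

definition sset_comp :: "'s sset \<Rightarrow> (nat \<Rightarrow> 't \<Rightarrow> 'w) \<Rightarrow> (nat \<Rightarrow> 's \<Rightarrow> 't) \<Rightarrow> nat \<Rightarrow> 's \<Rightarrow> 'w" where
  "sset_comp S \<psi> \<phi> = (\<lambda>n. \<lambda>s\<in>simp S n. \<psi> n (\<phi> n s))"

definition ord_cat :: "nat \<Rightarrow> (nat, unit) cat" where
  "ord_cat n = thin_cat {..n} (\<le>)"

definition nerve :: "('o, 'm) cat \<Rightarrow> (nat, unit, 'o, 'm) cfunctor sset" where
  "nerve C =
     \<lparr>simp = (\<lambda>n. funct (ord_cat n) C),
      sact = (\<lambda>m n \<theta> \<sigma>. func_comp (ord_cat m) \<sigma> (thin_functor (ord_cat m) \<theta>))\<rparr>"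

definition nerve_map ::
  "('o, 'm) cat \<Rightarrow> ('o, 'm, 'p, 'n) cfunctor \<Rightarrow>
   nat \<Rightarrow> (nat, unit, 'o, 'm) cfunctor \<Rightarrow> (nat, unit, 'p, 'n) cfunctor" where
  "nerve_map C T = (\<lambda>n. \<lambda>\<sigma>\<in>simp (nerve C) n. func_comp (ord_cat n) T \<sigma>)"

definition std_simplex :: "nat \<Rightarrow> (nat, unit, nat, unit) cfunctor sset" where
  "std_simplex n = nerve (ord_cat n)"

text \<open>The horn: the simplices of the standard simplex that miss some vertex other than \<open>k\<close>.\<close>

definition horn :: "nat \<Rightarrow> nat \<Rightarrow> (nat, unit, nat, unit) cfunctor sset" where
  "horn n k =
     \<lparr>simp = (\<lambda>m. {\<sigma> \<in> simp (std_simplex n) m. insert k (omap \<sigma> ` {..m}) \<noteq> {..n}}),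
      sact = sact (std_simplex n)\<rparr>"

definition kan_fibration :: "'s sset \<Rightarrow> 't sset \<Rightarrow> (nat \<Rightarrow> 's \<Rightarrow> 't) \<Rightarrow> bool" where
  "kan_fibration S T p \<longleftrightarrow> p \<in> smaps S T \<and>
     (\<forall>n k u v. 1 \<le> n \<and> k \<le> n \<and> u \<in> smaps (horn n k) S \<and> v \<in> smaps (std_simplex n) T \<and>
        (\<forall>m. \<forall>\<sigma>\<in>simp (horn n k) m. p m (u m \<sigma>) = v m \<sigma>) \<longrightarrow>
        (\<exists>w\<in>smaps (std_simplex n) S.
           (\<forall>m. \<forall>\<sigma>\<in>simp (horn n k) m. w m \<sigma> = u m \<sigma>) \<and>
           (\<forall>m. \<forall>\<sigma>\<in>simp (std_simplex n) m. p m (w m \<sigma>) = v m \<sigma>)))"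

text \<open>
  The barycentric subdivision of the standard \<open>n\<close>-simplex is the nerve of the poset of its faces,
  i.e. of non-empty subsets of \<open>{..n}\<close>; \<open>kan_Ex S\<close> has as \<open>n\<close>-simplices the maps from it to \<open>S\<close>.
\<close>

definition faces_cat :: "nat \<Rightarrow> (nat set, unit) cat" where
  "faces_cat n = thin_cat {s. s \<noteq> {} \<and> s \<subseteq> {..n}} (\<subseteq>)"

definition sd_simplex :: "nat \<Rightarrow> (nat, unit, nat set, unit) cfunctor sset" where
  "sd_simplex n = nerve (faces_cat n)"

definition sd_simplex_map ::
  "nat \<Rightarrow> (nat \<Rightarrow> nat) \<Rightarrow>
   nat \<Rightarrow> (nat, unit, nat set, unit) cfunctor \<Rightarrow> (nat, unit, nat set, unit) cfunctor" where
  "sd_simplex_map m \<theta> = nerve_map (faces_cat m) (thin_functor (faces_cat m) (\<lambda>s. \<theta> ` s))"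

definition kan_Ex :: "'s sset \<Rightarrow> (nat \<Rightarrow> (nat, unit, nat set, unit) cfunctor \<Rightarrow> 's) sset" where
  "kan_Ex S =
     \<lparr>simp = (\<lambda>n. smaps (sd_simplex n) S),
      sact = (\<lambda>m n \<theta> \<phi>. sset_comp (sd_simplex m) \<phi> (sd_simplex_map m \<theta>))\<rparr>"

definition kan_Ex_map ::
  "'s sset \<Rightarrow> (nat \<Rightarrow> 's \<Rightarrow> 't) \<Rightarrow>
   nat \<Rightarrow> (nat \<Rightarrow> (nat, unit, nat set, unit) cfunctor \<Rightarrow> 's) \<Rightarrow>
   (nat \<Rightarrow> (nat, unit, nat set, unit) cfunctor \<Rightarrow> 't)" where
  "kan_Ex_map S \<phi> = (\<lambda>n. \<lambda>\<psi>\<in>simp (kan_Ex S) n. sset_comp (sd_simplex n) \<phi> \<psi>)"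


section \<open>Geometric realization and classifying spaces\<close>

text \<open>The quotient of a space by an equivalence relation on its underlying set.\<close>

definition quotient_space :: "'a topology \<Rightarrow> ('a \<times> 'a) set \<Rightarrow> 'a set topology" where
  "quotient_space X r = topology (\<lambda>\<V>. \<V> \<subseteq> topspace X // r \<and> openin X (\<Union>\<V>))"

text \<open>The affine map of standard topological simplices induced by \<open>\<theta> \<in> mono_maps m n\<close>.\<close>

definition simplex_push :: "nat \<Rightarrow> (nat \<Rightarrow> nat) \<Rightarrow> (nat \<Rightarrow> real) \<Rightarrow> nat \<Rightarrow> real" where
  "simplex_push m \<theta> t = (\<lambda>j. \<Sum>i\<in>{i. i \<le> m \<and> \<theta> i = j}. t i)"

text \<open>The disjoint union of one topological \<open>n\<close>-simplex for each \<open>n\<close>-simplex of \<open>S\<close>, for all \<open>n\<close>.\<close>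

definition simplex_sum :: "'s sset \<Rightarrow> ((nat \<times> 's) \<times> (nat \<Rightarrow> real)) topology" where
  "simplex_sum S =
     sum_topology (\<lambda>(n, s). subtopology (powertop_real UNIV) (standard_simplex n))
       (SIGMA n:UNIV. simp S n)"

definition glue :: "'s sset \<Rightarrow>
    (((nat \<times> 's) \<times> (nat \<Rightarrow> real)) \<times> ((nat \<times> 's) \<times> (nat \<Rightarrow> real))) set" where
  "glue S = {(((m, sact S m n \<theta> s), t), ((n, s), simplex_push m \<theta> t)) | m n \<theta> s t.
     \<theta> \<in> mono_maps m n \<and> s \<in> simp S n \<and> t \<in> standard_simplex m}"

definition glue_equiv :: "'s sset \<Rightarrow>
    (((nat \<times> 's) \<times> (nat \<Rightarrow> real)) \<times> ((nat \<times> 's) \<times> (nat \<Rightarrow> real))) set" where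
  "glue_equiv S =
     (glue S \<union> (glue S)\<inverse>)\<^sup>* \<inter> (topspace (simplex_sum S) \<times> topspace (simplex_sum S))"

definition realization :: "'s sset \<Rightarrow> ((nat \<times> 's) \<times> (nat \<Rightarrow> real)) set topology" where
  "realization S = quotient_space (simplex_sum S) (glue_equiv S)"

text \<open>The map to the realization of \<open>T\<close> induced by a simplicial map \<open>\<phi>\<close>, acting on equivalence classes.\<close>

definition realization_map :: "'t sset \<Rightarrow> (nat \<Rightarrow> 's \<Rightarrow> 't) \<Rightarrow>
    ((nat \<times> 's) \<times> (nat \<Rightarrow> real)) set \<Rightarrow> ((nat \<times> 't) \<times> (nat \<Rightarrow> real)) set" where
  "realization_map T \<phi> K = glue_equiv T `` {((n, \<phi> n s), t) | n s t. ((n, s), t) \<in> K}"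

definition classifying_space where
  "classifying_space C = realization (nerve C)"

definition homotopy_equivalence_map :: "'a topology \<Rightarrow> 'b topology \<Rightarrow> ('a \<Rightarrow> 'b) \<Rightarrow> bool" where
  "homotopy_equivalence_map X Y f \<longleftrightarrow> continuous_map X Y f \<and>
     (\<exists>g. continuous_map Y X g \<and>
        homotopic_with (\<lambda>_. True) X X (g \<circ> f) id \<and> homotopic_with (\<lambda>_. True) Y Y (f \<circ> g) id)"


section \<open>Thomason's model structure\<close>

definition weak_equivalence ::
  "('o, 'm) cat \<Rightarrow> ('p, 'n) cat \<Rightarrow> ('o, 'm, 'p, 'n) cfunctor \<Rightarrow> bool" where
  "weak_equivalence C D T \<longleftrightarrow> T \<in> funct C D \<and>
     homotopy_equivalence_map (classifying_space C) (classifying_space D)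
       (realization_map (nerve D) (nerve_map C T))"

definition fibration ::
  "('o, 'm) cat \<Rightarrow> ('p, 'n) cat \<Rightarrow> ('o, 'm, 'p, 'n) cfunctor \<Rightarrow> bool" where
  "fibration C D T \<longleftrightarrow> T \<in> funct C D \<and>
     kan_fibration (kan_Ex (kan_Ex (nerve C))) (kan_Ex (kan_Ex (nerve D)))
       (kan_Ex_map (kan_Ex (nerve C)) (kan_Ex_map (nerve C) (nerve_map C T)))"

definition trivial_fibration ::
  "('o, 'm) cat \<Rightarrow> ('p, 'n) cat \<Rightarrow> ('o, 'm, 'p, 'n) cfunctor \<Rightarrow> bool" where
  "trivial_fibration C D T \<longleftrightarrow>
     category C \<and> category D \<and> fibration C D T \<and> weak_equivalence C D T"

text \<open>
  The left lifting property is tested against trivial fibrations between categories of the same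
  type \<open>('o, 'm) cat\<close> as the given ones, i.e. this type plays the role of the category of small
  categories. If \<open>'o\<close> and \<open>'m\<close> are infinite, this loses nothing for functors between categories
  with at most \<open>|'o|\<close> and at most \<open>|'m|\<close> arrows: since Thomason's model structure has countably many
  generating cofibrations, with finite domains and codomains, the small object argument factors
  such a functor as a relative cell complex followed by a trivial fibration, through a category
  of the same size; so lifting against that trivial fibration makes the functor a retract of a
  cofibration.
\<close>

definition cofibration ::
  "('o, 'm) cat \<Rightarrow> ('o, 'm) cat \<Rightarrow> ('o, 'm, 'o, 'm) cfunctor \<Rightarrow> bool" where
  "cofibration A B i \<longleftrightarrow> i \<in> funct A B \<and>
     (\<forall>(E :: ('o, 'm) cat) (D :: ('o, 'm) cat) p u v.
        trivial_fibration E D p \<and> u \<in> funct A E \<and> v \<in> funct B D \<and>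
        func_comp A p u = func_comp A v i \<longrightarrow>
        (\<exists>w\<in>funct B E. func_comp A w i = u \<and> func_comp B p w = v))"

definition cofibrant :: "('o, 'm) cat \<Rightarrow> bool" where
  "cofibrant C \<longleftrightarrow> category C \<and> cofibration empty_cat C (thin_functor empty_cat id)"

definition cofibrant_replacement ::
  "('o, 'm) cat \<Rightarrow> ('o, 'm) cat \<Rightarrow> ('o, 'm, 'o, 'm) cfunctor \<Rightarrow> bool" where
  "cofibrant_replacement C Q U \<longleftrightarrow> cofibrant Q \<and> trivial_fibration Q C U"


section \<open>Alexandroff spaces as categories\<close>

definition alexandroff_space :: "'a topology \<Rightarrow> bool" where
  "alexandroff_space X \<longleftrightarrow> (\<forall>\<U>. \<U> \<noteq> {} \<and> (\<forall>U\<in>\<U>. openin X U) \<longrightarrow> openin X (\<Inter>\<U>))"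

definition min_nbhd :: "'a topology \<Rightarrow> 'a \<Rightarrow> 'a set" where
  "min_nbhd X x = \<Inter>{U. openin X U \<and> x \<in> U}"

definition alex_le :: "'a topology \<Rightarrow> 'a \<Rightarrow> 'a \<Rightarrow> bool" where
  "alex_le X x y \<longleftrightarrow> x \<in> topspace X \<and> y \<in> topspace X \<and> min_nbhd X x \<subseteq> min_nbhd X y"

definition alex_cat :: "'a topology \<Rightarrow> ('a, 'm) cat" where
  "alex_cat X = thin_cat (topspace X) (alex_le X)"


section \<open>Fiber bundles\<close>

definition fiber_bundle :: "'b topology \<Rightarrow> 'f topology \<Rightarrow> 'e topology \<Rightarrow> ('e \<Rightarrow> 'b) \<Rightarrow> bool" where
  "fiber_bundle B F E p \<longleftrightarrow> continuous_map E B p \<and>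
     (\<forall>b\<in>topspace B. \<exists>U h. openin B U \<and> b \<in> U \<and>
        homeomorphic_map (subtopology E {e \<in> topspace E. p e \<in> U})
          (prod_topology (subtopology B U) F) h \<and>
        (\<forall>e\<in>topspace E. p e \<in> U \<longrightarrow> fst (h e) = p e))"

definition bundle_iso ::
  "'e topology \<Rightarrow> ('e \<Rightarrow> 'b) \<Rightarrow> 'd topology \<Rightarrow> ('d \<Rightarrow> 'b) \<Rightarrow> bool" where
  "bundle_iso E p E' q \<longleftrightarrow>
     (\<exists>\<alpha>. homeomorphic_map E E' \<alpha> \<and> (\<forall>e\<in>topspace E. q (\<alpha> e) = p e))"

text \<open>
  Since a fiber bundle over \<open>B\<close> with fiber \<open>F\<close> has as many points as the product of \<open>B\<close> and
  \<open>F\<close>, bundles with total space in the type \<open>'b \<times> 'f\<close> represent all isomorphism classes.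
\<close>

definition bundles :: "'b topology \<Rightarrow> 'f topology \<Rightarrow> (('b \<times> 'f) topology \<times> ('b \<times> 'f \<Rightarrow> 'b)) set" where
  "bundles B F = {(E, p). fiber_bundle B F E p}"

definition bundle_iso_rel :: "'b topology \<Rightarrow> 'f topology \<Rightarrow>
    ((('b \<times> 'f) topology \<times> ('b \<times> 'f \<Rightarrow> 'b)) \<times> (('b \<times> 'f) topology \<times> ('b \<times> 'f \<Rightarrow> 'b))) set" where
  "bundle_iso_rel B F =
     {((E, p), (E', q)). (E, p) \<in> bundles B F \<and> (E', q) \<in> bundles B F \<and> bundle_iso E p E' q}"


section \<open>The group of self-homeomorphisms\<close>

definition homeo_group :: "'f topology \<Rightarrow> ('f \<Rightarrow> 'f) monoid" where
  "homeo_group F =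
     \<lparr>carrier = {g \<in> extensional (topspace F). homeomorphic_map F F g},
      mult = (\<lambda>g f. compose (topspace F) g f), one = (\<lambda>u\<in>topspace F. u)\<rparr>"

definition aut_cat :: "'f topology \<Rightarrow> ('o, 'f \<Rightarrow> 'f) cat" where
  "aut_cat F = group_cat (homeo_group F)"

definition inner_automorphisms :: "('a, 'c) monoid_scheme \<Rightarrow> ('a \<Rightarrow> 'a) set" where
  "inner_automorphisms G = {\<lambda>g\<in>carrier G. c \<otimes>\<^bsub>G\<^esub> g \<otimes>\<^bsub>G\<^esub> inv\<^bsub>G\<^esub> c | c. c \<in> carrier G}"


section \<open>The fundamental groupoid and the induced homomorphism\<close>

definition path_homotopic :: "'a topology \<Rightarrow> (real \<Rightarrow> 'a) \<Rightarrow> (real \<Rightarrow> 'a) \<Rightarrow> bool" where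
  "path_homotopic X \<alpha> \<beta> \<longleftrightarrow>
     homotopic_with (\<lambda>\<gamma>. \<gamma> 0 = \<alpha> 0 \<and> \<gamma> 1 = \<alpha> 1) (top_of_set {0..1}) X \<alpha> \<beta>"

definition path_class :: "'a topology \<Rightarrow> (real \<Rightarrow> 'a) \<Rightarrow> (real \<Rightarrow> 'a) set" where
  "path_class X \<alpha> = {\<beta>. path_homotopic X \<alpha> \<beta>}"

definition path_join :: "(real \<Rightarrow> 'a) \<Rightarrow> (real \<Rightarrow> 'a) \<Rightarrow> real \<Rightarrow> 'a" where
  "path_join \<alpha> \<beta> = (\<lambda>t. if t \<le> 1/2 then \<alpha> (2 * t) else \<beta> (2 * t - 1))"

text \<open>
  The composite of the class of \<open>\<alpha>\<close> followed by that of \<open>\<beta>\<close> is the class of \<open>path_join \<alpha> \<beta>\<close>;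
  the union below is over equal sets.
\<close>

definition fundamental_groupoid :: "'a topology \<Rightarrow> ('a, (real \<Rightarrow> 'a) set) cat" where
  "fundamental_groupoid X =
     \<lparr>Obj = topspace X,
      Hom = (\<lambda>x y. {path_class X \<gamma> | \<gamma>. pathin X \<gamma> \<and> \<gamma> 0 = x \<and> \<gamma> 1 = y}),
      Ident = (\<lambda>x. path_class X (\<lambda>_. x)),
      Comp = (\<lambda>_ _ _ b a. \<Union>\<alpha>\<in>a. \<Union>\<beta>\<in>b. path_class X (path_join \<alpha> \<beta>))\<rparr>"

definition eta :: "'a \<Rightarrow> 'a \<Rightarrow> real \<Rightarrow> 'a" where
  "eta a b = (\<lambda>t. if t < 1 then a else b)"

definition eta_functor :: "'a topology \<Rightarrow> ('a, 'm, 'a, (real \<Rightarrow> 'a) set) cfunctor" where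
  "eta_functor X =
     \<lparr>omap = (\<lambda>x\<in>topspace X. x),
      amap = (\<lambda>x y. \<lambda>_\<in>Hom (alex_cat X :: ('a, 'm) cat) x y. path_class X (eta x y))\<rparr>"

text \<open>The unique extension of \<open>D\<close>, defined on \<open>X\<close> with values in \<open>C\<close>, along \<open>eta_functor X\<close>.\<close>

definition groupoid_extension :: "'a topology \<Rightarrow> ('p, 'n) cat \<Rightarrow> ('a, 'm, 'p, 'n) cfunctor \<Rightarrow>
    ('a, (real \<Rightarrow> 'a) set, 'p, 'n) cfunctor" where
  "groupoid_extension X C D =
     (THE T. T \<in> funct (fundamental_groupoid X) C \<and> func_comp (alex_cat X) T (eta_functor X) = D)"

definition pi1 :: "'a topology \<Rightarrow> 'a \<Rightarrow> (real \<Rightarrow> 'a) set set" where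
  "pi1 X x\<^sub>0 = Hom (fundamental_groupoid X) x\<^sub>0 x\<^sub>0"

definition induced_hom ::
  "'a topology \<Rightarrow> 'f topology \<Rightarrow> ('a, 'm, 'o, 'f \<Rightarrow> 'f) cfunctor \<Rightarrow> 'a \<Rightarrow>
   (real \<Rightarrow> 'a) set \<Rightarrow> 'f \<Rightarrow> 'f" where
  "induced_hom X F D x\<^sub>0 = restrict (amap (groupoid_extension X (aut_cat F) D) x\<^sub>0 x\<^sub>0) (pi1 X x\<^sub>0)"


section \<open>Maps into the cofibrant replacement\<close>

text \<open>
  From here on the base \<open>X\<close>, the fiber \<open>F\<close> and the replacement \<open>Q\<close> all have their points in one
  type \<open>'u\<close>, so that their categories all have the type \<open>('u, 'u \<Rightarrow> 'u) cat\<close>. Nothing is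
  assumed about how their underlying sets are related. \<open>along X U f\<close> is the functor from \<open>X\<close> to the automorphism category of \<open>F\<close>
  obtained from a map \<open>f\<close> from \<open>X\<close> to \<open>Q\<close>.
\<close>

definition along :: "'u topology \<Rightarrow> ('u, 'u \<Rightarrow> 'u, 'u, 'u \<Rightarrow> 'u) cfunctor \<Rightarrow> ('u \<Rightarrow> 'u) \<Rightarrow>
    ('u, 'u \<Rightarrow> 'u, 'u, 'u \<Rightarrow> 'u) cfunctor" where
  "along X U f = func_comp (alex_cat X) U (thin_functor (alex_cat X :: ('u, 'u \<Rightarrow> 'u) cat) f)"

definition maps :: "'a topology \<Rightarrow> 'b topology \<Rightarrow> ('a \<Rightarrow> 'b) set" where
  "maps X Q = {f \<in> extensional (topspace X). continuous_map X Q f}"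

text \<open>\<open>A\<close> contains exactly one point of each connected component.\<close>

definition component_transversal :: "'a topology \<Rightarrow> 'a set \<Rightarrow> bool" where
  "component_transversal X A \<longleftrightarrow>
     A \<subseteq> topspace X \<and> (\<forall>C\<in>connected_components_of X. \<exists>!a. a \<in> A \<inter> C)"

definition map_equiv_rel ::
  "'u topology \<Rightarrow> 'u topology \<Rightarrow> 'u topology \<Rightarrow> ('u, 'u \<Rightarrow> 'u, 'u, 'u \<Rightarrow> 'u) cfunctor \<Rightarrow> 'u set \<Rightarrow>
   (('u \<Rightarrow> 'u) \<times> ('u \<Rightarrow> 'u)) set" where
  "map_equiv_rel X F Q U A =
     {(f, g). f \<in> maps X Q \<and> g \<in> maps X Q \<and>
        (\<forall>x\<^sub>0\<in>A. \<exists>\<nu>\<in>inner_automorphisms (homeo_group F).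
           \<forall>c\<in>pi1 X x\<^sub>0. induced_hom X F (along X U g) x\<^sub>0 c = \<nu> (induced_hom X F (along X U f) x\<^sub>0 c))}"

text \<open>
  The topological Grothendieck construction of a functor from \<open>X\<close> to the automorphism category of
  \<open>F\<close>: its points are the pairs \<open>(x, u)\<close>, and it has as basis the sets of all \<open>(x, u)\<close> such that
  \<open>x \<le> y\<close> and the homeomorphism \<open>D (x \<le> y)\<close> sends \<open>u\<close> into \<open>V\<close>, for \<open>y\<close> in \<open>X\<close> and \<open>V\<close> open in \<open>F\<close>.
\<close>

definition grothendieck_space ::
  "'a topology \<Rightarrow> 'f topology \<Rightarrow> ('a, 'm, 'o, 'f \<Rightarrow> 'f) cfunctor \<Rightarrow> ('a \<times> 'f) topology" where
  "grothendieck_space X F D =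
     topology_generated_by
       {{(x, u). alex_le X x y \<and> u \<in> topspace F \<and> amap D x y arr u \<in> V} | y V.
          y \<in> topspace X \<and> openin F V}"

definition bundle_of ::
  "'u topology \<Rightarrow> 'u topology \<Rightarrow> ('u, 'u \<Rightarrow> 'u, 'u, 'u \<Rightarrow> 'u) cfunctor \<Rightarrow> ('u \<Rightarrow> 'u) \<Rightarrow>
   ('u \<times> 'u) topology \<times> ('u \<times> 'u \<Rightarrow> 'u)" where
  "bundle_of X F U f = (grothendieck_space X F (along X U f), fst)"

text \<open>
  The class of \<open>f\<close> is sent to the isomorphism class of \<open>bundle_of X F U f\<close>. (If this depended on
  the choice of \<open>f\<close> in its class, the value would be a union of several isomorphism classes.)
\<close>

definition classifying_bijection ::
  "'u topology \<Rightarrow> 'u topology \<Rightarrow> ('u, 'u \<Rightarrow> 'u, 'u, 'u \<Rightarrow> 'u) cfunctor \<Rightarrow> ('u \<Rightarrow> 'u) set \<Rightarrow>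
   (('u \<times> 'u) topology \<times> ('u \<times> 'u \<Rightarrow> 'u)) set" where
  "classifying_bijection X F U K = bundle_iso_rel X F `` (bundle_of X F U ` K)"

end

theory Submission
  imports Defs
begin

text \<open>
  Since \<open>X\<close> is cofibrant and \<open>U\<close> is a trivial fibration, every functor from \<open>X\<close> to \<open>aut_cat F\<close>
  lifts to a continuous map \<open>X \<rightarrow> Q\<close>; nothing else about the model structure is needed. It remains
  to classify functors and bundles. The transition maps of a bundle between minimal neighbourhoods
  are constant because \<open>F\<close> is \<open>T\<^sub>0\<close>, so they form a functor whose total space is the given bundle,
  and isomorphisms of bundles are exactly natural isomorphisms of functors. Finally, a functor \<open>\<delta>\<close>
  from \<open>X\<close> to a group defines a parallel transport along paths, which is homotopy invariant and is
  the unique extension of \<open>\<delta>\<close> to the fundamental groupoid; hence two functors are naturally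
  isomorphic iff their holonomies are conjugate on each component.
\<close>

section \<open>Alexandroff spaces\<close>

text \<open>A path in an Alexandroff space may change its value infinitely often, so it need not be
  a finite chain of comparable points, and transport cannot simply be defined as a product along
  such a chain. What always holds is that near each time t the path stays below its value at t.
  Arguments about paths therefore compare short pieces with the cone under one point and assemble
  the pieces by bisection of the interval; transport itself is read off from a group-valued function
  that satisfies a local condition. The T0 axiom is what makes transition maps rigid: for an
  indiscrete fiber every family of bijections of the fibers is continuous, so transition maps could
  vary arbitrarily. The lift of a functor to \<open>Q\<close> is not unique. This does no harm,
  since equivalence of maps speaks of the composite functors \<open>along X U f\<close> only;
  natural isomorphism of these functors is the common meaning of equivalence of maps and isomorphism
  of bundles.\<close>

lemma openin_min_nbhd:
  assumes "alexandroff_space X" "x \<in> topspace X"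
  shows "openin X (min_nbhd X x)"
proof -
  let ?\<U> = "{U. openin X U \<and> x \<in> U}"
  have "topspace X \<in> ?\<U>"
    using assms by simp
  then have "?\<U> \<noteq> {} \<and> (\<forall>U\<in>?\<U>. openin X U)"
    by blast
  with assms(1) have "openin X (\<Inter>?\<U>)"
    unfolding alexandroff_space_def by (elim allE[of _ ?\<U>]) (rule mp)
  then show ?thesis
    by (simp only: min_nbhd_def)
qed

lemma mem_min_nbhd: "x \<in> min_nbhd X x"
  by (auto simp: min_nbhd_def)

lemma min_nbhd_subset: "openin X W \<Longrightarrow> x \<in> W \<Longrightarrow> min_nbhd X x \<subseteq> W"
  by (auto simp: min_nbhd_def)

lemma min_nbhd_subset_topspace: "x \<in> topspace X \<Longrightarrow> min_nbhd X x \<subseteq> topspace X"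
  by (simp add: min_nbhd_subset)

lemma mem_min_nbhd_iff:
  assumes "alexandroff_space X" "x \<in> topspace X"
  shows "z \<in> min_nbhd X x \<longleftrightarrow> alex_le X z x"
  using assms min_nbhd_subset[OF openin_min_nbhd[OF assms]] min_nbhd_subset_topspace[OF assms(2)]
  by (auto simp: alex_le_def intro: mem_min_nbhd)

lemma alex_le_refl: "x \<in> topspace X \<Longrightarrow> alex_le X x x"
  by (simp add: alex_le_def)

lemma alex_le_trans: "alex_le X x y \<Longrightarrow> alex_le X y z \<Longrightarrow> alex_le X x z"
  by (auto simp: alex_le_def)

lemma alex_le_topspace: "alex_le X x y \<Longrightarrow> x \<in> topspace X \<and> y \<in> topspace X"
  by (simp add: alex_le_def)

lemma alex_le_open: "alex_le X x y \<Longrightarrow> openin X W \<Longrightarrow> y \<in> W \<Longrightarrow> x \<in> W"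
  using min_nbhd_subset[of X W y] mem_min_nbhd[of x X] unfolding alex_le_def by blast

text \<open>Each point of a lower set has its minimal neighbourhood inside the set.\<close>

lemma openin_alexandroff:
  assumes "alexandroff_space X" "W \<subseteq> topspace X" "\<And>x y. alex_le X x y \<Longrightarrow> y \<in> W \<Longrightarrow> x \<in> W"
  shows "openin X W"
proof (subst openin_subopen, intro ballI)
  fix x assume "x \<in> W"
  then have "x \<in> topspace X"
    using assms by auto
  then show "\<exists>T. openin X T \<and> x \<in> T \<and> T \<subseteq> W"
    using assms openin_min_nbhd[of X x] mem_min_nbhd[of x X] mem_min_nbhd_iff[of X x] \<open>x \<in> W\<close>
    by (intro exI[of _ "min_nbhd X x"]) auto
qed

text \<open>For monotonicity it suffices to pull back one open set: the preimage of the minimal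
  neighbourhood of \<open>f y\<close> is open and contains \<open>y\<close>, hence also every
  \<open>x\<close> below it.\<close>

lemma continuous_map_alexandroff_iff:
  assumes "alexandroff_space X" "alexandroff_space Y"
  shows "continuous_map X Y f \<longleftrightarrow>
    f \<in> topspace X \<rightarrow> topspace Y \<and> (\<forall>x y. alex_le X x y \<longrightarrow> alex_le Y (f x) (f y))"
proof
  assume f: "continuous_map X Y f"
  have "alex_le Y (f x) (f y)" if "alex_le X x y" for x y
  proof -
    have y: "x \<in> topspace X" "y \<in> topspace X" "f y \<in> topspace Y"
      using alex_le_topspace[OF that] f by (auto simp: continuous_map)
    have "openin X {x \<in> topspace X. f x \<in> min_nbhd Y (f y)}"
      using f openin_min_nbhd[OF assms(2) y(3)] by (simp add: continuous_map)
    then have "x \<in> {x \<in> topspace X. f x \<in> min_nbhd Y (f y)}"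
      by (rule alex_le_open[OF that]) (simp add: y mem_min_nbhd)
    then show ?thesis
      using mem_min_nbhd_iff[OF assms(2) y(3)] by auto
  qed
  then show "f \<in> topspace X \<rightarrow> topspace Y \<and> (\<forall>x y. alex_le X x y \<longrightarrow> alex_le Y (f x) (f y))"
    using f by (auto simp: continuous_map)
next
  assume f: "f \<in> topspace X \<rightarrow> topspace Y \<and> (\<forall>x y. alex_le X x y \<longrightarrow> alex_le Y (f x) (f y))"
  show "continuous_map X Y f"
    unfolding continuous_map_def
  proof (intro conjI allI impI)
    fix W assume W: "openin Y W"
    show "openin X {x \<in> topspace X. f x \<in> W}"
    proof (rule openin_alexandroff[OF assms(1)])
      fix x y assume "alex_le X x y" "y \<in> {x \<in> topspace X. f x \<in> W}"
      then show "x \<in> {x \<in> topspace X. f x \<in> W}"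
        using f alex_le_open[OF _ W, of "f x" "f y"] alex_le_topspace[of X x y] by simp
    qed auto
  qed (use f in auto)
qed

text \<open>Around \<open>f p\<close> there is a smallest open set, so continuity at
  \<open>p\<close> is a single condition with one radius. Paths and homotopies are handled in this
  form below.\<close>

lemma continuous_map_alexandroff_metric:
  fixes S :: "'b::metric_space set"
  assumes "alexandroff_space X"
  shows "continuous_map (top_of_set S) X f \<longleftrightarrow>
    f \<in> S \<rightarrow> topspace X \<and> (\<forall>p\<in>S. \<exists>\<epsilon>>0. \<forall>q\<in>S. dist q p < \<epsilon> \<longrightarrow> alex_le X (f q) (f p))"
proof
  assume f: "continuous_map (top_of_set S) X f"
  then have fS: "f \<in> S \<rightarrow> topspace X"
    by (auto simp: continuous_map)
  have "\<exists>\<epsilon>>0. \<forall>q\<in>S. dist q p < \<epsilon> \<longrightarrow> alex_le X (f q) (f p)" if p: "p \<in> S" for p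
  proof -
    have fp: "f p \<in> topspace X"
      using fS p by auto
    have "openin (top_of_set S) {q \<in> S. f q \<in> min_nbhd X (f p)}"
      using f openin_min_nbhd[OF assms fp] by (simp add: continuous_map)
    then obtain \<epsilon> where "\<epsilon> > 0" "\<forall>q\<in>S. dist q p < \<epsilon> \<longrightarrow> q \<in> {q \<in> S. f q \<in> min_nbhd X (f p)}"
      unfolding openin_euclidean_subtopology_iff using p mem_min_nbhd[of "f p" X] by blast
    then show ?thesis
      using mem_min_nbhd_iff[OF assms fp] by auto
  qed
  with fS show "f \<in> S \<rightarrow> topspace X \<and>
      (\<forall>p\<in>S. \<exists>\<epsilon>>0. \<forall>q\<in>S. dist q p < \<epsilon> \<longrightarrow> alex_le X (f q) (f p))"
    by auto
next
  assume f: "f \<in> S \<rightarrow> topspace X \<and>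
      (\<forall>p\<in>S. \<exists>\<epsilon>>0. \<forall>q\<in>S. dist q p < \<epsilon> \<longrightarrow> alex_le X (f q) (f p))"
  show "continuous_map (top_of_set S) X f"
    unfolding continuous_map_def
  proof (intro conjI allI impI)
    fix W assume W: "openin X W"
    show "openin (top_of_set S) {x \<in> topspace (top_of_set S). f x \<in> W}"
      unfolding openin_euclidean_subtopology_iff
    proof (intro conjI ballI)
      fix p assume p: "p \<in> {x \<in> topspace (top_of_set S). f x \<in> W}"
      then obtain \<epsilon> where "\<epsilon> > 0" "\<forall>q\<in>S. dist q p < \<epsilon> \<longrightarrow> alex_le X (f q) (f p)"
        using f by auto
      then show "\<exists>e>0. \<forall>x'\<in>S. dist x' p < e \<longrightarrow> x' \<in> {x \<in> topspace (top_of_set S). f x \<in> W}"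
        using alex_le_open[OF _ W] p by auto
    qed auto
  qed (use f in auto)
qed

lemma pathin_alexandroff:
  assumes "alexandroff_space X"
  shows "pathin X \<gamma> \<longleftrightarrow> \<gamma> \<in> {0..1} \<rightarrow> topspace X \<and>
    (\<forall>t\<in>{0..1}. \<exists>\<epsilon>>0. \<forall>s\<in>{0..1}. \<bar>s - t\<bar> < \<epsilon> \<longrightarrow> alex_le X (\<gamma> s) (\<gamma> t))"
  unfolding pathin_def continuous_map_alexandroff_metric[OF assms] by (simp add: dist_real_def)

lemma pathin_eta:
  assumes "alexandroff_space X" "alex_le X x y"
  shows "pathin X (eta x y)"
  unfolding pathin_alexandroff[OF assms(1)]
proof (intro conjI ballI)
  have le: "alex_le X x x" "alex_le X y y"
    using alex_le_topspace[OF assms(2)] by (auto intro: alex_le_refl)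
  fix t :: real assume "t \<in> {0..1}"
  show "\<exists>\<epsilon>>0. \<forall>s\<in>{0..1}. \<bar>s - t\<bar> < \<epsilon> \<longrightarrow> alex_le X (eta x y s) (eta x y t)"
  proof (cases "t < 1")
    case True
    then show ?thesis
      using le by (intro exI[of _ "1 - t"]) (auto simp: eta_def)
  next
    case False
    then show ?thesis
      using le assms(2) by (intro exI[of _ 1]) (auto simp: eta_def)
  qed
qed (use alex_le_topspace[OF assms(2)] in \<open>auto simp: eta_def\<close>)

text \<open>If y \<le> z, the path \<open>eta y z\<close> joins them inside every open set that
  contains z, so path components of open sets are lower sets. This is needed because transversals
  refer to connected components, whereas holonomy is compared along paths.\<close>

lemma locally_path_connected_space_alexandroff:
  assumes "alexandroff_space X"
  shows "locally_path_connected_space X"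
  unfolding locally_path_connected_space_eq_open_path_component_of
proof (intro allI impI)
  fix W x assume Wx: "openin X W \<and> x \<in> W"
  let ?C = "Collect (path_component_of (subtopology X W) x)"
  show "openin X ?C"
  proof (rule openin_alexandroff[OF assms])
    have C: "?C \<subseteq> W \<inter> topspace X"
      using path_component_of_subset_topspace[of "subtopology X W" x] by (auto simp: Collect_mono_iff)
    then show "?C \<subseteq> topspace X"
      by auto
    fix y z assume le: "alex_le X y z" and z: "z \<in> ?C"
    with C have "z \<in> W"
      by auto
    then have "y \<in> W"
      using Wx alex_le_open[OF le] by auto
    then have "pathin (subtopology X W) (eta y z)"
      using pathin_eta[OF assms le] \<open>z \<in> W\<close> unfolding pathin_subtopology by (auto simp: eta_def)
    then have "path_component_of (subtopology X W) y z"
      unfolding path_component_of_def by (intro exI[of _ "eta y z"]) (simp add: eta_def)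
    then show "y \<in> ?C"
      using z path_component_of_trans path_component_of_sym by (metis mem_Collect_eq)
  qed
qed

section \<open>Paths and homotopies\<close>

text \<open>Boxes in place of discs: the distance is at most the sum of the coordinate distances and
  at least each of them. With the two coordinates apart, time can be rescaled without touching the
  homotopy parameter.\<close>

lemma continuous_map_square_alexandroff:
  assumes "alexandroff_space X"
  shows "continuous_map (top_of_set ({0..1::real} \<times> {0..1::real})) X h \<longleftrightarrow>
    (\<forall>s\<in>{0..1}. \<forall>t\<in>{0..1}. h (s, t) \<in> topspace X) \<and>
    (\<forall>s\<in>{0..1}. \<forall>t\<in>{0..1}. \<exists>\<epsilon>>0. \<forall>s'\<in>{0..1}. \<forall>t'\<in>{0..1}.
       \<bar>s' - s\<bar> < \<epsilon> \<and> \<bar>t' - t\<bar> < \<epsilon> \<longrightarrow> alex_le X (h (s', t')) (h (s, t)))"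
proof -
  have "(\<exists>\<epsilon>>0. \<forall>q\<in>{0..1} \<times> {0..1}. dist q (s, t) < \<epsilon> \<longrightarrow> alex_le X (h q) (h (s, t))) \<longleftrightarrow>
    (\<exists>\<epsilon>>0. \<forall>s'\<in>{0..1}. \<forall>t'\<in>{0..1}.
       \<bar>s' - s\<bar> < \<epsilon> \<and> \<bar>t' - t\<bar> < \<epsilon> \<longrightarrow> alex_le X (h (s', t')) (h (s, t)))" (is "?L \<longleftrightarrow> ?R")
    for s t :: real
  proof
    assume ?L
    then obtain \<epsilon> where \<epsilon>: "\<epsilon> > 0"
      "\<And>q. q \<in> {0..1} \<times> {0..1} \<Longrightarrow> dist q (s, t) < \<epsilon> \<Longrightarrow> alex_le X (h q) (h (s, t))"
      by blast
    have "dist (s', t') (s, t) < \<epsilon>" if "\<bar>s' - s\<bar> < \<epsilon> / 2" "\<bar>t' - t\<bar> < \<epsilon> / 2" for s' t'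
    proof -
      have "dist (s', t') (s, t) \<le> \<bar>s' - s\<bar> + \<bar>t' - t\<bar>"
        by (simp add: dist_Pair_Pair dist_real_def) (metis power2_abs sqrt_sum_squares_le_sum abs_ge_zero)
      with that show ?thesis
        by linarith
    qed
    then show ?R
      using \<epsilon> by (intro exI[of _ "\<epsilon> / 2"]) auto
  next
    assume ?R
    then obtain \<epsilon> where \<epsilon>: "\<epsilon> > 0" "\<And>s' t'. s' \<in> {0..1} \<Longrightarrow> t' \<in> {0..1} \<Longrightarrow>
        \<bar>s' - s\<bar> < \<epsilon> \<Longrightarrow> \<bar>t' - t\<bar> < \<epsilon> \<Longrightarrow> alex_le X (h (s', t')) (h (s, t))"
      by blast
    have "alex_le X (h q) (h (s, t))" if q: "q \<in> {0..1} \<times> {0..1}" "dist q (s, t) < \<epsilon>" for q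
    proof -
      obtain s' t' where "q = (s', t')"
        by (cases q)
      then show ?thesis
        using q \<epsilon>(2)[of s' t'] dist_fst_le[of q "(s, t)"] dist_snd_le[of q "(s, t)"]
        by (simp add: dist_real_def)
    qed
    then show ?L
      using \<epsilon>(1) by blast
  qed
  then show ?thesis
    unfolding continuous_map_alexandroff_metric[OF assms] by (auto simp: Pi_iff)
qed

text \<open>The first coordinate of \<open>h\<close> is the homotopy parameter. The end conditions
  range over all real \<open>t\<close>, as in \<open>homotopic_with\<close>; outside the square
  continuity does not constrain \<open>h\<close>.\<close>

lemma path_homotopicI:
  assumes "continuous_map (top_of_set ({0..1::real} \<times> {0..1::real})) X h"
    and "\<And>t. h (0, t) = \<alpha> t" "\<And>t. h (1, t) = \<beta> t"
    and "\<And>s. s \<in> {0..1} \<Longrightarrow> h (s, 0) = \<alpha> 0 \<and> h (s, 1) = \<alpha> 1"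
  shows "path_homotopic X \<alpha> \<beta>"
  unfolding path_homotopic_def homotopic_with_def using assms by (intro exI[of _ h]) simp

lemma path_homotopicE:
  assumes "path_homotopic X \<alpha> \<beta>"
  obtains h where "continuous_map (top_of_set ({0..1::real} \<times> {0..1::real})) X h"
    and "\<And>t. h (0, t) = \<alpha> t" "\<And>t. h (1, t) = \<beta> t"
    and "\<And>s. s \<in> {0..1} \<Longrightarrow> h (s, 0) = \<alpha> 0 \<and> h (s, 1) = \<alpha> 1"
  using assms unfolding path_homotopic_def homotopic_with_def by auto

lemma path_homotopic_imp_pathin: "path_homotopic X \<alpha> \<beta> \<Longrightarrow> pathin X \<alpha> \<and> pathin X \<beta>"
  unfolding path_homotopic_def pathin_def by (rule homotopic_with_imp_continuous_maps)

lemma path_homotopic_imp_ends: "path_homotopic X \<alpha> \<beta> \<Longrightarrow> \<beta> 0 = \<alpha> 0 \<and> \<beta> 1 = \<alpha> 1"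
  unfolding path_homotopic_def using homotopic_with_imp_property by blast

lemma path_homotopic_refl: "pathin X \<alpha> \<Longrightarrow> path_homotopic X \<alpha> \<alpha>"
  by (simp add: path_homotopic_def pathin_def)

lemma path_homotopic_sym:
  assumes "path_homotopic X \<alpha> \<beta>"
  shows "path_homotopic X \<beta> \<alpha>"
  using homotopic_with_symD[OF assms[unfolded path_homotopic_def]] path_homotopic_imp_ends[OF assms]
  by (simp add: path_homotopic_def)

lemma path_homotopic_trans:
  assumes "path_homotopic X \<alpha> \<beta>" "path_homotopic X \<beta> \<gamma>"
  shows "path_homotopic X \<alpha> \<gamma>"
  using homotopic_with_trans[of _ "top_of_set {0..1}" X \<alpha> \<beta> \<gamma>] assms path_homotopic_imp_ends[OF assms(1)]
  by (simp add: path_homotopic_def)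

lemma path_class_eqI: "path_homotopic X \<alpha> \<beta> \<Longrightarrow> path_class X \<alpha> = path_class X \<beta>"
  unfolding path_class_def using path_homotopic_sym path_homotopic_trans by blast

lemma path_class_self: "pathin X \<gamma> \<Longrightarrow> \<gamma> \<in> path_class X \<gamma>"
  by (simp add: path_class_def path_homotopic_refl)

text \<open>Away from the seam t = 1/2 a small box meets only one of the two homotopies. On the seam
  both stay at the common end point \<open>\<alpha> 1 = \<beta> 0\<close>, so the smaller of the two
  radii works.\<close>

lemma path_homotopic_join:
  assumes X: "alexandroff_space X"
    and \<alpha>: "path_homotopic X \<alpha> \<alpha>'" and \<beta>: "path_homotopic X \<beta> \<beta>'" and "\<alpha> 1 = \<beta> 0"
  shows "path_homotopic X (path_join \<alpha> \<beta>) (path_join \<alpha>' \<beta>')"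
proof -
  obtain f where f: "continuous_map (top_of_set ({0..1::real} \<times> {0..1::real})) X f"
    "\<And>t. f (0, t) = \<alpha> t" "\<And>t. f (1, t) = \<alpha>' t"
    "\<And>s. s \<in> {0..1} \<Longrightarrow> f (s, 0) = \<alpha> 0 \<and> f (s, 1) = \<alpha> 1"
    using path_homotopicE[OF \<alpha>] by metis
  obtain g where g: "continuous_map (top_of_set ({0..1::real} \<times> {0..1::real})) X g"
    "\<And>t. g (0, t) = \<beta> t" "\<And>t. g (1, t) = \<beta>' t"
    "\<And>s. s \<in> {0..1} \<Longrightarrow> g (s, 0) = \<beta> 0 \<and> g (s, 1) = \<beta> 1"
    using path_homotopicE[OF \<beta>] by metis
  define h where "h = (\<lambda>(s, t). if t \<le> 1/2 then f (s, 2 * t) else g (s, 2 * t - 1))"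
  note F = f(1)[unfolded continuous_map_square_alexandroff[OF X]]
  note G = g(1)[unfolded continuous_map_square_alexandroff[OF X]]
  have "continuous_map (top_of_set ({0..1::real} \<times> {0..1::real})) X h"
    unfolding continuous_map_square_alexandroff[OF X]
  proof (intro conjI ballI)
    fix s t :: real assume st: "s \<in> {0..1}" "t \<in> {0..1}"
    then show "h (s, t) \<in> topspace X"
      using F G by (simp add: h_def)
    have fex: "\<exists>\<epsilon>>0. \<forall>s'\<in>{0..1}. \<forall>t'\<in>{0..1/2}. \<bar>s' - s\<bar> < \<epsilon> \<and> \<bar>t' - t\<bar> < \<epsilon> \<longrightarrow>
        alex_le X (f (s', 2 * t')) (f (s, 2 * t))" if t: "t \<le> 1/2"
    proof -
      have "2 * t \<in> {0..1}"
        using st t by auto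
      from bspec[OF bspec[OF conjunct2[OF F] st(1)] this]
      obtain \<epsilon> where \<epsilon>: "\<epsilon> > 0" "\<And>s' t'. s' \<in> {0..1} \<Longrightarrow> t' \<in> {0..1} \<Longrightarrow>
          \<bar>s' - s\<bar> < \<epsilon> \<Longrightarrow> \<bar>t' - 2 * t\<bar> < \<epsilon> \<Longrightarrow> alex_le X (f (s', t')) (f (s, 2 * t))"
        by blast
      have "alex_le X (f (s', 2 * t')) (f (s, 2 * t))"
        if "s' \<in> {0..1}" "t' \<in> {0..1/2}" "\<bar>s' - s\<bar> < \<epsilon> / 2" "\<bar>t' - t\<bar> < \<epsilon> / 2" for s' t'
        using that \<epsilon>(1) by (intro \<epsilon>(2)) (auto simp: abs_if split: if_splits)
      then show ?thesis
        using \<epsilon>(1) by (intro exI[of _ "\<epsilon> / 2"]) auto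
    qed
    have gex: "\<exists>\<epsilon>>0. \<forall>s'\<in>{0..1}. \<forall>t'\<in>{1/2..1}. \<bar>s' - s\<bar> < \<epsilon> \<and> \<bar>t' - t\<bar> < \<epsilon> \<longrightarrow>
        alex_le X (g (s', 2 * t' - 1)) (g (s, 2 * t - 1))" if t: "t \<ge> 1/2"
    proof -
      have "2 * t - 1 \<in> {0..1}"
        using st t by auto
      from bspec[OF bspec[OF conjunct2[OF G] st(1)] this]
      obtain \<epsilon> where \<epsilon>: "\<epsilon> > 0" "\<And>s' t'. s' \<in> {0..1} \<Longrightarrow> t' \<in> {0..1} \<Longrightarrow>
          \<bar>s' - s\<bar> < \<epsilon> \<Longrightarrow> \<bar>t' - (2 * t - 1)\<bar> < \<epsilon> \<Longrightarrow> alex_le X (g (s', t')) (g (s, 2 * t - 1))"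
        by blast
      have "alex_le X (g (s', 2 * t' - 1)) (g (s, 2 * t - 1))"
        if "s' \<in> {0..1}" "t' \<in> {1/2..1}" "\<bar>s' - s\<bar> < \<epsilon> / 2" "\<bar>t' - t\<bar> < \<epsilon> / 2" for s' t'
        using that \<epsilon>(1) by (intro \<epsilon>(2)) (auto simp: abs_if split: if_splits)
      then show ?thesis
        using \<epsilon>(1) by (intro exI[of _ "\<epsilon> / 2"]) auto
    qed
    consider "t < 1/2" | "t > 1/2" | "t = 1/2"
      by linarith
    then show "\<exists>\<epsilon>>0. \<forall>s'\<in>{0..1}. \<forall>t'\<in>{0..1}. \<bar>s' - s\<bar> < \<epsilon> \<and> \<bar>t' - t\<bar> < \<epsilon> \<longrightarrow>
        alex_le X (h (s', t')) (h (s, t))"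
    proof cases
      case 1
      then obtain \<epsilon> where \<epsilon>: "\<epsilon> > 0" "\<And>s' t'. s' \<in> {0..1} \<Longrightarrow> t' \<in> {0..1/2} \<Longrightarrow>
          \<bar>s' - s\<bar> < \<epsilon> \<Longrightarrow> \<bar>t' - t\<bar> < \<epsilon> \<Longrightarrow> alex_le X (f (s', 2 * t')) (f (s, 2 * t))"
        using fex by auto
      have "alex_le X (h (s', t')) (h (s, t))" if "s' \<in> {0..1}" "t' \<in> {0..1}"
        "\<bar>s' - s\<bar> < min \<epsilon> (1/2 - t)" "\<bar>t' - t\<bar> < min \<epsilon> (1/2 - t)" for s' t'
        using that 1 \<epsilon>(2)[of s' t'] by (auto simp: h_def abs_if split: if_splits)
      then show ?thesis
        using \<epsilon>(1) 1 by (intro exI[of _ "min \<epsilon> (1/2 - t)"]) auto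
    next
      case 2
      then obtain \<epsilon> where \<epsilon>: "\<epsilon> > 0" "\<And>s' t'. s' \<in> {0..1} \<Longrightarrow> t' \<in> {1/2..1} \<Longrightarrow>
          \<bar>s' - s\<bar> < \<epsilon> \<Longrightarrow> \<bar>t' - t\<bar> < \<epsilon> \<Longrightarrow> alex_le X (g (s', 2 * t' - 1)) (g (s, 2 * t - 1))"
        using gex by auto
      have "alex_le X (h (s', t')) (h (s, t))" if "s' \<in> {0..1}" "t' \<in> {0..1}"
        "\<bar>s' - s\<bar> < min \<epsilon> (t - 1/2)" "\<bar>t' - t\<bar> < min \<epsilon> (t - 1/2)" for s' t'
        using that 2 \<epsilon>(2)[of s' t'] by (auto simp: h_def abs_if split: if_splits)
      then show ?thesis
        using \<epsilon>(1) 2 by (intro exI[of _ "min \<epsilon> (t - 1/2)"]) auto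
    next
      case 3
      have same: "f (s, 2 * t) = g (s, 2 * t - 1)"
        using st f(4)[of s] g(4)[of s] assms(4) unfolding 3 by simp
      obtain \<epsilon> where \<epsilon>: "\<epsilon> > 0" "\<And>s' t'. s' \<in> {0..1} \<Longrightarrow> t' \<in> {0..1/2} \<Longrightarrow>
          \<bar>s' - s\<bar> < \<epsilon> \<Longrightarrow> \<bar>t' - t\<bar> < \<epsilon> \<Longrightarrow> alex_le X (f (s', 2 * t')) (f (s, 2 * t))"
        using fex 3 by auto
      obtain \<epsilon>' where \<epsilon>': "\<epsilon>' > 0" "\<And>s' t'. s' \<in> {0..1} \<Longrightarrow> t' \<in> {1/2..1} \<Longrightarrow>
          \<bar>s' - s\<bar> < \<epsilon>' \<Longrightarrow> \<bar>t' - t\<bar> < \<epsilon>' \<Longrightarrow> alex_le X (g (s', 2 * t' - 1)) (g (s, 2 * t - 1))"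
        using gex 3 by auto
      have "alex_le X (h (s', t')) (h (s, t))" if "s' \<in> {0..1}" "t' \<in> {0..1}"
        "\<bar>s' - s\<bar> < min \<epsilon> \<epsilon>'" "\<bar>t' - t\<bar> < min \<epsilon> \<epsilon>'" for s' t'
      proof (cases "t' \<le> 1/2")
        case True
        then show ?thesis
          using that 3 \<epsilon>(2)[of s' t'] by (simp add: h_def)
      next
        case False
        then show ?thesis
          using that 3 \<epsilon>'(2)[of s' t'] same by (simp add: h_def)
      qed
      then show ?thesis
        using \<epsilon>(1) \<epsilon>'(1) by (intro exI[of _ "min \<epsilon> \<epsilon>'"]) auto
    qed
  qed
  then show ?thesis
    by (rule path_homotopicI) (auto simp: h_def path_join_def f(2-4) g(2-4))
qed

lemma pathin_join:
  assumes "alexandroff_space X" "pathin X \<alpha>" "pathin X \<beta>" "\<alpha> 1 = \<beta> 0"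
  shows "pathin X (path_join \<alpha> \<beta>)"
  using path_homotopic_join[OF assms(1) path_homotopic_refl[OF assms(2)] path_homotopic_refl[OF assms(3)]
      assms(4)] path_homotopic_imp_pathin by blast

text \<open>By \<open>path_homotopic_join\<close> all members of the double union in the definition
  are the same class; the classes of \<open>\<alpha>\<close> and \<open>\<beta>\<close> are
  nonempty, so the union is this class and not empty.\<close>

lemma Comp_fundamental_groupoid:
  assumes "alexandroff_space X" "pathin X \<alpha>" "pathin X \<beta>" "\<alpha> 1 = \<beta> 0"
  shows "Comp (fundamental_groupoid X) x y z (path_class X \<beta>) (path_class X \<alpha>) =
    path_class X (path_join \<alpha> \<beta>)"
proof -
  have "path_class X (path_join \<alpha>' \<beta>') = path_class X (path_join \<alpha> \<beta>)"
    if "\<alpha>' \<in> path_class X \<alpha>" "\<beta>' \<in> path_class X \<beta>" for \<alpha>' \<beta>'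
    using path_homotopic_join[OF assms(1), of \<alpha> \<alpha>' \<beta> \<beta>'] assms(4) that
    by (intro path_class_eqI[symmetric]) (simp add: path_class_def)
  then have "(\<Union>\<alpha>'\<in>path_class X \<alpha>. \<Union>\<beta>'\<in>path_class X \<beta>. path_class X (path_join \<alpha>' \<beta>')) =
      (\<Union>\<alpha>'\<in>path_class X \<alpha>. \<Union>\<beta>'\<in>path_class X \<beta>. path_class X (path_join \<alpha> \<beta>))"
    by (intro SUP_cong refl)
  moreover have "path_class X \<alpha> \<noteq> {}" "path_class X \<beta> \<noteq> {}"
    using path_class_self assms(2,3) by fast+
  ultimately have "(\<Union>\<alpha>'\<in>path_class X \<alpha>. \<Union>\<beta>'\<in>path_class X \<beta>. path_class X (path_join \<alpha>' \<beta>')) =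
      path_class X (path_join \<alpha> \<beta>)"
    by simp
  then show ?thesis
    by (simp add: fundamental_groupoid_def)
qed

text \<open>The straight line homotopy from \<open>\<phi>\<close> to \<open>\<psi>\<close> stays in
  the parameter interval, which is convex, and is then composed with
  \<open>\<gamma>\<close>.\<close>

lemma path_homotopic_reparam:
  assumes "pathin X \<gamma>"
    and "continuous_on {0..1} \<phi>" "\<phi> \<in> {0..1} \<rightarrow> {0..1}"
    and "continuous_on {0..1} \<psi>" "\<psi> \<in> {0..1} \<rightarrow> {0..1}"
    and "\<phi> 0 = \<psi> 0" "\<phi> 1 = \<psi> 1"
  shows "path_homotopic X (\<lambda>t. \<gamma> (\<phi> t)) (\<lambda>t. \<gamma> (\<psi> t))"
proof -
  let ?r = "\<lambda>(s, t). (1 - s) * \<phi> t + s * \<psi> t"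
  have \<phi>: "continuous_on ({0..1} \<times> {0..1}) (\<lambda>p. \<phi> (snd p))"
    by (rule continuous_on_compose2[OF assms(2) continuous_on_snd]) auto
  have \<psi>: "continuous_on ({0..1} \<times> {0..1}) (\<lambda>p. \<psi> (snd p))"
    by (rule continuous_on_compose2[OF assms(4) continuous_on_snd]) auto
  have "continuous_on ({0..1} \<times> {0..1}) ?r"
    unfolding case_prod_beta by (intro continuous_intros \<phi> \<psi>)
  moreover have "(1 - s) * \<phi> t + s * \<psi> t \<in> {0..1}" if "s \<in> {0..1}" "t \<in> {0..1}" for s t
  proof -
    have "\<phi> t \<in> {0..1}" "\<psi> t \<in> {0..1}"
      using that assms(3,5) by auto
    then show ?thesis
      using that convex_bound_le[of "\<phi> t" 1 "\<psi> t" "1 - s" s] by simp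
  qed
  ultimately have "continuous_map (top_of_set ({0..1::real} \<times> {0..1::real})) (top_of_set {0..1}) ?r"
    by (auto simp: continuous_map_in_subtopology)
  then have "continuous_map (top_of_set ({0..1::real} \<times> {0..1::real})) X (\<gamma> \<circ> ?r)"
    using assms(1) unfolding pathin_def by (rule continuous_map_compose)
  then show ?thesis
    by (rule path_homotopicI) (use assms in \<open>auto simp: algebra_simps\<close>)
qed

lemma pathin_reparam:
  assumes "pathin X \<gamma>" "continuous_on {0..1} \<phi>" "\<phi> \<in> {0..1} \<rightarrow> {0..1}"
  shows "pathin X (\<lambda>t. \<gamma> (\<phi> t))"
  using path_homotopic_reparam[OF assms assms(2,3)] path_homotopic_imp_pathin by blast

text \<open>The cone under \<open>m\<close> is simply connected. This is where a homotopy is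
  obtained from the order, and it makes short pieces of a path comparable with \<open>eta\<close>.
  Lifting everything to \<open>m\<close> at once would move the end points, so the paths are first
  made to pause there.\<close>

lemma path_homotopic_in_min_nbhd:
  assumes X: "alexandroff_space X"
    and "pathin X \<alpha>" "pathin X \<beta>" "\<alpha> 0 = \<beta> 0" "\<alpha> 1 = \<beta> 1"
    and \<alpha>m: "\<And>t. t \<in> {0..1} \<Longrightarrow> alex_le X (\<alpha> t) m" and \<beta>m: "\<And>t. t \<in> {0..1} \<Longrightarrow> alex_le X (\<beta> t) m"
  shows "path_homotopic X \<alpha> \<beta>"
proof -
  \<comment> \<open>\<open>\<phi>\<close> is 0 on the first third, 1 on the last third and linear
    between them. During the two pauses both paths stand at a common end point, so \<open>h\<close>
    can be constant near both ends.\<close>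
  define \<phi> :: "real \<Rightarrow> real" where "\<phi> t = max 0 (min 1 (3 * t - 1))" for t
  have \<phi>: "continuous_on {0..1} \<phi>" "\<phi> \<in> {0..1} \<rightarrow> {0..1}" "\<phi> 0 = 0" "\<phi> 1 = 1"
    unfolding \<phi>_def by (auto intro!: continuous_intros)
  have to: "path_homotopic X \<gamma> (\<lambda>t. \<gamma> (\<phi> t))" if "pathin X \<gamma>" for \<gamma>
    using path_homotopic_reparam[OF that, of "\<lambda>t. t" \<phi>] \<phi> by (auto simp: continuous_on_id)
  have p\<alpha>: "pathin X (\<lambda>t. \<alpha> (\<phi> t))" and p\<beta>: "pathin X (\<lambda>t. \<beta> (\<phi> t))"
    using assms \<phi> by (auto intro: pathin_reparam)
  note P\<alpha> = p\<alpha>[unfolded pathin_alexandroff[OF X]] and P\<beta> = p\<beta>[unfolded pathin_alexandroff[OF X]]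
  text \<open>The two slowed down paths agree with constants near their ends; elsewhere the homotopy
    switches from one to the other at time \<open>1/2\<close>, where it may take the maximal value \<open>m\<close>.\<close>
  define h where "h = (\<lambda>(s::real, t). if s < 1/2 then \<alpha> (\<phi> t) else if s > 1/2 then \<beta> (\<phi> t)
    else if t < 1/3 then \<alpha> 0 else if t > 2/3 then \<alpha> 1 else m)"
  have low: "\<phi> t = 0" if "t < 1/3" for t
    using that by (simp add: \<phi>_def)
  have high: "\<phi> t = 1" if "t > 2/3" for t
    using that by (simp add: \<phi>_def)
  have mX: "m \<in> topspace X"
    using \<alpha>m[of 0] alex_le_topspace by force
  have hm: "alex_le X (h (s, t)) m" if "t \<in> {0..1}" for s t
    using that \<alpha>m \<beta>m \<phi>(2) mX by (auto simp: h_def alex_le_refl Pi_iff)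
  have "continuous_map (top_of_set ({0..1::real} \<times> {0..1::real})) X h"
    unfolding continuous_map_square_alexandroff[OF X]
  proof (intro conjI ballI)
    fix s t :: real assume st: "s \<in> {0..1}" "t \<in> {0..1}"
    show hX: "h (s, t) \<in> topspace X"
      using hm[OF st(2)] alex_le_topspace by force
    \<comment> \<open>The strict inequalities in \<open>h\<close> make the segment on which it is
      set to \<open>m\<close> closed: a small box around any other point avoids it, and at its own
      points all neighbouring values lie below \<open>m\<close>.\<close>
    consider "s < 1/2" | "s > 1/2" | "s = 1/2" "t < 1/3" | "s = 1/2" "t > 2/3"
      | "s = 1/2" "1/3 \<le> t" "t \<le> 2/3"
      by linarith
    then show "\<exists>\<epsilon>>0. \<forall>s'\<in>{0..1}. \<forall>t'\<in>{0..1}. \<bar>s' - s\<bar> < \<epsilon> \<and> \<bar>t' - t\<bar> < \<epsilon> \<longrightarrow>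
        alex_le X (h (s', t')) (h (s, t))"
    proof cases
      case 1
      obtain \<epsilon> where \<epsilon>: "\<epsilon> > 0"
        "\<And>t'. t' \<in> {0..1} \<Longrightarrow> \<bar>t' - t\<bar> < \<epsilon> \<Longrightarrow> alex_le X (\<alpha> (\<phi> t')) (\<alpha> (\<phi> t))"
        using bspec[OF conjunct2[OF P\<alpha>] st(2)] by blast
      have "alex_le X (h (s', t')) (h (s, t))" if "t' \<in> {0..1}"
        "\<bar>s' - s\<bar> < min \<epsilon> (1/2 - s)" "\<bar>t' - t\<bar> < min \<epsilon> (1/2 - s)" for s' t'
        using that 1 \<epsilon>(2)[of t'] by (auto simp: h_def abs_if split: if_splits)
      then show ?thesis
        using \<epsilon>(1) 1 by (intro exI[of _ "min \<epsilon> (1/2 - s)"]) auto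
    next
      case 2
      obtain \<epsilon> where \<epsilon>: "\<epsilon> > 0"
        "\<And>t'. t' \<in> {0..1} \<Longrightarrow> \<bar>t' - t\<bar> < \<epsilon> \<Longrightarrow> alex_le X (\<beta> (\<phi> t')) (\<beta> (\<phi> t))"
        using bspec[OF conjunct2[OF P\<beta>] st(2)] by blast
      have "alex_le X (h (s', t')) (h (s, t))" if "t' \<in> {0..1}"
        "\<bar>s' - s\<bar> < min \<epsilon> (s - 1/2)" "\<bar>t' - t\<bar> < min \<epsilon> (s - 1/2)" for s' t'
        using that 2 \<epsilon>(2)[of t'] by (auto simp: h_def abs_if split: if_splits)
      then show ?thesis
        using \<epsilon>(1) 2 by (intro exI[of _ "min \<epsilon> (s - 1/2)"]) auto
    next
      case 3
      have "alex_le X (h (s', t')) (h (s, t))" if "\<bar>t' - t\<bar> < 1/3 - t" for s' t'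
      proof -
        have "t' < 1/3"
          using that by linarith
        then have "h (s', t') = h (s, t)"
          using 3 low[of t'] assms(4) by (simp add: h_def)
        then show ?thesis
          using alex_le_refl[OF hX] by simp
      qed
      then show ?thesis
        using 3(2) by (intro exI[of _ "1/3 - t"]) simp
    next
      case 4
      have "alex_le X (h (s', t')) (h (s, t))" if "\<bar>t' - t\<bar> < t - 2/3" for s' t'
      proof -
        have "t' > 2/3"
          using that by linarith
        then have "h (s', t') = h (s, t)"
          using 4 high[of t'] assms(5) by (simp add: h_def)
        then show ?thesis
          using alex_le_refl[OF hX] by simp
      qed
      then show ?thesis
        using 4(2) by (intro exI[of _ "t - 2/3"]) simp
    next
      case 5
      then have "h (s, t) = m"
        by (simp add: h_def)
      then show ?thesis
        using hm by (intro exI[of _ 1]) auto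
    qed
  qed
  then have "path_homotopic X (\<lambda>t. \<alpha> (\<phi> t)) (\<lambda>t. \<beta> (\<phi> t))"
    by (rule path_homotopicI) (use \<phi>(3,4) assms(4,5) in \<open>auto simp: h_def\<close>)
  then show ?thesis
    using to[OF assms(2)] path_homotopic_sym[OF to[OF assms(3)]] path_homotopic_trans by blast
qed

lemma path_class_subpath_join:
  fixes a b c :: real
  assumes "pathin X \<gamma>" "0 \<le> a" "a \<le> b" "b \<le> c" "c \<le> 1"
  shows "path_class X (path_join (\<lambda>t. \<gamma> (a + (b - a) * t)) (\<lambda>t. \<gamma> (b + (c - b) * t))) =
    path_class X (\<lambda>t. \<gamma> (a + (c - a) * t))"
proof -
  \<comment> \<open>The broken line through \<open>a\<close>, \<open>b\<close> and \<open>c\<close>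
    at times 0, 1/2 and 1, written with \<open>min\<close> and \<open>max\<close> so that it is
    continuous by construction.\<close>
  define \<phi> :: "real \<Rightarrow> real" where "\<phi> t = a + (b - a) * min (2 * t) 1 + (c - b) * max (2 * t - 1) 0" for t
  have box: "a + (y - a) * t \<in> {0..1}" if "t \<in> {0..1}" "a \<le> y" "y \<le> c" for y t
  proof -
    have "0 \<le> (y - a) * t" "(y - a) * t \<le> y - a"
      using that by (auto intro!: mult_left_le mult_nonneg_nonneg)
    then show ?thesis
      using that assms by auto
  qed
  have "\<phi> t \<in> {0..1}" if "t \<in> {0..1}" for t
  proof -
    have "0 \<le> (b - a) * min (2 * t) 1" "(b - a) * min (2 * t) 1 \<le> b - a"
      "0 \<le> (c - b) * max (2 * t - 1) 0" "(c - b) * max (2 * t - 1) 0 \<le> c - b"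
      using that assms by (auto intro!: mult_left_le mult_nonneg_nonneg)
    then show ?thesis
      using assms by (auto simp: \<phi>_def)
  qed
  then have "path_homotopic X (\<lambda>t. \<gamma> (\<phi> t)) (\<lambda>t. \<gamma> (a + (c - a) * t))"
    using box assms by (intro path_homotopic_reparam) (auto simp: \<phi>_def intro!: continuous_intros)
  moreover have "path_join (\<lambda>t. \<gamma> (a + (b - a) * t)) (\<lambda>t. \<gamma> (b + (c - b) * t)) = (\<lambda>t. \<gamma> (\<phi> t))"
    by (rule ext) (auto simp: path_join_def \<phi>_def)
  ultimately show ?thesis
    by (simp add: path_class_eqI)
qed

section \<open>Parallel transport\<close>

text \<open>Connectedness of the interval, for functions into a type without topology. The bisection
  principle \<open>Bolzano\<close> plays the part of a Lebesgue number. Uniqueness of lifts,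
  transport inside a cone and homotopy invariance all reduce to this.\<close>

lemma locally_constant_on_interval:
  fixes f :: "real \<Rightarrow> 'b"
  assumes "a \<le> b"
    and "\<And>t. t \<in> {a..b} \<Longrightarrow> \<exists>\<epsilon>>0. \<forall>s\<in>{a..b}. \<bar>s - t\<bar> < \<epsilon> \<longrightarrow> f s = f t"
  shows "f a = f b"
proof -
  have "a \<le> a \<and> b \<le> b \<longrightarrow> f a = f b"
    using assms(1)
  proof (rule Bolzano[where P = "\<lambda>a' b'. a \<le> a' \<and> b' \<le> b \<longrightarrow> f a' = f b'"])
    fix x assume x: "a \<le> x" "x \<le> b"
    then have "x \<in> {a..b}"
      by simp
    from assms(2)[OF this]
    obtain \<epsilon> where \<epsilon>: "\<epsilon> > 0" "\<And>s. s \<in> {a..b} \<Longrightarrow> \<bar>s - x\<bar> < \<epsilon> \<Longrightarrow> f s = f x"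
      by blast
    show "\<exists>d>0. \<forall>u v. u \<le> x \<and> x \<le> v \<and> v - u < d \<longrightarrow> a \<le> u \<and> v \<le> b \<longrightarrow> f u = f v"
    proof (intro exI[of _ \<epsilon>] conjI allI impI)
      fix u v assume uv: "u \<le> x \<and> x \<le> v \<and> v - u < \<epsilon>" "a \<le> u \<and> v \<le> b"
      have "u \<in> {a..b}" "\<bar>u - x\<bar> < \<epsilon>" "v \<in> {a..b}" "\<bar>v - x\<bar> < \<epsilon>"
        using uv x by auto
      then show "f u = f v"
        using \<epsilon>(2)[of u] \<epsilon>(2)[of v] by simp
    qed (rule \<epsilon>(1))
  qed auto
  then show ?thesis
    by simp
qed

text \<open>Cancellation for products nested to the right, the form into which
  \<open>m_assoc\<close> brings them.\<close>

lemma (in group) inv_cancel: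
  assumes "g \<in> carrier G" "k \<in> carrier G"
  shows "inv g \<otimes> (g \<otimes> k) = k" "g \<otimes> (inv g \<otimes> k) = k"
  using assms by (simp_all add: m_assoc[symmetric])

text \<open>A functor from an Alexandroff space, viewed as a category, to a group.\<close>

locale local_system = group G for G :: "('g, 'c) monoid_scheme" (structure) +
  fixes X :: "'a topology" and \<delta> :: "'a \<Rightarrow> 'a \<Rightarrow> 'g"
  assumes alexandroff: "alexandroff_space X"
    and act_closed [simp, intro]: "alex_le X x y \<Longrightarrow> \<delta> x y \<in> carrier G"
    and act_refl: "x \<in> topspace X \<Longrightarrow> \<delta> x x = \<one>"
    and act_trans: "alex_le X x y \<Longrightarrow> alex_le X y z \<Longrightarrow> \<delta> x z = \<delta> y z \<otimes> \<delta> x y"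
begin

text \<open>Horizontal lifts of \<open>\<gamma>\<close>, restricted to \<open>[a, b]\<close>, to the covering space of \<open>X\<close> with fiber
  \<open>G\<close> determined by \<open>\<delta>\<close>.\<close>

definition lift :: "(real \<Rightarrow> 'a) \<Rightarrow> real \<Rightarrow> real \<Rightarrow> (real \<Rightarrow> 'g) \<Rightarrow> bool" where
  "lift \<gamma> a b \<theta> \<longleftrightarrow> (\<forall>t\<in>{a..b}. \<theta> t \<in> carrier G \<and>
     (\<exists>\<epsilon>>0. \<forall>s\<in>{a..b}. \<bar>s - t\<bar> < \<epsilon> \<longrightarrow>
        alex_le X (\<gamma> s) (\<gamma> t) \<and> \<theta> t = \<delta> (\<gamma> s) (\<gamma> t) \<otimes> \<theta> s))"

lemma liftI:
  assumes "\<And>t. t \<in> {a..b} \<Longrightarrow> \<theta> t \<in> carrier G"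
    and "\<And>t. t \<in> {a..b} \<Longrightarrow> \<exists>\<epsilon>>0. \<forall>s\<in>{a..b}. \<bar>s - t\<bar> < \<epsilon> \<longrightarrow>
      alex_le X (\<gamma> s) (\<gamma> t) \<and> \<theta> t = \<delta> (\<gamma> s) (\<gamma> t) \<otimes> \<theta> s"
  shows "lift \<gamma> a b \<theta>"
  using assms by (simp add: lift_def)

lemma lift_closed: "lift \<gamma> a b \<theta> \<Longrightarrow> t \<in> {a..b} \<Longrightarrow> \<theta> t \<in> carrier G"
  by (simp add: lift_def)

lemma liftE:
  assumes "lift \<gamma> a b \<theta>" "t \<in> {a..b}"
  obtains \<epsilon> where "\<epsilon> > 0" "\<And>s. s \<in> {a..b} \<Longrightarrow> \<bar>s - t\<bar> < \<epsilon> \<Longrightarrow> alex_le X (\<gamma> s) (\<gamma> t)"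
    "\<And>s. s \<in> {a..b} \<Longrightarrow> \<bar>s - t\<bar> < \<epsilon> \<Longrightarrow> \<theta> t = \<delta> (\<gamma> s) (\<gamma> t) \<otimes> \<theta> s"
  using bspec[OF assms(1)[unfolded lift_def] assms(2)] by blast

lemma lift_cong:
  assumes "lift \<gamma> a b \<theta>" "\<And>t. t \<in> {a..b} \<Longrightarrow> \<gamma>' t = \<gamma> t" "\<And>t. t \<in> {a..b} \<Longrightarrow> \<theta>' t = \<theta> t"
  shows "lift \<gamma>' a b \<theta>'"
proof (rule liftI)
  fix t assume t: "t \<in> {a..b}"
  show "\<theta>' t \<in> carrier G"
    using lift_closed[OF assms(1) t] assms(3)[OF t] by simp
  obtain \<epsilon> where \<epsilon>: "\<epsilon> > 0"
    "\<And>s. s \<in> {a..b} \<Longrightarrow> \<bar>s - t\<bar> < \<epsilon> \<Longrightarrow> alex_le X (\<gamma> s) (\<gamma> t)"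
    "\<And>s. s \<in> {a..b} \<Longrightarrow> \<bar>s - t\<bar> < \<epsilon> \<Longrightarrow> \<theta> t = \<delta> (\<gamma> s) (\<gamma> t) \<otimes> \<theta> s"
    by (rule liftE[OF assms(1) t]) (rule that)
  show "\<exists>\<epsilon>>0. \<forall>s\<in>{a..b}. \<bar>s - t\<bar> < \<epsilon> \<longrightarrow>
      alex_le X (\<gamma>' s) (\<gamma>' t) \<and> \<theta>' t = \<delta> (\<gamma>' s) (\<gamma>' t) \<otimes> \<theta>' s"
  proof (intro exI[of _ \<epsilon>] conjI ballI impI)
    fix s assume s: "s \<in> {a..b}" "\<bar>s - t\<bar> < \<epsilon>"
    show "alex_le X (\<gamma>' s) (\<gamma>' t)" "\<theta>' t = \<delta> (\<gamma>' s) (\<gamma>' t) \<otimes> \<theta>' s"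
      unfolding assms(2)[OF t] assms(2)[OF s(1)] assms(3)[OF t] assms(3)[OF s(1)] using \<epsilon>(2,3)[OF s] .
  qed (rule \<epsilon>(1))
qed

lemma lift_subset:
  assumes "lift \<gamma> a b \<theta>" "a \<le> a'" "b' \<le> b"
  shows "lift \<gamma> a' b' \<theta>"
proof (rule liftI)
  fix t assume t: "t \<in> {a'..b'}"
  then have t': "t \<in> {a..b}"
    using assms by auto
  show "\<theta> t \<in> carrier G"
    using lift_closed[OF assms(1) t'] .
  obtain \<epsilon> where \<epsilon>: "\<epsilon> > 0"
    "\<And>s. s \<in> {a..b} \<Longrightarrow> \<bar>s - t\<bar> < \<epsilon> \<Longrightarrow> alex_le X (\<gamma> s) (\<gamma> t)"
    "\<And>s. s \<in> {a..b} \<Longrightarrow> \<bar>s - t\<bar> < \<epsilon> \<Longrightarrow> \<theta> t = \<delta> (\<gamma> s) (\<gamma> t) \<otimes> \<theta> s"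
    by (rule liftE[OF assms(1) t']) (rule that)
  show "\<exists>\<epsilon>>0. \<forall>s\<in>{a'..b'}. \<bar>s - t\<bar> < \<epsilon> \<longrightarrow>
      alex_le X (\<gamma> s) (\<gamma> t) \<and> \<theta> t = \<delta> (\<gamma> s) (\<gamma> t) \<otimes> \<theta> s"
  proof (intro exI[of _ \<epsilon>] conjI ballI impI)
    fix s assume s: "s \<in> {a'..b'}" "\<bar>s - t\<bar> < \<epsilon>"
    then have "s \<in> {a..b}"
      using assms by auto
    then show "alex_le X (\<gamma> s) (\<gamma> t)" "\<theta> t = \<delta> (\<gamma> s) (\<gamma> t) \<otimes> \<theta> s"
      using \<epsilon>(2,3) s(2) by blast+
  qed (rule \<epsilon>(1))
qed

text \<open>Negative \<open>k\<close> is included because reversing a path is the case k = -1. The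
  radius is divided by the absolute value of \<open>k\<close>.\<close>

lemma lift_affine:
  assumes "lift \<gamma> a b \<theta>" "k \<noteq> 0" "\<And>t. t \<in> {a'..b'} \<Longrightarrow> k * t + l \<in> {a..b}"
  shows "lift (\<lambda>t. \<gamma> (k * t + l)) a' b' (\<lambda>t. \<theta> (k * t + l))"
proof (rule liftI)
  fix t assume t: "t \<in> {a'..b'}"
  show "\<theta> (k * t + l) \<in> carrier G"
    using lift_closed[OF assms(1) assms(3)[OF t]] .
  obtain \<epsilon> where \<epsilon>: "\<epsilon> > 0"
    "\<And>s. s \<in> {a..b} \<Longrightarrow> \<bar>s - (k * t + l)\<bar> < \<epsilon> \<Longrightarrow> alex_le X (\<gamma> s) (\<gamma> (k * t + l))"
    "\<And>s. s \<in> {a..b} \<Longrightarrow> \<bar>s - (k * t + l)\<bar> < \<epsilon> \<Longrightarrow>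
       \<theta> (k * t + l) = \<delta> (\<gamma> s) (\<gamma> (k * t + l)) \<otimes> \<theta> s"
    by (rule liftE[OF assms(1) assms(3)[OF t]]) (rule that)
  have "\<bar>(k * s + l) - (k * t + l)\<bar> < \<epsilon>" if "\<bar>s - t\<bar> < \<epsilon> / \<bar>k\<bar>" for s
  proof -
    have "\<bar>(k * s + l) - (k * t + l)\<bar> = \<bar>k\<bar> * \<bar>s - t\<bar>"
      by (simp add: abs_mult[symmetric] algebra_simps)
    then show ?thesis
      using that assms(2) by (simp add: pos_less_divide_eq mult.commute)
  qed
  then show "\<exists>\<epsilon>>0. \<forall>s\<in>{a'..b'}. \<bar>s - t\<bar> < \<epsilon> \<longrightarrow>
      alex_le X (\<gamma> (k * s + l)) (\<gamma> (k * t + l)) \<and>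
      \<theta> (k * t + l) = \<delta> (\<gamma> (k * s + l)) (\<gamma> (k * t + l)) \<otimes> \<theta> (k * s + l)"
    using \<epsilon> assms(2,3) by (intro exI[of _ "\<epsilon> / \<bar>k\<bar>"]) auto
qed

text \<open>The system acts from the left, so right multiplication commutes with it. These are the
  deck transformations of the covering; they move a lift to any prescribed starting value.\<close>

lemma lift_mult_right:
  assumes "lift \<gamma> a b \<theta>" "g \<in> carrier G"
  shows "lift \<gamma> a b (\<lambda>t. \<theta> t \<otimes> g)"
proof (rule liftI)
  fix t assume t: "t \<in> {a..b}"
  show "\<theta> t \<otimes> g \<in> carrier G"
    using lift_closed[OF assms(1) t] assms(2) by simp
  obtain \<epsilon> where \<epsilon>: "\<epsilon> > 0"
    "\<And>s. s \<in> {a..b} \<Longrightarrow> \<bar>s - t\<bar> < \<epsilon> \<Longrightarrow> alex_le X (\<gamma> s) (\<gamma> t)"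
    "\<And>s. s \<in> {a..b} \<Longrightarrow> \<bar>s - t\<bar> < \<epsilon> \<Longrightarrow> \<theta> t = \<delta> (\<gamma> s) (\<gamma> t) \<otimes> \<theta> s"
    by (rule liftE[OF assms(1) t]) (rule that)
  show "\<exists>\<epsilon>>0. \<forall>s\<in>{a..b}. \<bar>s - t\<bar> < \<epsilon> \<longrightarrow>
      alex_le X (\<gamma> s) (\<gamma> t) \<and> \<theta> t \<otimes> g = \<delta> (\<gamma> s) (\<gamma> t) \<otimes> (\<theta> s \<otimes> g)"
  proof (intro exI[of _ \<epsilon>] conjI ballI impI)
    fix s assume s: "s \<in> {a..b}" "\<bar>s - t\<bar> < \<epsilon>"
    show le: "alex_le X (\<gamma> s) (\<gamma> t)"
      using \<epsilon>(2) s .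
    show "\<theta> t \<otimes> g = \<delta> (\<gamma> s) (\<gamma> t) \<otimes> (\<theta> s \<otimes> g)"
      using \<epsilon>(3)[OF s] le lift_closed[OF assms(1) s(1)] assms(2) by (simp add: m_assoc)
  qed (rule \<epsilon>(1))
qed

text \<open>The element \<open>inv (\<theta> t) \<otimes> \<theta>' t\<close> is the deck
  transformation that carries one lift to the other at time t. In it the factors coming from
  \<open>\<delta>\<close> cancel, so it is locally constant.\<close>

lemma lift_unique:
  assumes "lift \<gamma> a b \<theta>" "lift \<gamma> a b \<theta>'" "a \<le> b"
  shows "inv (\<theta> a) \<otimes> \<theta>' a = inv (\<theta> b) \<otimes> \<theta>' b"
proof (rule locally_constant_on_interval[OF assms(3)])
  fix t assume t: "t \<in> {a..b}"
  obtain \<epsilon> where \<epsilon>: "\<epsilon> > 0"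
    "\<And>s. s \<in> {a..b} \<Longrightarrow> \<bar>s - t\<bar> < \<epsilon> \<Longrightarrow> alex_le X (\<gamma> s) (\<gamma> t)"
    "\<And>s. s \<in> {a..b} \<Longrightarrow> \<bar>s - t\<bar> < \<epsilon> \<Longrightarrow> \<theta> t = \<delta> (\<gamma> s) (\<gamma> t) \<otimes> \<theta> s"
    by (rule liftE[OF assms(1) t]) (rule that)
  obtain \<epsilon>' where \<epsilon>': "\<epsilon>' > 0"
    "\<And>s. s \<in> {a..b} \<Longrightarrow> \<bar>s - t\<bar> < \<epsilon>' \<Longrightarrow> alex_le X (\<gamma> s) (\<gamma> t)"
    "\<And>s. s \<in> {a..b} \<Longrightarrow> \<bar>s - t\<bar> < \<epsilon>' \<Longrightarrow> \<theta>' t = \<delta> (\<gamma> s) (\<gamma> t) \<otimes> \<theta>' s"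
    by (rule liftE[OF assms(2) t]) (rule that)
  show "\<exists>\<epsilon>>0. \<forall>s\<in>{a..b}. \<bar>s - t\<bar> < \<epsilon> \<longrightarrow> inv (\<theta> s) \<otimes> \<theta>' s = inv (\<theta> t) \<otimes> \<theta>' t"
  proof (intro exI[of _ "min \<epsilon> \<epsilon>'"] conjI ballI impI)
    fix s assume s: "s \<in> {a..b}" "\<bar>s - t\<bar> < min \<epsilon> \<epsilon>'"
    then have "alex_le X (\<gamma> s) (\<gamma> t)" and eq: "\<theta> t = \<delta> (\<gamma> s) (\<gamma> t) \<otimes> \<theta> s" "\<theta>' t = \<delta> (\<gamma> s) (\<gamma> t) \<otimes> \<theta>' s"
      using \<epsilon>(2,3)[of s] \<epsilon>'(3)[of s] by auto
    then have "\<delta> (\<gamma> s) (\<gamma> t) \<in> carrier G"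
      by simp
    then show "inv (\<theta> s) \<otimes> \<theta>' s = inv (\<theta> t) \<otimes> \<theta>' t"
      using lift_closed[OF assms(1) s(1)] lift_closed[OF assms(2) s(1)]
      by (simp add: eq inv_mult_group m_assoc inv_cancel)
  qed (use \<epsilon>(1) \<epsilon>'(1) in simp)
qed

text \<open>Carried on to \<open>m\<close>, the values of a lift become locally constant, by
  functoriality of \<open>\<delta>\<close>. Hence transport along a path below \<open>m\<close>
  depends on its end points only.\<close>

lemma lift_cone:
  assumes "lift \<gamma> a b \<theta>" "a \<le> b" "\<And>t. t \<in> {a..b} \<Longrightarrow> alex_le X (\<gamma> t) m"
  shows "\<delta> (\<gamma> a) m \<otimes> \<theta> a = \<delta> (\<gamma> b) m \<otimes> \<theta> b"
proof (rule locally_constant_on_interval[OF assms(2)])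
  fix t assume t: "t \<in> {a..b}"
  obtain \<epsilon> where \<epsilon>: "\<epsilon> > 0"
    "\<And>s. s \<in> {a..b} \<Longrightarrow> \<bar>s - t\<bar> < \<epsilon> \<Longrightarrow> alex_le X (\<gamma> s) (\<gamma> t)"
    "\<And>s. s \<in> {a..b} \<Longrightarrow> \<bar>s - t\<bar> < \<epsilon> \<Longrightarrow> \<theta> t = \<delta> (\<gamma> s) (\<gamma> t) \<otimes> \<theta> s"
    by (rule liftE[OF assms(1) t]) (rule that)
  show "\<exists>\<epsilon>>0. \<forall>s\<in>{a..b}. \<bar>s - t\<bar> < \<epsilon> \<longrightarrow> \<delta> (\<gamma> s) m \<otimes> \<theta> s = \<delta> (\<gamma> t) m \<otimes> \<theta> t"
  proof (intro exI[of _ \<epsilon>] conjI ballI impI)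
    fix s assume s: "s \<in> {a..b}" "\<bar>s - t\<bar> < \<epsilon>"
    then show "\<delta> (\<gamma> s) m \<otimes> \<theta> s = \<delta> (\<gamma> t) m \<otimes> \<theta> t"
      using \<epsilon>(2)[OF s] assms(3)[OF t] lift_closed[OF assms(1) s(1)] \<epsilon>(3)[OF s]
      by (simp add: act_trans[of "\<gamma> s" "\<gamma> t" m] m_assoc)
  qed (rule \<epsilon>(1))
qed

text \<open>The second lift is translated by a deck transformation until it agrees with the first at
  \<open>b\<close>. The end value is recorded because the transport of a joined path is computed
  from it.\<close>

lemma lift_glue:
  assumes \<theta>: "lift \<gamma> a b \<theta>" and \<theta>': "lift \<gamma> b c \<theta>'" and "a \<le> b" "b \<le> c"
  shows "\<exists>\<theta>''. lift \<gamma> a c \<theta>'' \<and> \<theta>'' a = \<theta> a \<and> \<theta>'' c = \<theta>' c \<otimes> (inv (\<theta>' b) \<otimes> \<theta> b)"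
proof -
  define g where "g = inv (\<theta>' b) \<otimes> \<theta> b"
  have b: "\<theta> b \<in> carrier G" "\<theta>' b \<in> carrier G"
    using lift_closed[OF \<theta>, of b] lift_closed[OF \<theta>', of b] assms(3,4) by auto
  then have g: "g \<in> carrier G" "\<theta>' b \<otimes> g = \<theta> b"
    by (auto simp: g_def m_assoc[symmetric])
  define \<theta>'' where "\<theta>'' t = (if t \<le> b then \<theta> t else \<theta>' t \<otimes> g)" for t
  have right: "\<theta>'' t = \<theta>' t \<otimes> g" if "b \<le> t" for t
    using that g(2) by (auto simp: \<theta>''_def)
  have "lift \<gamma> a c \<theta>''"
  proof (rule liftI)
    fix t assume t: "t \<in> {a..c}"
    show "\<theta>'' t \<in> carrier G"
      using t lift_closed[OF \<theta>, of t] lift_closed[OF \<theta>', of t] g by (auto simp: \<theta>''_def)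
    \<comment> \<open>This and its mirror image are one-sided conditions. A time beyond
      \<open>b\<close> satisfies the left one vacuously, with its distance to \<open>b\<close> as
      radius, so at every \<open>t\<close> both are available and can be combined.\<close>
    have left_ex: "\<exists>\<epsilon>>0. \<forall>s\<in>{a..b}. \<bar>s - t\<bar> < \<epsilon> \<longrightarrow>
        alex_le X (\<gamma> s) (\<gamma> t) \<and> \<theta>'' t = \<delta> (\<gamma> s) (\<gamma> t) \<otimes> \<theta>'' s"
    proof (cases "t \<le> b")
      case True
      then show ?thesis
        using \<theta> t unfolding lift_def by (simp add: \<theta>''_def)
    next
      case False
      then show ?thesis
        by (intro exI[of _ "t - b"]) auto
    qed
    have right_ex: "\<exists>\<epsilon>>0. \<forall>s\<in>{b..c}. \<bar>s - t\<bar> < \<epsilon> \<longrightarrow>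
        alex_le X (\<gamma> s) (\<gamma> t) \<and> \<theta>'' t = \<delta> (\<gamma> s) (\<gamma> t) \<otimes> \<theta>'' s"
    proof (cases "b \<le> t")
      case True
      then show ?thesis
        using lift_mult_right[OF \<theta>' g(1)] t right unfolding lift_def by simp
    next
      case False
      then show ?thesis
        by (intro exI[of _ "b - t"]) auto
    qed
    obtain \<epsilon> where \<epsilon>: "\<epsilon> > 0" "\<And>s. s \<in> {a..b} \<Longrightarrow> \<bar>s - t\<bar> < \<epsilon> \<Longrightarrow>
        alex_le X (\<gamma> s) (\<gamma> t) \<and> \<theta>'' t = \<delta> (\<gamma> s) (\<gamma> t) \<otimes> \<theta>'' s"
      using left_ex by blast
    obtain \<epsilon>' where \<epsilon>': "\<epsilon>' > 0" "\<And>s. s \<in> {b..c} \<Longrightarrow> \<bar>s - t\<bar> < \<epsilon>' \<Longrightarrow>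
        alex_le X (\<gamma> s) (\<gamma> t) \<and> \<theta>'' t = \<delta> (\<gamma> s) (\<gamma> t) \<otimes> \<theta>'' s"
      using right_ex by blast
    show "\<exists>\<epsilon>>0. \<forall>s\<in>{a..c}. \<bar>s - t\<bar> < \<epsilon> \<longrightarrow>
        alex_le X (\<gamma> s) (\<gamma> t) \<and> \<theta>'' t = \<delta> (\<gamma> s) (\<gamma> t) \<otimes> \<theta>'' s"
    proof (intro exI[of _ "min \<epsilon> \<epsilon>'"] conjI[of "_ > _"] ballI impI)
      fix s assume s: "s \<in> {a..c}" "\<bar>s - t\<bar> < min \<epsilon> \<epsilon>'"
      show "alex_le X (\<gamma> s) (\<gamma> t) \<and> \<theta>'' t = \<delta> (\<gamma> s) (\<gamma> t) \<otimes> \<theta>'' s"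
        using \<epsilon>(2)[of s] \<epsilon>'(2)[of s] s by (cases "s \<le> b") auto
    qed (use \<epsilon>(1) \<epsilon>'(1) in simp)
  qed
  then show ?thesis
    using right[OF assms(4)] assms(3) by (intro exI[of _ \<theta>'']) (simp add: \<theta>''_def g_def)
qed

text \<open>Bisection reduces existence to short intervals, where the path lies below one of its
  values; a right translation then normalizes the starting value.\<close>

lemma lift_exists:
  assumes "pathin X \<gamma>"
  shows "\<exists>\<theta>. lift \<gamma> 0 1 \<theta> \<and> \<theta> 0 = \<one>"
proof -
  note P = assms[unfolded pathin_alexandroff[OF alexandroff]]
  have "0 \<le> (0::real) \<and> (1::real) \<le> 1 \<longrightarrow> (\<exists>\<theta>. lift \<gamma> 0 1 \<theta>)"
  proof (rule Bolzano[where P = "\<lambda>a b. 0 \<le> a \<and> b \<le> 1 \<longrightarrow> (\<exists>\<theta>. lift \<gamma> a b \<theta>)"])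
    fix a b c :: real
    assume "0 \<le> a \<and> b \<le> 1 \<longrightarrow> (\<exists>\<theta>. lift \<gamma> a b \<theta>)" "0 \<le> b \<and> c \<le> 1 \<longrightarrow> (\<exists>\<theta>. lift \<gamma> b c \<theta>)"
      and le: "a \<le> b" "b \<le> c"
    then show "0 \<le> a \<and> c \<le> 1 \<longrightarrow> (\<exists>\<theta>. lift \<gamma> a c \<theta>)"
      using lift_glue[OF _ _ le] by force
  next
    fix x :: real assume x: "0 \<le> x" "x \<le> 1"
    then obtain \<epsilon> where \<epsilon>: "\<epsilon> > 0" "\<And>s. s \<in> {0..1} \<Longrightarrow> \<bar>s - x\<bar> < \<epsilon> \<Longrightarrow> alex_le X (\<gamma> s) (\<gamma> x)"
      using bspec[OF conjunct2[OF P], of x] by auto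
    show "\<exists>d>0. \<forall>a b. a \<le> x \<and> x \<le> b \<and> b - a < d \<longrightarrow> 0 \<le> a \<and> b \<le> 1 \<longrightarrow> (\<exists>\<theta>. lift \<gamma> a b \<theta>)"
    proof (intro exI[of _ \<epsilon>] conjI allI impI)
      fix a b assume ab: "a \<le> x \<and> x \<le> b \<and> b - a < \<epsilon>" "0 \<le> a \<and> b \<le> 1"
      then have near: "alex_le X (\<gamma> s) (\<gamma> x)" if "s \<in> {a..b}" for s
        using that by (intro \<epsilon>(2)) auto
      \<comment> \<open>By \<open>lift_cone\<close>, the product of
        \<open>\<delta> (\<gamma> s) (\<gamma> x)\<close> with a lift at s must be constant; making
        this constant \<one> gives the formula.\<close>
      have "lift \<gamma> a b (\<lambda>s. inv (\<delta> (\<gamma> s) (\<gamma> x)))"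
      proof (rule liftI)
        fix t assume t: "t \<in> {a..b}"
        then show "inv (\<delta> (\<gamma> t) (\<gamma> x)) \<in> carrier G"
          using near by simp
        have "t \<in> {0..1}"
          using t ab by auto
        then obtain \<epsilon>' where \<epsilon>': "\<epsilon>' > 0" "\<And>s. s \<in> {0..1} \<Longrightarrow> \<bar>s - t\<bar> < \<epsilon>' \<Longrightarrow> alex_le X (\<gamma> s) (\<gamma> t)"
          using bspec[OF conjunct2[OF P], of t] by auto
        have "alex_le X (\<gamma> s) (\<gamma> t) \<and> inv (\<delta> (\<gamma> t) (\<gamma> x)) = \<delta> (\<gamma> s) (\<gamma> t) \<otimes> inv (\<delta> (\<gamma> s) (\<gamma> x))"
          if s: "s \<in> {a..b}" "\<bar>s - t\<bar> < \<epsilon>'" for s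
        proof -
          have le: "alex_le X (\<gamma> s) (\<gamma> t)"
            using s ab by (intro \<epsilon>'(2)) auto
          then show ?thesis
            using near[OF t] act_closed[OF le] act_closed[OF near[OF t]]
            by (simp add: act_trans[OF le near[OF t]] inv_mult_group m_assoc[symmetric])
        qed
        then show "\<exists>\<epsilon>>0. \<forall>s\<in>{a..b}. \<bar>s - t\<bar> < \<epsilon> \<longrightarrow> alex_le X (\<gamma> s) (\<gamma> t) \<and>
            inv (\<delta> (\<gamma> t) (\<gamma> x)) = \<delta> (\<gamma> s) (\<gamma> t) \<otimes> inv (\<delta> (\<gamma> s) (\<gamma> x))"
          using \<epsilon>'(1) by blast
      qed
      then show "\<exists>\<theta>. lift \<gamma> a b \<theta>"
        by blast
    qed (rule \<epsilon>(1))
  qed simp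
  then obtain \<theta> where \<theta>: "lift \<gamma> 0 1 \<theta>"
    by auto
  then have "\<theta> 0 \<in> carrier G"
    by (rule lift_closed) simp
  then show ?thesis
    using lift_mult_right[OF \<theta>, of "inv (\<theta> 0)"] by (intro exI[of _ "\<lambda>t. \<theta> t \<otimes> inv (\<theta> 0)"]) simp
qed

section \<open>Transport along a path and its homotopy invariance\<close>

definition transport :: "(real \<Rightarrow> 'a) \<Rightarrow> 'g" where
  "transport \<gamma> = (THE g. \<exists>\<theta>. lift \<gamma> 0 1 \<theta> \<and> \<theta> 0 = \<one> \<and> \<theta> 1 = g)"

text \<open>Lifts may be translated from the right, so any lift computes the transport, whatever its
  starting value. The proof also shows that exactly one element meets the description in
  \<open>transport\<close>.\<close>

lemma transport_lift:
  assumes "lift \<gamma> 0 1 \<theta>"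
  shows "\<theta> 1 = transport \<gamma> \<otimes> \<theta> 0" "transport \<gamma> \<in> carrier G"
proof -
  have c: "\<theta> 0 \<in> carrier G" "\<theta> 1 \<in> carrier G"
    using lift_closed[OF assms] by auto
  have "transport \<gamma> = \<theta> 1 \<otimes> inv (\<theta> 0)"
    unfolding transport_def
  proof (rule the_equality)
    show "\<exists>\<theta>'. lift \<gamma> 0 1 \<theta>' \<and> \<theta>' 0 = \<one> \<and> \<theta>' 1 = \<theta> 1 \<otimes> inv (\<theta> 0)"
      using lift_mult_right[OF assms, of "inv (\<theta> 0)"] c by (intro exI[of _ "\<lambda>t. \<theta> t \<otimes> inv (\<theta> 0)"]) simp
    fix g assume "\<exists>\<theta>'. lift \<gamma> 0 1 \<theta>' \<and> \<theta>' 0 = \<one> \<and> \<theta>' 1 = g"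
    then obtain \<theta>' where \<theta>': "lift \<gamma> 0 1 \<theta>'" "\<theta>' 0 = \<one>" "\<theta>' 1 = g"
      by blast
    have "g \<in> carrier G"
      using lift_closed[OF \<theta>'(1), of 1] \<theta>'(3) by simp
    moreover have "inv (\<theta> 0) = inv (\<theta> 1) \<otimes> g"
      using lift_unique[OF assms \<theta>'(1)] \<theta>'(2,3) c by simp
    ultimately show "g = \<theta> 1 \<otimes> inv (\<theta> 0)"
      using c by (simp add: m_assoc[symmetric])
  qed
  then show "\<theta> 1 = transport \<gamma> \<otimes> \<theta> 0" "transport \<gamma> \<in> carrier G"
    using c by (auto simp: m_assoc)
qed

lemma transport_closed [simp]: "pathin X \<gamma> \<Longrightarrow> transport \<gamma> \<in> carrier G"
  using lift_exists transport_lift(2) by blast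

lemma transport_const:
  assumes "x \<in> topspace X"
  shows "transport (\<lambda>_. x) = \<one>"
proof -
  have lift: "lift (\<lambda>_. x) 0 1 (\<lambda>_. \<one>)"
    by (rule liftI) (use assms in \<open>auto simp: act_refl alex_le_refl intro: exI[of _ 1]\<close>)
  show ?thesis
    using transport_lift[OF lift] by simp
qed

text \<open>The lift jumps together with \<open>eta\<close>, at time 1. An upward jump is allowed at
  its upper end; at an earlier t the radius 1 - t stays clear of it.\<close>

lemma transport_eta:
  assumes "alex_le X x y"
  shows "transport (eta x y) = \<delta> x y"
proof -
  have X: "x \<in> topspace X" "y \<in> topspace X"
    using alex_le_topspace[OF assms] by auto
  have lift: "lift (eta x y) 0 1 (\<lambda>t. if t < 1 then \<one> else \<delta> x y)"
  proof (rule liftI)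
    fix t :: real assume "t \<in> {0..1}"
    show "(if t < 1 then \<one> else \<delta> x y) \<in> carrier G"
      using assms by simp
    show "\<exists>\<epsilon>>0. \<forall>s\<in>{0..1}. \<bar>s - t\<bar> < \<epsilon> \<longrightarrow> alex_le X (eta x y s) (eta x y t) \<and>
        (if t < 1 then \<one> else \<delta> x y) =
        \<delta> (eta x y s) (eta x y t) \<otimes> (if s < 1 then \<one> else \<delta> x y)"
    proof (cases "t < 1")
      case True
      then show ?thesis
        using X by (intro exI[of _ "1 - t"]) (auto simp: eta_def act_refl alex_le_refl)
    next
      case False
      then show ?thesis
        using assms X by (intro exI[of _ 1]) (auto simp: eta_def act_refl alex_le_refl)
    qed
  qed
  show ?thesis
    using transport_lift[OF lift] assms by simp
qed

text \<open>As the system acts from the left, the path that is followed later contributes the left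
  factor, in agreement with composition in the fundamental groupoid.\<close>

lemma transport_join:
  assumes "pathin X \<alpha>" "pathin X \<beta>" "\<alpha> 1 = \<beta> 0"
  shows "transport (path_join \<alpha> \<beta>) = transport \<beta> \<otimes> transport \<alpha>"
proof -
  obtain \<theta> where \<theta>: "lift \<alpha> 0 1 \<theta>" "\<theta> 0 = \<one>"
    using lift_exists[OF assms(1)] by blast
  obtain \<theta>' where \<theta>': "lift \<beta> 0 1 \<theta>'" "\<theta>' 0 = \<one>"
    using lift_exists[OF assms(2)] by blast
  have "lift (\<lambda>t. \<alpha> (2 * t + 0)) 0 (1/2) (\<lambda>t. \<theta> (2 * t + 0))"
    by (rule lift_affine[OF \<theta>(1)]) auto
  then have 1: "lift (path_join \<alpha> \<beta>) 0 (1/2) (\<lambda>t. \<theta> (2 * t))"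
    by (rule lift_cong) (auto simp: path_join_def)
  have "lift (\<lambda>t. \<beta> (2 * t + -1)) (1/2) 1 (\<lambda>t. \<theta>' (2 * t + -1))"
    by (rule lift_affine[OF \<theta>'(1)]) auto
  then have 2: "lift (path_join \<alpha> \<beta>) (1/2) 1 (\<lambda>t. \<theta>' (2 * t - 1))"
  proof (rule lift_cong)
    fix t :: real assume "t \<in> {1/2..1}"
    \<comment> \<open>At the seam \<open>path_join\<close> uses its first branch, so there the claim
      is \<open>\<alpha> 1 = \<beta> 0\<close>.\<close>
    then consider "t = 1/2" | "\<not> t \<le> 1/2"
      by force
    then show "path_join \<alpha> \<beta> t = \<beta> (2 * t + -1)"
    proof cases
      case 1
      then show ?thesis
        unfolding 1 using assms(3) by (simp add: path_join_def)
    qed (simp add: path_join_def)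
  qed simp
  obtain \<theta>'' where \<theta>'': "lift (path_join \<alpha> \<beta>) 0 1 \<theta>''" "\<theta>'' 0 = \<one>" "\<theta>'' 1 = \<theta>' 1 \<otimes> \<theta> 1"
    using lift_glue[OF 1 2] \<theta>(2) \<theta>'(2) lift_closed[OF \<theta>(1), of 1] by auto
  show ?thesis
    using transport_lift[OF \<theta>(1)] transport_lift[OF \<theta>'(1)] transport_lift[OF \<theta>''(1)] \<theta>(2) \<theta>'(2) \<theta>''(2,3)
    by simp
qed

lemma transport_reverse:
  assumes "pathin X \<gamma>"
  shows "transport (\<lambda>t. \<gamma> (1 - t)) = inv (transport \<gamma>)"
proof -
  obtain \<theta> where \<theta>: "lift \<gamma> 0 1 \<theta>" "\<theta> 0 = \<one>"
    using lift_exists[OF assms] by blast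
  have "lift (\<lambda>t. \<gamma> (-1 * t + 1)) 0 1 (\<lambda>t. \<theta> (-1 * t + 1))"
    by (rule lift_affine[OF \<theta>(1)]) auto
  then have lift: "lift (\<lambda>t. \<gamma> (1 - t)) 0 1 (\<lambda>t. \<theta> (1 - t))"
    by (rule lift_cong) (auto simp: algebra_simps)
  show ?thesis
    using transport_lift[OF \<theta>(1)] transport_lift[OF lift] \<theta>(2) inv_equality by simp
qed

text \<open>Each row of the homotopy is lifted separately, starting at \<one>. Lifts of neighbouring
  rows turn out to be related by \<open>\<delta>\<close> at every time. All rows end at the same
  point, where \<open>\<delta>\<close> is the identity, so the end value of the lift is locally
  constant in the homotopy parameter.\<close>

lemma transport_homotopic:
  assumes "path_homotopic X \<alpha> \<beta>"
  shows "transport \<alpha> = transport \<beta>"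
proof -
  obtain h where h: "continuous_map (top_of_set ({0..1::real} \<times> {0..1::real})) X h"
    "\<And>t. h (0, t) = \<alpha> t" "\<And>t. h (1, t) = \<beta> t"
    "\<And>s. s \<in> {0..1} \<Longrightarrow> h (s, 0) = \<alpha> 0 \<and> h (s, 1) = \<alpha> 1"
    using path_homotopicE[OF assms] by metis
  note H = h(1)[unfolded continuous_map_square_alexandroff[OF alexandroff]]
  have near: "\<exists>\<epsilon>>0. \<forall>s'\<in>{0..1}. \<forall>t'\<in>{0..1}. \<bar>s' - s\<bar> < \<epsilon> \<and> \<bar>t' - t\<bar> < \<epsilon> \<longrightarrow>
      alex_le X (h (s', t')) (h (s, t))" if "s \<in> {0..1}" "t \<in> {0..1}" for s t
    using bspec[OF bspec[OF conjunct2[OF H] that(1)] that(2)] .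
  have path: "pathin X (\<lambda>t. h (s, t))" if s: "s \<in> {0..1}" for s
    unfolding pathin_alexandroff[OF alexandroff]
  proof (intro conjI ballI)
    fix t :: real assume "t \<in> {0..1}"
    from near[OF s this] show "\<exists>\<epsilon>>0. \<forall>t'\<in>{0..1}. \<bar>t' - t\<bar> < \<epsilon> \<longrightarrow> alex_le X (h (s, t')) (h (s, t))"
      using s by (metis abs_zero diff_self)
  qed (use H s in auto)
  have "\<forall>s\<in>{0..1}. \<exists>\<theta>. lift (\<lambda>t. h (s, t)) 0 1 \<theta> \<and> \<theta> 0 = \<one>"
    using lift_exists[OF path] by blast
  then obtain \<Theta> where \<Theta>: "\<And>s. s \<in> {0..1} \<Longrightarrow> lift (\<lambda>t. h (s, t)) 0 1 (\<Theta> s)"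
    "\<And>s. s \<in> {0..1} \<Longrightarrow> \<Theta> s 0 = \<one>"
    by metis
  have "\<Theta> 0 1 = \<Theta> 1 1"
  proof (rule locally_constant_on_interval)
    fix s assume s: "s \<in> {0..1::real}"
    let ?R = "\<lambda>t s'. alex_le X (h (s', t)) (h (s, t)) \<and> \<Theta> s t = \<delta> (h (s', t)) (h (s, t)) \<otimes> \<Theta> s' t"
    \<comment> \<open>Compatibility of the family of lifts with \<open>\<delta>\<close> across the
      rows, at time t and near row s; the radius may depend on t.\<close>
    let ?Q = "\<lambda>t. \<exists>\<epsilon>>0. \<forall>s'\<in>{0..1}. \<bar>s' - s\<bar> < \<epsilon> \<longrightarrow> ?R t s'"
    \<comment> \<open>Implications compose, so bisection can carry \<open>?Q\<close> from time 0,
      where all lifts are \<one> over one point, to time 1.\<close>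
    have "0 \<le> (0::real) \<and> (1::real) \<le> 1 \<longrightarrow> ?Q 0 \<longrightarrow> ?Q 1"
    proof (rule Bolzano[where P = "\<lambda>a b. 0 \<le> a \<and> b \<le> 1 \<longrightarrow> ?Q a \<longrightarrow> ?Q b"])
      fix t :: real assume t: "0 \<le> t" "t \<le> 1"
      define m where "m = h (s, t)"
      obtain \<epsilon> where \<epsilon>: "\<epsilon> > 0" "\<And>s' t'. s' \<in> {0..1} \<Longrightarrow> t' \<in> {0..1} \<Longrightarrow>
          \<bar>s' - s\<bar> < \<epsilon> \<Longrightarrow> \<bar>t' - t\<bar> < \<epsilon> \<Longrightarrow> alex_le X (h (s', t')) m"
        using near[OF s, of t] t unfolding m_def by auto
      have "?Q b" if ab: "a \<le> t" "t \<le> b" "b - a < \<epsilon>" "0 \<le> a" "b \<le> 1" and Qa: "?Q a" for a b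
      proof -
        obtain \<epsilon>' where \<epsilon>': "\<epsilon>' > 0" "\<And>s'. s' \<in> {0..1} \<Longrightarrow> \<bar>s' - s\<bar> < \<epsilon>' \<Longrightarrow> ?R a s'"
          using Qa by blast
        obtain \<epsilon>'' where \<epsilon>'': "\<epsilon>'' > 0" "\<And>s'. s' \<in> {0..1} \<Longrightarrow> \<bar>s' - s\<bar> < \<epsilon>'' \<Longrightarrow>
            alex_le X (h (s', b)) (h (s, b))"
        proof -
          have "b \<in> {0..1}"
            using ab t by auto
          from near[OF s this] this that show thesis
            by (metis abs_zero diff_self)
        qed
        have cone: "\<delta> (h (s', a)) m \<otimes> \<Theta> s' a = \<delta> (h (s', b)) m \<otimes> \<Theta> s' b"
          if "s' \<in> {0..1}" "\<bar>s' - s\<bar> < \<epsilon>" for s'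
        proof (rule lift_cone)
          show "lift (\<lambda>t. h (s', t)) a b (\<Theta> s')"
            using lift_subset[OF \<Theta>(1)[OF that(1)]] ab by simp
          show "alex_le X (h (s', t')) m" if "t' \<in> {a..b}" for t'
            using \<open>s' \<in> {0..1}\<close> \<open>\<bar>s' - s\<bar> < \<epsilon>\<close> that ab by (intro \<epsilon>(2)) auto
        qed (use ab in simp)
        have "?R b s'" if s': "s' \<in> {0..1}" "\<bar>s' - s\<bar> < min \<epsilon> (min \<epsilon>' \<epsilon>'')" for s'
        proof
          have ab1: "a \<in> {0..1}" "b \<in> {0..1}"
            using ab t by auto
          show leb: "alex_le X (h (s', b)) (h (s, b))"
            using \<epsilon>''(2) s' by simp
          have lea: "alex_le X (h (s', a)) (h (s, a))" and Ra: "\<Theta> s a = \<delta> (h (s', a)) (h (s, a)) \<otimes> \<Theta> s' a"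
            using \<epsilon>'(2)[of s'] s' by auto
          have m: "alex_le X (h (s, a)) m" "alex_le X (h (s, b)) m"
            using s ab \<epsilon>(1) ab1 by (auto intro!: \<epsilon>(2))
          have c: "\<Theta> s' a \<in> carrier G" "\<Theta> s' b \<in> carrier G" "\<Theta> s a \<in> carrier G" "\<Theta> s b \<in> carrier G"
            using lift_closed[OF \<Theta>(1)] s s'(1) ab1 by auto
          \<comment> \<open>All four corners of the small rectangle lie below \<open>m\<close>, so
            values are compared after being carried to \<open>m\<close>: back along row s, across at
            time \<open>a\<close> by \<open>?Q a\<close>, forward along row s'. Splitting the last
            step at \<open>h (s, b)\<close> leaves a common factor to cancel.\<close>
          have "\<delta> (h (s, b)) m \<otimes> \<Theta> s b = \<delta> (h (s, a)) m \<otimes> \<Theta> s a"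
            using cone[OF s] \<epsilon>(1) by simp
          also have "\<dots> = \<delta> (h (s', a)) m \<otimes> \<Theta> s' a"
            using c by (simp add: Ra act_trans[OF lea m(1)] m_assoc lea m)
          also have "\<dots> = \<delta> (h (s', b)) m \<otimes> \<Theta> s' b"
            using cone[of s'] s' by simp
          also have "\<dots> = \<delta> (h (s, b)) m \<otimes> (\<delta> (h (s', b)) (h (s, b)) \<otimes> \<Theta> s' b)"
            using c by (simp add: act_trans[OF leb m(2)] m_assoc leb m)
          finally show "\<Theta> s b = \<delta> (h (s', b)) (h (s, b)) \<otimes> \<Theta> s' b"
            using c m(2) leb by simp
        qed
        then show ?thesis
          using \<epsilon>(1) \<epsilon>'(1) \<epsilon>''(1) by (intro exI[of _ "min \<epsilon> (min \<epsilon>' \<epsilon>'')"]) simp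
      qed
      then show "\<exists>d>0. \<forall>a b. a \<le> t \<and> t \<le> b \<and> b - a < d \<longrightarrow> 0 \<le> a \<and> b \<le> 1 \<longrightarrow> ?Q a \<longrightarrow> ?Q b"
        using \<epsilon>(1) by blast
    qed auto
    moreover have "?Q 0"
    proof -
      have "\<alpha> 0 \<in> topspace X"
        using path_homotopic_imp_pathin[OF assms] path_start_in_topspace by blast
      then show ?thesis
        using h(4) \<Theta>(2) s by (intro exI[of _ 1]) (simp add: act_refl alex_le_refl)
    qed
    ultimately obtain \<epsilon> where \<epsilon>: "\<epsilon> > 0" "\<And>s'. s' \<in> {0..1} \<Longrightarrow> \<bar>s' - s\<bar> < \<epsilon> \<Longrightarrow> ?R 1 s'"
      by auto
    have "\<Theta> s' 1 = \<Theta> s 1" if "s' \<in> {0..1}" "\<bar>s' - s\<bar> < \<epsilon>" for s'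
    proof -
      have "\<alpha> 1 \<in> topspace X"
        using path_homotopic_imp_pathin[OF assms] path_finish_in_topspace by blast
      then show ?thesis
        using \<epsilon>(2)[OF that] h(4) s that lift_closed[OF \<Theta>(1)[OF that(1)], of 1] by (simp add: act_refl)
    qed
    then show "\<exists>\<epsilon>>0. \<forall>s'\<in>{0..1}. \<bar>s' - s\<bar> < \<epsilon> \<longrightarrow> \<Theta> s' 1 = \<Theta> s 1"
      using \<epsilon>(1) by blast
  qed simp
  moreover have "\<Theta> 0 1 = transport \<alpha>" "\<Theta> 1 1 = transport \<beta>"
    using transport_lift[OF \<Theta>(1)[of 0]] transport_lift[OF \<Theta>(1)[of 1]] \<Theta>(2) h(2,3) by auto
  ultimately show ?thesis
    by simp
qed

text \<open>A natural transformation is a map of coverings: multiplying a lift for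
  \<open>\<delta>\<close> by the components of \<open>a\<close> along the path gives a lift for
  \<open>\<delta>'\<close>, whose two end values yield the formula.\<close>

lemma transport_natural:
  assumes "local_system G X \<delta>'" "pathin X \<gamma>"
    and a: "\<And>x. x \<in> topspace X \<Longrightarrow> a x \<in> carrier G"
    and nat: "\<And>x y. alex_le X x y \<Longrightarrow> a y \<otimes> \<delta> x y = \<delta>' x y \<otimes> a x"
  shows "local_system.transport G X \<delta>' \<gamma> \<otimes> a (\<gamma> 0) = a (\<gamma> 1) \<otimes> transport \<gamma>"
proof -
  interpret D': local_system G X \<delta>'
    by (rule assms)
  obtain \<theta> where \<theta>: "lift \<gamma> 0 1 \<theta>" "\<theta> 0 = \<one>"
    using lift_exists[OF assms(2)] by blast
  have \<gamma>: "\<gamma> t \<in> topspace X" if "t \<in> {0..1}" for t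
    using assms(2) that by (auto simp: pathin_def continuous_map)
  have "D'.lift \<gamma> 0 1 (\<lambda>t. a (\<gamma> t) \<otimes> \<theta> t)"
  proof (rule D'.liftI)
    fix t :: real assume t: "t \<in> {0..1}"
    then show "a (\<gamma> t) \<otimes> \<theta> t \<in> carrier G"
      using a \<gamma> lift_closed[OF \<theta>(1)] by simp
    obtain \<epsilon> where \<epsilon>: "\<epsilon> > 0"
      "\<And>s. s \<in> {0..1} \<Longrightarrow> \<bar>s - t\<bar> < \<epsilon> \<Longrightarrow> alex_le X (\<gamma> s) (\<gamma> t)"
      "\<And>s. s \<in> {0..1} \<Longrightarrow> \<bar>s - t\<bar> < \<epsilon> \<Longrightarrow> \<theta> t = \<delta> (\<gamma> s) (\<gamma> t) \<otimes> \<theta> s"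
      by (rule liftE[OF \<theta>(1) t]) (rule that)
    have "a (\<gamma> t) \<otimes> \<theta> t = \<delta>' (\<gamma> s) (\<gamma> t) \<otimes> (a (\<gamma> s) \<otimes> \<theta> s)" if s: "s \<in> {0..1}" "\<bar>s - t\<bar> < \<epsilon>" for s
    proof -
      have "a (\<gamma> t) \<otimes> \<theta> t = (a (\<gamma> t) \<otimes> \<delta> (\<gamma> s) (\<gamma> t)) \<otimes> \<theta> s"
        using \<epsilon>(2)[OF s] \<epsilon>(3)[OF s] a \<gamma> t lift_closed[OF \<theta>(1) s(1)] by (simp add: m_assoc)
      also have "\<dots> = \<delta>' (\<gamma> s) (\<gamma> t) \<otimes> (a (\<gamma> s) \<otimes> \<theta> s)"
        using nat[OF \<epsilon>(2)[OF s]] \<epsilon>(2)[OF s] a \<gamma> s lift_closed[OF \<theta>(1) s(1)] by (simp add: m_assoc)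
      finally show ?thesis .
    qed
    then show "\<exists>\<epsilon>>0. \<forall>s\<in>{0..1}. \<bar>s - t\<bar> < \<epsilon> \<longrightarrow> alex_le X (\<gamma> s) (\<gamma> t) \<and>
        a (\<gamma> t) \<otimes> \<theta> t = \<delta>' (\<gamma> s) (\<gamma> t) \<otimes> (a (\<gamma> s) \<otimes> \<theta> s)"
      using \<epsilon>(1,2) by blast
  qed
  from D'.transport_lift(1)[OF this] show ?thesis
    using transport_lift[OF \<theta>(1)] \<theta>(2) a[OF \<gamma>, of 0] by simp
qed

end

section \<open>Transport as the only functorial extension of \<open>\<delta>\<close> to path
  classes\<close>

context local_system
begin

text \<open>Following a piece of \<open>\<gamma>\<close> that lies below \<open>m\<close> and then
  jumping to \<open>m\<close> is homotopic to jumping to \<open>m\<close> at once. Functoriality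
  therefore forces the value of \<open>\<tau>\<close> on the piece to be the factor by which a lift
  changes along it. \<open>\<tau>\<close> takes end points as arguments because the arrow map of a
  functor does.\<close>

lemma eq_transportI:
  assumes \<tau>: "\<And>\<gamma>. pathin X \<gamma> \<Longrightarrow> \<tau> (\<gamma> 0) (\<gamma> 1) (path_class X \<gamma>) \<in> carrier G"
    and \<tau>_eta: "\<And>x y. alex_le X x y \<Longrightarrow> \<tau> x y (path_class X (eta x y)) = \<delta> x y"
    and \<tau>_join: "\<And>\<alpha> \<beta>. pathin X \<alpha> \<Longrightarrow> pathin X \<beta> \<Longrightarrow> \<alpha> 1 = \<beta> 0 \<Longrightarrow>
      \<tau> (\<alpha> 0) (\<beta> 1) (path_class X (path_join \<alpha> \<beta>)) =
      \<tau> (\<beta> 0) (\<beta> 1) (path_class X \<beta>) \<otimes> \<tau> (\<alpha> 0) (\<alpha> 1) (path_class X \<alpha>)"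
    and \<gamma>: "pathin X \<gamma>"
  shows "\<tau> (\<gamma> 0) (\<gamma> 1) (path_class X \<gamma>) = transport \<gamma>"
proof -
  obtain \<theta> where \<theta>: "lift \<gamma> 0 1 \<theta>" "\<theta> 0 = \<one>"
    using lift_exists[OF \<gamma>] by blast
  note P = \<gamma>[unfolded pathin_alexandroff[OF alexandroff]]
  define sub where "sub a b = (\<lambda>t. \<gamma> (a + (b - a) * t))" for a b
  have ends: "sub a b 0 = \<gamma> a" "sub a b 1 = \<gamma> b" for a b
    by (simp_all add: sub_def)
  have between: "a + (b - a) * t \<in> {a..b}" if "a \<le> b" "t \<in> {0..1}" for a b t :: real
  proof -
    have "0 \<le> (b - a) * t" "(b - a) * t \<le> b - a"
      using that by (auto intro!: mult_nonneg_nonneg mult_left_le)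
    then show ?thesis
      by simp
  qed
  have path: "pathin X (sub a b)" if "0 \<le> a" "a \<le> b" "b \<le> 1" for a b
    unfolding sub_def
  proof (rule pathin_reparam[OF \<gamma>])
    show "continuous_on {0..1} (\<lambda>t. a + (b - a) * t)"
      by (intro continuous_intros)
    show "(\<lambda>t. a + (b - a) * t) \<in> {0..1} \<rightarrow> {0..1}"
      using between[OF that(2)] that by force
  qed
  define g where "g a b = \<tau> (\<gamma> a) (\<gamma> b) (path_class X (sub a b))" for a b
  have g_closed: "g a b \<in> carrier G" if "0 \<le> a" "a \<le> b" "b \<le> 1" for a b
    using \<tau>[OF path[OF that]] by (simp add: g_def ends)
  \<comment> \<open>The quantity followed by bisection: the value of \<open>\<tau>\<close> on the
    piece from a to b carries the lift at a to the lift at b.\<close>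
  have "0 \<le> (0::real) \<and> (1::real) \<le> 1 \<longrightarrow> g 0 1 \<otimes> \<theta> 0 = \<theta> 1"
  proof (rule Bolzano[where P = "\<lambda>a b. 0 \<le> a \<and> b \<le> 1 \<longrightarrow> g a b \<otimes> \<theta> a = \<theta> b"])
    fix a b c :: real
    assume 1: "0 \<le> a \<and> b \<le> 1 \<longrightarrow> g a b \<otimes> \<theta> a = \<theta> b" "0 \<le> b \<and> c \<le> 1 \<longrightarrow> g b c \<otimes> \<theta> b = \<theta> c"
      and le: "a \<le> b" "b \<le> c"
    show "0 \<le> a \<and> c \<le> 1 \<longrightarrow> g a c \<otimes> \<theta> a = \<theta> c"
    proof
      assume ac: "0 \<le> a \<and> c \<le> 1"
      have "g a c = g b c \<otimes> g a b"
        using \<tau>_join[of "sub a b" "sub b c"] path ac le path_class_subpath_join[OF \<gamma>, of a b c]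
        by (simp add: g_def ends) (simp add: sub_def)
      moreover have "\<theta> a \<in> carrier G"
        using lift_closed[OF \<theta>(1), of a] ac le by auto
      ultimately show "g a c \<otimes> \<theta> a = \<theta> c"
        using 1 ac le g_closed by (simp add: m_assoc)
    qed
  next
    fix x :: real assume x: "0 \<le> x" "x \<le> 1"
    then have "x \<in> {0..1}"
      by simp
    from bspec[OF conjunct2[OF P] this] obtain \<epsilon> where \<epsilon>: "\<epsilon> > 0"
      "\<And>s. s \<in> {0..1} \<Longrightarrow> \<bar>s - x\<bar> < \<epsilon> \<Longrightarrow> alex_le X (\<gamma> s) (\<gamma> x)"
      by blast
    define m where "m = \<gamma> x"
    show "\<exists>d>0. \<forall>a b. a \<le> x \<and> x \<le> b \<and> b - a < d \<longrightarrow> 0 \<le> a \<and> b \<le> 1 \<longrightarrow> g a b \<otimes> \<theta> a = \<theta> b"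
    proof (intro exI[of _ \<epsilon>] conjI allI impI)
      fix a b assume ab: "a \<le> x \<and> x \<le> b \<and> b - a < \<epsilon>" "0 \<le> a \<and> b \<le> 1"
      then have ab': "0 \<le> a" "a \<le> b" "b \<le> 1"
        by auto
      have near: "alex_le X (\<gamma> s) m" if "s \<in> {a..b}" for s
        unfolding m_def using that ab by (intro \<epsilon>(2)) auto
      have nab: "alex_le X (\<gamma> a) m" "alex_le X (\<gamma> b) m"
        using near ab' by auto
      have mX: "alex_le X m m"
        using alex_le_topspace[OF nab(1)] by (simp add: alex_le_refl)
      let ?j = "path_join (sub a b) (eta (\<gamma> b) m)"
      have eta_b: "pathin X (eta (\<gamma> b) m)"
        by (rule pathin_eta[OF alexandroff nab(2)])
      have ends': "eta y m 0 = y" "eta y m 1 = m" for y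
        by (simp_all add: eta_def)
      have "path_homotopic X ?j (eta (\<gamma> a) m)"
      proof (rule path_homotopic_in_min_nbhd[OF alexandroff])
        show "pathin X ?j"
          using path[OF ab'] eta_b by (intro pathin_join[OF alexandroff]) (auto simp: ends ends')
        show "pathin X (eta (\<gamma> a) m)"
          by (rule pathin_eta[OF alexandroff nab(1)])
        show "?j 0 = eta (\<gamma> a) m 0" "?j 1 = eta (\<gamma> a) m 1"
          by (simp_all add: path_join_def ends ends')
        fix t :: real assume t: "t \<in> {0..1}"
        show "alex_le X (eta (\<gamma> a) m t) m"
          using nab mX by (simp add: eta_def)
        show "alex_le X (?j t) m"
        proof (cases "t \<le> 1/2")
          case True
          then have "alex_le X (sub a b (2 * t)) m"
            unfolding sub_def using t between[OF ab'(2), of "2 * t"] by (intro near) simp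
          then show ?thesis
            using True by (simp add: path_join_def)
        qed (use nab mX in \<open>simp add: path_join_def eta_def\<close>)
      qed
      then have "path_class X ?j = path_class X (eta (\<gamma> a) m)"
        by (rule path_class_eqI)
      then have cone: "\<delta> (\<gamma> a) m = \<delta> (\<gamma> b) m \<otimes> g a b"
        using \<tau>_join[OF path[OF ab'] eta_b] \<tau>_eta[OF nab(1)] \<tau>_eta[OF nab(2)]
        by (simp add: g_def ends ends')
      have c: "\<theta> a \<in> carrier G" "\<theta> b \<in> carrier G"
        using lift_closed[OF \<theta>(1)] ab' by auto
      have "\<delta> (\<gamma> a) m \<otimes> \<theta> a = \<delta> (\<gamma> b) m \<otimes> \<theta> b"
        using lift_cone[OF lift_subset[OF \<theta>(1) ab'(1,3)] ab'(2) near] .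
      then have "\<delta> (\<gamma> b) m \<otimes> (g a b \<otimes> \<theta> a) = \<delta> (\<gamma> b) m \<otimes> \<theta> b"
        using c g_closed[OF ab'] nab by (simp add: cone m_assoc)
      then show "g a b \<otimes> \<theta> a = \<theta> b"
        using c g_closed[OF ab'] nab by simp
    qed (rule \<epsilon>(1))
  qed simp
  then have "g 0 1 = \<theta> 1"
    using g_closed[of 0 1] \<theta>(2) by simp
  then show ?thesis
    using transport_lift[OF \<theta>(1)] \<theta>(2) by (simp add: g_def sub_def)
qed

text \<open>An arrow of the fundamental groupoid is a bare set of paths, so the extension is
  evaluated on a chosen member; homotopy invariance makes the choice immaterial.\<close>

lemma transport_path_class:
  assumes "pathin X \<gamma>"
  shows "transport (SOME \<gamma>'. \<gamma>' \<in> path_class X \<gamma>) = transport \<gamma>"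
proof -
  have "(SOME \<gamma>'. \<gamma>' \<in> path_class X \<gamma>) \<in> path_class X \<gamma>"
    using path_class_self[OF assms] by (auto simp: some_in_eq)
  then show ?thesis
    using transport_homotopic unfolding path_class_def by fastforce
qed

end

section \<open>Functors into a group and their extension to the fundamental groupoid\<close>

lemma Obj_alex_cat: "Obj (alex_cat X) = topspace X"
  by (simp add: alex_cat_def thin_cat_def)

lemma Hom_alex_cat: "Hom (alex_cat X) x y = (if alex_le X x y then {arr} else {})"
  using alex_le_topspace[of X x y] by (simp add: alex_cat_def thin_cat_def)

lemma alex_cat_simps: "Ident (alex_cat X) x = arr" "Comp (alex_cat X) x y z g f = arr"
  by (simp_all add: alex_cat_def thin_cat_def)

lemma group_cat_simps:
  "Obj (group_cat G) = {undefined}"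
  "Hom (group_cat G) undefined undefined = carrier G"
  "Ident (group_cat G) x = \<one>\<^bsub>G\<^esub>"
  "Comp (group_cat G) x y z g f = g \<otimes>\<^bsub>G\<^esub> f"
  by (simp_all add: group_cat_def)

lemma fundamental_groupoid_simps:
  "Obj (fundamental_groupoid X) = topspace X"
  "Hom (fundamental_groupoid X) x y = {path_class X \<gamma> | \<gamma>. pathin X \<gamma> \<and> \<gamma> 0 = x \<and> \<gamma> 1 = y}"
  "Ident (fundamental_groupoid X) x = path_class X (\<lambda>_. x)"
  by (simp_all add: fundamental_groupoid_def)

lemma functI:
  assumes "omap T \<in> Obj C \<rightarrow>\<^sub>E Obj D"
    and "\<And>x y. amap T x y \<in> Hom C x y \<rightarrow>\<^sub>E Hom D (omap T x) (omap T y)"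
    and "\<And>x. x \<in> Obj C \<Longrightarrow> amap T x x (Ident C x) = Ident D (omap T x)"
    and "\<And>x y z f g. f \<in> Hom C x y \<Longrightarrow> g \<in> Hom C y z \<Longrightarrow> amap T x z (Comp C x y z g f) =
      Comp D (omap T x) (omap T y) (omap T z) (amap T y z g) (amap T x y f)"
  shows "T \<in> funct C D"
  using assms by (simp add: funct_def)

lemma functD:
  assumes "T \<in> funct C D"
  shows "omap T \<in> Obj C \<rightarrow>\<^sub>E Obj D"
    and "amap T x y \<in> Hom C x y \<rightarrow>\<^sub>E Hom D (omap T x) (omap T y)"
    and "x \<in> Obj C \<Longrightarrow> amap T x x (Ident C x) = Ident D (omap T x)"
    and "f \<in> Hom C x y \<Longrightarrow> g \<in> Hom C y z \<Longrightarrow> amap T x z (Comp C x y z g f) =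
      Comp D (omap T x) (omap T y) (omap T z) (amap T y z g) (amap T x y f)"
  using assms by (simp_all add: funct_def)

text \<open>The only object of \<open>group_cat\<close> is \<open>undefined\<close>, so a functor
  into it is determined by its arrow map.\<close>

lemma funct_group_omap:
  assumes "T \<in> funct C (group_cat G)"
  shows "x \<in> Obj C \<Longrightarrow> omap T x = undefined" "omap T = (\<lambda>x\<in>Obj C. undefined)"
proof -
  have T: "omap T \<in> Obj C \<rightarrow>\<^sub>E {undefined}"
    using functD(1)[OF assms] by (simp add: group_cat_simps)
  then show "omap T x = undefined" if "x \<in> Obj C"
    using that by blast
  show "omap T = (\<lambda>x\<in>Obj C. undefined)"
    using T by (auto simp: PiE_def extensional_def)
qed

lemma local_system_funct:
  fixes X :: "'a topology"
  assumes "alexandroff_space X" "group G"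
    and D: "D \<in> funct (alex_cat X :: ('a, 'm) cat) (group_cat G :: ('o, 'g) cat)"
  shows "local_system G X (\<lambda>x y. amap D x y arr)"
proof -
  note om = funct_group_omap(1)[OF D, unfolded Obj_alex_cat]
  have arr: "arr \<in> Hom (alex_cat X :: ('a, 'm) cat) x y" if "alex_le X x y" for x y
    using that by (simp add: Hom_alex_cat)
  show ?thesis
  proof (intro local_system.intro local_system_axioms.intro assms(1,2))
    fix x y assume le: "alex_le X x y"
    show "amap D x y arr \<in> carrier G"
      using PiE_mem[OF functD(2)[OF D] arr[OF le]] om alex_le_topspace[OF le]
      by (simp add: group_cat_simps)
  next
    fix x assume "x \<in> topspace X"
    then show "amap D x x arr = \<one>\<^bsub>G\<^esub>"
      using functD(3)[OF D, of x] by (simp add: Obj_alex_cat alex_cat_simps group_cat_simps)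
  next
    fix x y z assume "alex_le X x y" "alex_le X y z"
    from functD(4)[OF D arr[OF this(1)] arr[OF this(2)]]
    show "amap D x z arr = amap D y z arr \<otimes>\<^bsub>G\<^esub> amap D x y arr"
      by (simp add: alex_cat_simps group_cat_simps)
  qed
qed

lemma cfunctor_eqI: "omap S = omap T \<Longrightarrow> amap S = amap T \<Longrightarrow> S = (T :: ('o, 'm, 'p, 'n) cfunctor)"
  by (cases S; cases T) simp

text \<open>\<open>groupoid_extension\<close> is a definite description, so its value is known only
  after existence and uniqueness: transport of representatives is an extension, and by
  \<open>eq_transportI\<close> every extension is given by transport.\<close>

lemma groupoid_extension_eq_transport:
  fixes X :: "'a topology"
  assumes X: "alexandroff_space X" and "group G"
    and D: "D \<in> funct (alex_cat X :: ('a, 'm) cat) (group_cat G :: ('o, 'g) cat)"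
    and \<gamma>: "pathin X \<gamma>"
  shows "amap (groupoid_extension X (group_cat G) D) (\<gamma> 0) (\<gamma> 1) (path_class X \<gamma>) =
    local_system.transport G X (\<lambda>x y. amap D x y arr) \<gamma>"
proof -
  let ?\<Pi> = "fundamental_groupoid X" and ?C = "group_cat G :: ('o, 'g) cat"
  interpret local_system G X "\<lambda>x y. amap D x y arr"
    by (rule local_system_funct[OF assms(1-3)])
  have top: "x \<in> topspace X \<and> y \<in> topspace X" if "c \<in> Hom ?\<Pi> x y" for c x y
    using that path_start_in_topspace path_finish_in_topspace
    by (auto simp: fundamental_groupoid_simps)
  have HomI: "path_class X \<gamma> \<in> Hom ?\<Pi> (\<gamma> 0) (\<gamma> 1)" if "pathin X \<gamma>" for \<gamma>
    using that by (auto simp: fundamental_groupoid_simps)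
  define ext where "ext T \<longleftrightarrow> T \<in> funct ?\<Pi> ?C \<and> func_comp (alex_cat X) T (eta_functor X) = D" for T
  have ext_transport: "amap T (\<gamma> 0) (\<gamma> 1) (path_class X \<gamma>) = transport \<gamma>"
    if T: "ext T" and "pathin X \<gamma>" for T \<gamma>
  proof (rule eq_transportI[OF _ _ _ that(2)])
    have F: "T \<in> funct ?\<Pi> ?C" and E: "func_comp (alex_cat X) T (eta_functor X) = D"
      using T by (auto simp: ext_def)
    have om: "omap T x = undefined" if "x \<in> topspace X" for x
      using funct_group_omap(1)[OF F] that by (simp add: fundamental_groupoid_simps)
    show "amap T (\<alpha> 0) (\<alpha> 1) (path_class X \<alpha>) \<in> carrier G" if "pathin X \<alpha>" for \<alpha>
      using PiE_mem[OF functD(2)[OF F] HomI[OF that]] om path_start_in_topspace[OF that]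
        path_finish_in_topspace[OF that] by (simp add: group_cat_simps)
    show "amap T x y (path_class X (eta x y)) = amap D x y arr" if "alex_le X x y" for x y
      unfolding E[symmetric] using that alex_le_topspace[OF that]
      by (simp add: func_comp_def eta_functor_def Hom_alex_cat)
    show "amap T (\<alpha> 0) (\<beta> 1) (path_class X (path_join \<alpha> \<beta>)) =
        amap T (\<beta> 0) (\<beta> 1) (path_class X \<beta>) \<otimes>\<^bsub>G\<^esub> amap T (\<alpha> 0) (\<alpha> 1) (path_class X \<alpha>)"
      if "pathin X \<alpha>" "pathin X \<beta>" "\<alpha> 1 = \<beta> 0" for \<alpha> \<beta>
      using functD(4)[OF F HomI[OF that(1)], of "path_class X \<beta>" "\<beta> 1"] HomI[OF that(2)] that(3)
      by (simp add: group_cat_simps Comp_fundamental_groupoid[OF X that])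
  qed
  have unique: "S = T" if "ext S" "ext T" for S T
  proof (rule cfunctor_eqI)
    have F: "S \<in> funct ?\<Pi> ?C" "T \<in> funct ?\<Pi> ?C"
      using that by (auto simp: ext_def)
    show "omap S = omap T"
      using funct_group_omap(2)[OF F(1)] funct_group_omap(2)[OF F(2)] by simp
    show "amap S = amap T"
    proof (intro ext)
      fix x y c
      show "amap S x y c = amap T x y c"
      proof (cases "c \<in> Hom ?\<Pi> x y")
        case True
        then obtain \<gamma> where "pathin X \<gamma>" "\<gamma> 0 = x" "\<gamma> 1 = y" "c = path_class X \<gamma>"
          by (auto simp: fundamental_groupoid_simps)
        then show ?thesis
          using ext_transport[OF that(1), of \<gamma>] ext_transport[OF that(2), of \<gamma>] by simp
      next
        case False
        then show ?thesis
          using PiE_arb[OF functD(2)[OF F(1)] False] PiE_arb[OF functD(2)[OF F(2)] False] by simp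
      qed
    qed
  qed
  define T :: "('a, (real \<Rightarrow> 'a) set, 'o, 'g) cfunctor" where
    "T = \<lparr>omap = (\<lambda>x\<in>topspace X. undefined),
      amap = (\<lambda>x y. \<lambda>c\<in>Hom ?\<Pi> x y. transport (SOME \<gamma>. \<gamma> \<in> c))\<rparr>"
  have amap_T: "amap T (\<gamma> 0) (\<gamma> 1) (path_class X \<gamma>) = transport \<gamma>" if "pathin X \<gamma>" for \<gamma>
    using HomI[OF that] transport_path_class[OF that] by (simp add: T_def)
  have om: "omap T x = undefined" if "x \<in> topspace X" for x
    using that by (simp add: T_def)
  have "T \<in> funct ?\<Pi> ?C"
  proof (rule functI)
    show "omap T \<in> Obj ?\<Pi> \<rightarrow>\<^sub>E Obj ?C"
      by (simp add: T_def fundamental_groupoid_simps group_cat_simps)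
    show "amap T x y \<in> Hom ?\<Pi> x y \<rightarrow>\<^sub>E Hom ?C (omap T x) (omap T y)" for x y
    proof (rule PiE_I)
      fix c assume c: "c \<in> Hom ?\<Pi> x y"
      then obtain \<gamma> where "pathin X \<gamma>" "\<gamma> 0 = x" "\<gamma> 1 = y" "c = path_class X \<gamma>"
        by (auto simp: fundamental_groupoid_simps)
      then show "amap T x y c \<in> Hom ?C (omap T x) (omap T y)"
        using amap_T[of \<gamma>] top[OF c] om by (auto simp: group_cat_simps)
    qed (simp add: T_def)
    show "amap T x x (Ident ?\<Pi> x) = Ident ?C (omap T x)" if "x \<in> Obj ?\<Pi>" for x
      using that amap_T[of "\<lambda>_. x"] transport_const[of x]
      by (simp add: fundamental_groupoid_simps group_cat_simps)
    fix x y z f g assume fg: "f \<in> Hom ?\<Pi> x y" "g \<in> Hom ?\<Pi> y z"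
    obtain \<alpha> where \<alpha>: "pathin X \<alpha>" "\<alpha> 0 = x" "\<alpha> 1 = y" "f = path_class X \<alpha>"
      using fg(1) by (auto simp: fundamental_groupoid_simps)
    obtain \<beta> where \<beta>: "pathin X \<beta>" "\<beta> 0 = y" "\<beta> 1 = z" "g = path_class X \<beta>"
      using fg(2) by (auto simp: fundamental_groupoid_simps)
    have ab: "\<alpha> 1 = \<beta> 0"
      using \<alpha> \<beta> by simp
    have "path_join \<alpha> \<beta> 0 = x" "path_join \<alpha> \<beta> 1 = z"
      using \<alpha> \<beta> by (auto simp: path_join_def)
    then show "amap T x z (Comp ?\<Pi> x y z g f) =
        Comp ?C (omap T x) (omap T y) (omap T z) (amap T y z g) (amap T x y f)"
      using amap_T[OF pathin_join[OF X \<alpha>(1) \<beta>(1) ab]] amap_T[OF \<alpha>(1)] amap_T[OF \<beta>(1)]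
        transport_join[OF \<alpha>(1) \<beta>(1) ab] \<alpha> \<beta>
      by (simp add: group_cat_simps Comp_fundamental_groupoid[OF X \<alpha>(1) \<beta>(1) ab])
  qed
  moreover have "func_comp (alex_cat X) T (eta_functor X) = D"
  proof (rule cfunctor_eqI)
    show "omap (func_comp (alex_cat X) T (eta_functor X)) = omap D"
      unfolding funct_group_omap(2)[OF D]
      by (auto simp: func_comp_def eta_functor_def Obj_alex_cat om)
    show "amap (func_comp (alex_cat X) T (eta_functor X)) = amap D"
    proof (intro ext)
      fix x y and f :: 'm
      show "amap (func_comp (alex_cat X) T (eta_functor X)) x y f = amap D x y f"
      proof (cases "f \<in> Hom (alex_cat X) x y")
        case True
        then have le: "alex_le X x y" and f: "f = arr"
          by (auto simp: Hom_alex_cat split: if_splits)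
        have "amap T x y (path_class X (eta x y)) = amap D x y arr"
          using amap_T[OF pathin_eta[OF X le]] transport_eta[OF le] by (simp add: eta_def)
        then show ?thesis
          using le alex_le_topspace[OF le] f
          by (simp add: func_comp_def eta_functor_def Hom_alex_cat)
      next
        case False
        then show ?thesis
          using PiE_arb[OF functD(2)[OF D] False] by (simp add: func_comp_def)
      qed
    qed
  qed
  ultimately have "ext T"
    by (simp add: ext_def)
  then have "groupoid_extension X ?C D = T"
    unfolding groupoid_extension_def ext_def[symmetric] using unique by blast
  then show ?thesis
    using amap_T[OF \<gamma>] by simp
qed

section \<open>Natural isomorphism and conjugacy\<close>

text \<open>By local path connectedness the connected component of \<open>x\<close>, which meets the
  transversal, is a path component.\<close>

lemma component_transversal_path:
  assumes "alexandroff_space X" "component_transversal X A" "x \<in> topspace X"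
  shows "\<exists>a\<in>A. path_component_of X a x"
proof -
  have "connected_component_of_set X x \<in> connected_components_of X"
    using assms(3) by (simp add: connected_components_of_def)
  then have "\<exists>!a. a \<in> A \<inter> connected_component_of_set X x"
    by (rule bspec[OF conjunct2[OF assms(2)[unfolded component_transversal_def]]])
  then obtain a where a: "a \<in> A" "connected_component_of X x a"
    by auto
  then have "path_component_of X x a"
    using path_component_eq_connected_component_of[OF
        locally_path_connected_space_alexandroff[OF assms(1)], of x] by (simp add: set_eq_iff)
  with a(1) show ?thesis
    using path_component_of_sym[of X x a] by blast
qed

lemma component_transversal_unique:
  assumes "component_transversal X A" "a \<in> A" "b \<in> A" "path_component_of X a b"
  shows "a = b"
proof -
  have "a \<in> topspace X"
    using assms(1,2) unfolding component_transversal_def by blast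
  then have "connected_component_of_set X a \<in> connected_components_of X"
    "a \<in> connected_component_of_set X a"
    by (auto simp: connected_components_of_def connected_component_of_refl)
  moreover have "b \<in> connected_component_of_set X a"
    using path_component_subset_connected_component_of[of X a] assms(4) by auto
  moreover have "\<exists>!a'. a' \<in> A \<inter> connected_component_of_set X a"
    by (rule bspec[OF conjunct2[OF assms(1)[unfolded component_transversal_def]] calculation(1)])
  ultimately show ?thesis
    using assms(2,3) by blast
qed

text \<open>A natural isomorphism conjugates holonomies by its component at the base point.
  Conversely, a conjugating element at the base point is spread over the component by transport in
  both systems, and conjugacy on loops makes the result natural.\<close>

lemma natural_iff_conjugate:
  fixes G (structure)
  assumes D: "local_system G X \<delta>" and D': "local_system G X \<delta>'"
    and A: "component_transversal X A"
  shows "(\<exists>a. (\<forall>x\<in>topspace X. a x \<in> carrier G) \<and>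
      (\<forall>x y. alex_le X x y \<longrightarrow> a y \<otimes> \<delta> x y = \<delta>' x y \<otimes> a x)) \<longleftrightarrow>
    (\<forall>x\<^sub>0\<in>A. \<exists>c\<in>carrier G. \<forall>\<gamma>. pathin X \<gamma> \<and> \<gamma> 0 = x\<^sub>0 \<and> \<gamma> 1 = x\<^sub>0 \<longrightarrow>
      local_system.transport G X \<delta>' \<gamma> = c \<otimes> local_system.transport G X \<delta> \<gamma> \<otimes> inv c)"
    (is "?nat \<longleftrightarrow> ?conj")
proof -
  interpret local_system G X \<delta>
    by (rule D)
  interpret D': local_system G X \<delta>'
    by (rule D')
  have AX: "A \<subseteq> topspace X"
    using A by (simp add: component_transversal_def)
  show ?thesis
  proof
    assume ?nat
    then obtain a where a: "\<And>x. x \<in> topspace X \<Longrightarrow> a x \<in> carrier G"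
      "\<And>x y. alex_le X x y \<Longrightarrow> a y \<otimes> \<delta> x y = \<delta>' x y \<otimes> a x"
      by blast
    show ?conj
    proof (intro ballI bexI allI impI)
      fix x\<^sub>0 \<gamma> assume "x\<^sub>0 \<in> A" and \<gamma>: "pathin X \<gamma> \<and> \<gamma> 0 = x\<^sub>0 \<and> \<gamma> 1 = x\<^sub>0"
      then have x0: "a x\<^sub>0 \<in> carrier G"
        using a AX by auto
      have "D'.transport \<gamma> \<otimes> a x\<^sub>0 = a x\<^sub>0 \<otimes> transport \<gamma>"
        using transport_natural[OF D' _ a, of \<gamma>] \<gamma> by simp
      then show "D'.transport \<gamma> = a x\<^sub>0 \<otimes> transport \<gamma> \<otimes> inv (a x\<^sub>0)"
        using x0 \<gamma> by (metis D'.transport_closed inv_solve_right m_closed transport_closed)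
    qed (use a AX in auto)
  next
    assume ?conj
    then obtain c where c: "\<And>b. b \<in> A \<Longrightarrow> c b \<in> carrier G"
      "\<And>b \<gamma>. b \<in> A \<Longrightarrow> pathin X \<gamma> \<Longrightarrow> \<gamma> 0 = b \<Longrightarrow> \<gamma> 1 = b \<Longrightarrow>
        D'.transport \<gamma> = c b \<otimes> transport \<gamma> \<otimes> inv (c b)"
      by metis
    have "\<forall>x\<in>topspace X. \<exists>\<gamma>. pathin X \<gamma> \<and> \<gamma> 0 \<in> A \<and> \<gamma> 1 = x"
      using component_transversal_path[OF alexandroff A] unfolding path_component_of_def by blast
    then obtain p where p: "\<And>x. x \<in> topspace X \<Longrightarrow> pathin X (p x)"
      "\<And>x. x \<in> topspace X \<Longrightarrow> p x 0 \<in> A" "\<And>x. x \<in> topspace X \<Longrightarrow> p x 1 = x"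
      by metis
    \<comment> \<open>The only possible value: naturality along the path \<open>p x\<close> forces
      it once the component at the base point is chosen.\<close>
    define a where "a x = D'.transport (p x) \<otimes> c (p x 0) \<otimes> inv (transport (p x))" for x
    have a: "a x \<in> carrier G" if "x \<in> topspace X" for x
      using p[OF that] c by (simp add: a_def)
    have "a y \<otimes> \<delta> x y = \<delta>' x y \<otimes> a x" if le: "alex_le X x y" for x y
    proof -
      have xy: "x \<in> topspace X" "y \<in> topspace X"
        using alex_le_topspace[OF le] by auto
      have eta: "pathin X (eta x y)" "eta x y 0 = x" "eta x y 1 = y"
        using pathin_eta[OF alexandroff le] by (auto simp: eta_def)
      \<comment> \<open>From the base point to x, up to y and back again: conjugacy on this loop
        amounts to naturality along x \<le> y.\<close>
      define q where "q = path_join (p x) (eta x y)"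
      have q: "pathin X q" "q 0 = p x 0" "q 1 = y"
        using pathin_join[OF alexandroff p(1)[OF xy(1)] eta(1)] eta(2,3) p(3)[OF xy(1)]
        by (auto simp: q_def path_join_def)
      define r where "r = (\<lambda>t. p y (1 - t))"
      have r: "pathin X r" "r 0 = y" "r 1 = p y 0"
        using pathin_reparam[OF p(1)[OF xy(2)] continuous_on_diff[OF continuous_on_const continuous_on_id]]
          p(3)[OF xy(2)] by (auto simp: r_def)
      define l where "l = path_join q r"
      have l: "pathin X l" "l 0 = p x 0" "l 1 = p y 0"
        using pathin_join[OF alexandroff q(1) r(1)] q r by (auto simp: l_def path_join_def)
      \<comment> \<open>The paths \<open>p x\<close> and \<open>p y\<close> might start at different
        points of \<open>A\<close>. Since \<open>l\<close> joins these two points, they coincide,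
        and \<open>l\<close> is a loop.\<close>
      have same: "p x 0 = p y 0"
        using component_transversal_unique[OF A p(2)[OF xy(1)] p(2)[OF xy(2)]] l
        unfolding path_component_of_def by blast
      have c': "c (p y 0) \<in> carrier G" "transport (p x) \<in> carrier G" "transport (p y) \<in> carrier G"
        "D'.transport (p x) \<in> carrier G" "D'.transport (p y) \<in> carrier G" "\<delta> x y \<in> carrier G"
        "\<delta>' x y \<in> carrier G"
        using c(1) p xy le by auto
      have "transport l = inv (transport (p y)) \<otimes> (\<delta> x y \<otimes> transport (p x))"
        using transport_join[OF q(1) r(1)] transport_join[OF p(1)[OF xy(1)] eta(1)]
          transport_reverse[OF p(1)[OF xy(2)]] q r p(3)[OF xy(1)] eta(2) transport_eta[OF le]
        by (simp add: l_def q_def r_def)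
      moreover have "D'.transport l = inv (D'.transport (p y)) \<otimes> (\<delta>' x y \<otimes> D'.transport (p x))"
        using D'.transport_join[OF q(1) r(1)] D'.transport_join[OF p(1)[OF xy(1)] eta(1)]
          D'.transport_reverse[OF p(1)[OF xy(2)]] q r p(3)[OF xy(1)] eta(2) D'.transport_eta[OF le]
        by (simp add: l_def q_def r_def)
      moreover have "D'.transport l = c (p y 0) \<otimes> transport l \<otimes> inv (c (p y 0))"
        using c(2)[OF p(2)[OF xy(2)] l(1)] l same by simp
      ultimately have *: "inv (D'.transport (p y)) \<otimes> (\<delta>' x y \<otimes> D'.transport (p x)) =
          c (p y 0) \<otimes> (inv (transport (p y)) \<otimes> (\<delta> x y \<otimes> transport (p x))) \<otimes> inv (c (p y 0))"
        by simp
      have "\<delta>' x y \<otimes> a x = D'.transport (p y) \<otimes> (inv (D'.transport (p y)) \<otimes>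
          (\<delta>' x y \<otimes> D'.transport (p x))) \<otimes> (c (p y 0) \<otimes> inv (transport (p x)))"
        using c' by (simp add: a_def same m_assoc inv_cancel)
      also have "\<dots> = a y \<otimes> \<delta> x y"
        unfolding * using c' by (simp add: a_def m_assoc inv_cancel)
      finally show ?thesis
        by simp
    qed
    with a show ?nat
      by blast
  qed
qed

section \<open>The group of self-homeomorphisms\<close>

lemma homeo_group_simps:
  "g \<in> carrier (homeo_group F) \<longleftrightarrow> g \<in> extensional (topspace F) \<and> homeomorphic_map F F g"
  "g \<otimes>\<^bsub>homeo_group F\<^esub> f = compose (topspace F) g f"
  "\<one>\<^bsub>homeo_group F\<^esub> = (\<lambda>u\<in>topspace F. u)"
  by (auto simp: homeo_group_def)

text \<open>Only values on \<open>topspace X\<close> matter. The group consists of extensional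
  functions, and plain composites and inverses have to be cut down to it.\<close>

lemma homeomorphic_map_restrict:
  "homeomorphic_map X Y (restrict f (topspace X)) \<longleftrightarrow> homeomorphic_map X Y f"
  by (auto elim: homeomorphic_map_eq)

lemma group_homeo_group: "group (homeo_group F)"
proof (rule groupI)
  show "\<one>\<^bsub>homeo_group F\<^esub> \<in> carrier (homeo_group F)"
    using homeomorphic_map_id[of F F, unfolded id_def]
    by (simp add: homeo_group_simps homeomorphic_map_restrict)
  fix f g h
  assume f: "f \<in> carrier (homeo_group F)" and g: "g \<in> carrier (homeo_group F)"
    and h: "h \<in> carrier (homeo_group F)"
  show "f \<otimes>\<^bsub>homeo_group F\<^esub> g \<in> carrier (homeo_group F)"
    using f g homeomorphic_map_compose[of F F g F f] homeomorphic_map_restrict[of F F "f \<circ> g"]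
    by (simp add: homeo_group_simps compose_def comp_def)
  show "f \<otimes>\<^bsub>homeo_group F\<^esub> g \<otimes>\<^bsub>homeo_group F\<^esub> h =
      f \<otimes>\<^bsub>homeo_group F\<^esub> (g \<otimes>\<^bsub>homeo_group F\<^esub> h)"
    using homeomorphic_imp_surjective_map[of F F h] h
    by (auto simp: homeo_group_simps compose_def intro!: restrict_ext)
next
  fix f assume f: "f \<in> carrier (homeo_group F)"
  then have ext: "f \<in> extensional (topspace F)" and im: "f ` topspace F = topspace F"
    by (auto simp: homeo_group_simps homeomorphic_imp_surjective_map)
  show "\<one>\<^bsub>homeo_group F\<^esub> \<otimes>\<^bsub>homeo_group F\<^esub> f = f"
    using ext im by (auto simp: homeo_group_simps compose_def fun_eq_iff extensional_def)
  obtain g where g: "homeomorphic_maps F F f g"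
    using f by (auto simp: homeo_group_simps homeomorphic_map_maps)
  have "restrict g (topspace F) \<in> carrier (homeo_group F)"
    using homeomorphic_maps_sym[of F F f g] g homeomorphic_map_maps[of F F g]
    by (auto simp: homeo_group_simps homeomorphic_map_restrict)
  moreover have "restrict g (topspace F) \<otimes>\<^bsub>homeo_group F\<^esub> f = \<one>\<^bsub>homeo_group F\<^esub>"
    using g im by (auto simp: homeo_group_simps compose_def homeomorphic_maps_def fun_eq_iff)
  ultimately show "\<exists>y\<in>carrier (homeo_group F). y \<otimes>\<^bsub>homeo_group F\<^esub> f = \<one>\<^bsub>homeo_group F\<^esub>"
    by blast
qed

lemma homeo_group_continuous: "g \<in> carrier (homeo_group F) \<Longrightarrow> continuous_map F F g"
  by (simp add: homeo_group_simps homeomorphic_imp_continuous_map)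

lemma homeo_group_apply:
  assumes "g \<in> carrier (homeo_group F)" "u \<in> topspace F"
  shows "g u \<in> topspace F"
    and "(f \<otimes>\<^bsub>homeo_group F\<^esub> g) u = f (g u)"
    and "(inv\<^bsub>homeo_group F\<^esub> g) (g u) = u"
    and "g ((inv\<^bsub>homeo_group F\<^esub> g) u) = u"
proof -
  interpret group "homeo_group F"
    by (rule group_homeo_group)
  have mult: "(f' \<otimes>\<^bsub>homeo_group F\<^esub> g') u = f' (g' u)" for f' g'
    using assms(2) by (simp add: homeo_group_simps compose_def)
  have one: "\<one>\<^bsub>homeo_group F\<^esub> u = u"
    using assms(2) by (simp add: homeo_group_simps)
  show "g u \<in> topspace F"
    using homeo_group_continuous[OF assms(1)] assms(2) by (auto simp: continuous_map)
  show "(f \<otimes>\<^bsub>homeo_group F\<^esub> g) u = f (g u)"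
    by (rule mult)
  show "(inv\<^bsub>homeo_group F\<^esub> g) (g u) = u"
    using mult[of "inv\<^bsub>homeo_group F\<^esub> g" g] assms(1) one by simp
  show "g ((inv\<^bsub>homeo_group F\<^esub> g) u) = u"
    using mult[of g "inv\<^bsub>homeo_group F\<^esub> g"] assms(1) one by simp
qed

lemma homeo_group_eqI:
  assumes "g \<in> carrier (homeo_group F)" "h \<in> carrier (homeo_group F)"
    and "\<And>u. u \<in> topspace F \<Longrightarrow> g u = h u"
  shows "g = h"
  using assms by (auto simp: homeo_group_simps intro: extensionalityI)

section \<open>The total space of a functor to the automorphism group of the fiber\<close>

lemma topspace_restriction:
  assumes "x \<in> topspace X"
  shows "topspace (subtopology X (min_nbhd X x)) = min_nbhd X x"
  using min_nbhd_subset_topspace[OF assms] by auto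

locale homeo_system = local_system "homeo_group F" X \<delta>
  for F :: "'f topology" and X :: "'a topology" and \<delta>
begin

text \<open>The flat bundle with transition maps \<open>\<delta>\<close>. It is
  \<open>grothendieck_space\<close> for a system instead of a functor, so that it applies directly
  to transition maps extracted from a bundle.\<close>

definition total :: "('a \<times> 'f) topology" where
  "total = topology_generated_by
    {{(x, u). alex_le X x y \<and> u \<in> topspace F \<and> \<delta> x y u \<in> V} | y V. y \<in> topspace X \<and> openin F V}"

lemma openin_total:
  "y \<in> topspace X \<Longrightarrow> openin F V \<Longrightarrow>
    openin total {(x, u). alex_le X x y \<and> u \<in> topspace F \<and> \<delta> x y u \<in> V}"
  unfolding total_def by (rule topology_generated_by_Basis) blast

lemma topspace_total: "topspace total = topspace X \<times> topspace F"
proof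
  show "topspace total \<subseteq> topspace X \<times> topspace F"
    unfolding total_def topology_generated_by_topspace using alex_le_topspace[of X] by auto
  show "topspace X \<times> topspace F \<subseteq> topspace total"
  proof clarify
    fix x u assume x: "x \<in> topspace X" and u: "u \<in> topspace F"
    then have "(x, u) \<in> {(z, u). alex_le X z x \<and> u \<in> topspace F \<and> \<delta> z x u \<in> topspace F}"
      using alex_le_refl[OF x] homeo_group_apply(1)[OF act_closed[OF alex_le_refl[OF x]] u] by simp
    then show "(x, u) \<in> topspace total"
      using openin_subset[OF openin_total[OF x openin_topspace]] by blast
  qed
qed

text \<open>The preimage of an open \<open>W\<close> is filled by the basic sets with y in
  \<open>W\<close> and V the whole fiber, because \<open>W\<close> is a lower set.\<close>

lemma continuous_map_total_fst: "continuous_map total X fst"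
  unfolding continuous_map_def
proof (intro conjI allI impI)
  fix W assume W: "openin X W"
  let ?B = "\<lambda>y. {(x, u). alex_le X x y \<and> u \<in> topspace F \<and> \<delta> x y u \<in> topspace F}"
  have WX: "W \<subseteq> topspace X"
    using W by (rule openin_subset)
  have "{p \<in> topspace total. fst p \<in> W} = (\<Union>y\<in>W. ?B y)"
  proof (intro equalityI subsetI)
    fix p assume "p \<in> {p \<in> topspace total. fst p \<in> W}"
    then obtain x u where p: "p = (x, u)" "x \<in> W" "x \<in> topspace X" "u \<in> topspace F"
      by (auto simp: topspace_total)
    then show "p \<in> (\<Union>y\<in>W. ?B y)"
      using alex_le_refl[OF p(3)] homeo_group_apply(1)[OF act_closed[OF alex_le_refl[OF p(3)]] p(4)]
      by auto
  next
    fix p assume "p \<in> (\<Union>y\<in>W. ?B y)"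
    then obtain x u y where p: "p = (x, u)" "y \<in> W" "alex_le X x y" "u \<in> topspace F"
      by auto
    then show "p \<in> {p \<in> topspace total. fst p \<in> W}"
      using alex_le_open[OF p(3) W p(2)] WX by (auto simp: topspace_total)
  qed
  moreover have "openin total (\<Union>y\<in>W. ?B y)"
    using WX by (intro openin_Union) (auto intro!: openin_total)
  ultimately show "openin total {p \<in> topspace total. fst p \<in> W}"
    by simp
qed (auto simp: topspace_total)

text \<open>All points of the minimal neighbourhood lie below \<open>y\<close>, so transport to
  \<open>y\<close> identifies their fibers with the one over \<open>y\<close>. Continuity of this
  chart is built into the basic sets; the work lies in its inverse.\<close>

lemma total_trivialization:
  assumes y: "y \<in> topspace X"
  shows "homeomorphic_maps (subtopology total {e \<in> topspace total. fst e \<in> min_nbhd X y})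
    (prod_topology (subtopology X (min_nbhd X y)) F)
    (\<lambda>(x, u). (x, \<delta> x y u)) (\<lambda>(x, v). (x, (inv\<^bsub>homeo_group F\<^esub> (\<delta> x y)) v))"
proof -
  let ?U = "min_nbhd X y"
  let ?E = "subtopology total {e \<in> topspace total. fst e \<in> ?U}"
  let ?P = "prod_topology (subtopology X ?U) F"
  let ?h = "\<lambda>(x, u). (x, \<delta> x y u)" and ?k = "\<lambda>(x, v). (x, (inv\<^bsub>homeo_group F\<^esub> (\<delta> x y)) v)"
  note U = mem_min_nbhd_iff[OF alexandroff y]
  have topE: "topspace ?E = ?U \<times> topspace F"
    using min_nbhd_subset_topspace[OF y] by (auto simp: topspace_total)
  have topP: "topspace ?P = ?U \<times> topspace F"
    unfolding topspace_prod_topology topspace_restriction[OF y] ..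
  have app: "\<delta> x y u \<in> topspace F" "(inv\<^bsub>homeo_group F\<^esub> (\<delta> x y)) u \<in> topspace F"
    "(inv\<^bsub>homeo_group F\<^esub> (\<delta> x y)) (\<delta> x y u) = u" "\<delta> x y ((inv\<^bsub>homeo_group F\<^esub> (\<delta> x y)) u) = u"
    if "x \<in> ?U" "u \<in> topspace F" for x u
  proof -
    have "\<delta> x y \<in> carrier (homeo_group F)"
      using that(1) U by simp
    then show "\<delta> x y u \<in> topspace F" "(inv\<^bsub>homeo_group F\<^esub> (\<delta> x y)) u \<in> topspace F"
      "(inv\<^bsub>homeo_group F\<^esub> (\<delta> x y)) (\<delta> x y u) = u" "\<delta> x y ((inv\<^bsub>homeo_group F\<^esub> (\<delta> x y)) u) = u"
      using homeo_group_apply[OF _ that(2)] inv_closed by simp_all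
  qed
  have "continuous_map ?E ?P ?h"
    unfolding continuous_map_pairwise
  proof
    have "continuous_map ?E (subtopology X ?U) fst"
      unfolding continuous_map_in_subtopology using topE
      by (auto intro: continuous_map_from_subtopology continuous_map_total_fst)
    then show "continuous_map ?E (subtopology X ?U) (fst \<circ> ?h)"
      by (simp add: comp_def case_prod_beta)
    show "continuous_map ?E F (snd \<circ> ?h)"
      unfolding continuous_map_def
    proof (intro conjI allI impI)
      show "snd \<circ> ?h \<in> topspace ?E \<rightarrow> topspace F"
        unfolding topE using app by auto
      fix V assume V: "openin F V"
      have "{e \<in> topspace ?E. (snd \<circ> ?h) e \<in> V} =
          {(x, u). alex_le X x y \<and> u \<in> topspace F \<and> \<delta> x y u \<in> V} \<inter>
          {e \<in> topspace total. fst e \<in> ?U}"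
        unfolding topE using U min_nbhd_subset_topspace[OF y] by (auto simp: topspace_total)
      then show "openin ?E {e \<in> topspace ?E. (snd \<circ> ?h) e \<in> V}"
        using openin_total[OF y V] by (auto simp: openin_subtopology)
    qed
  qed
  moreover have "continuous_map ?P ?E ?k"
    unfolding continuous_map_in_subtopology
  proof
    have k: "?k ` topspace ?P \<subseteq> ?U \<times> topspace F"
      unfolding topP using app by auto
    then have kt: "?k ` topspace ?P \<subseteq> topspace total"
      unfolding topspace_total
      by (rule order_trans[OF _ Sigma_mono[OF min_nbhd_subset_topspace[OF y] order_refl]])
    show "?k \<in> topspace ?P \<rightarrow> {e \<in> topspace total. fst e \<in> ?U}"
    proof
      fix e assume e: "e \<in> topspace ?P"
      have "?k e \<in> topspace total" "?k e \<in> ?U \<times> topspace F"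
        using subsetD[OF kt imageI[OF e]] subsetD[OF k imageI[OF e]] .
      then show "?k e \<in> {e \<in> topspace total. fst e \<in> ?U}"
        by (simp add: mem_Times_iff)
    qed
    show "continuous_map ?P total ?k"
      unfolding total_def
    proof (rule continuous_on_generated_topo)
      show "?k ` topspace ?P \<subseteq> \<Union> {{(x, u). alex_le X x y \<and> u \<in> topspace F \<and> \<delta> x y u \<in> V} | y V.
          y \<in> topspace X \<and> openin F V}"
        using kt unfolding total_def topology_generated_by_topspace .
      fix B assume "B \<in> {{(x, u). alex_le X x y \<and> u \<in> topspace F \<and> \<delta> x y u \<in> V} | y V.
          y \<in> topspace X \<and> openin F V}"
      then obtain z V where z: "z \<in> topspace X" and V: "openin F V"
        and B: "B = {(x, u). alex_le X x z \<and> u \<in> topspace F \<and> \<delta> x z u \<in> V}"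
        by blast
      show "openin ?P (?k -` B \<inter> topspace ?P)"
        unfolding openin_prod_topology_alt
      proof (intro allI impI)
        fix x\<^sub>0 v\<^sub>0 assume "(x\<^sub>0, v\<^sub>0) \<in> ?k -` B \<inter> topspace ?P"
        then have x0: "x\<^sub>0 \<in> ?U" "alex_le X x\<^sub>0 z" and v0: "v\<^sub>0 \<in> topspace F"
          "\<delta> x\<^sub>0 z ((inv\<^bsub>homeo_group F\<^esub> (\<delta> x\<^sub>0 y)) v\<^sub>0) \<in> V"
          unfolding topP by (auto simp: B)
        have x0y: "alex_le X x\<^sub>0 y"
          using x0 U by simp
        have x0X: "x\<^sub>0 \<in> topspace X"
          using alex_le_topspace[OF x0y] by simp
        \<comment> \<open>Below \<open>x\<^sub>0\<close> the map \<open>\<delta> x z\<close> after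
          the inverse of \<open>\<delta> x y\<close> does not depend on x, since the common factor
          \<open>\<delta> x x\<^sub>0\<close> cancels. Hence the product of
          \<open>min_nbhd X x\<^sub>0\<close> with the preimage of \<open>V\<close> under
          \<open>g\<close> is the required open box.\<close>
        define g where "g = \<delta> x\<^sub>0 z \<otimes>\<^bsub>homeo_group F\<^esub> inv\<^bsub>homeo_group F\<^esub> (\<delta> x\<^sub>0 y)"
        have g: "g \<in> carrier (homeo_group F)"
          using x0 x0y by (simp add: g_def)
        have gx: "\<delta> x z ((inv\<^bsub>homeo_group F\<^esub> (\<delta> x y)) v) = g v"
          if le: "alex_le X x x\<^sub>0" and v: "v \<in> topspace F" for x v
        proof -
          have xy: "alex_le X x y" and xz: "alex_le X x z"
            using alex_le_trans[OF le] x0y x0 by auto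
          have "\<delta> x z \<otimes>\<^bsub>homeo_group F\<^esub> inv\<^bsub>homeo_group F\<^esub> (\<delta> x y) = g"
            using le x0(2) x0y
            by (simp add: act_trans[OF le x0(2)] act_trans[OF le x0y] g_def inv_mult_group m_assoc inv_cancel)
          then show ?thesis
            using homeo_group_apply(2)[OF inv_closed[OF act_closed[OF xy]] v, of "\<delta> x z"] by simp
        qed
        let ?V = "{v \<in> topspace F. g v \<in> V}"
        show "\<exists>U' V'. openin (subtopology X ?U) U' \<and> openin F V' \<and> x\<^sub>0 \<in> U' \<and> v\<^sub>0 \<in> V' \<and>
            U' \<times> V' \<subseteq> ?k -` B \<inter> topspace ?P"
        proof (intro exI conjI)
          have "min_nbhd X x\<^sub>0 \<subseteq> ?U"
            using x0y by (simp add: alex_le_def)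
          then show "openin (subtopology X ?U) (min_nbhd X x\<^sub>0)"
            using openin_min_nbhd[OF alexandroff x0X] by (auto simp: openin_subtopology)
          show "openin F ?V"
            using homeo_group_continuous[OF g] V by (simp add: continuous_map)
          show "x\<^sub>0 \<in> min_nbhd X x\<^sub>0"
            by (rule mem_min_nbhd)
          show "v\<^sub>0 \<in> ?V"
            using v0 gx[OF alex_le_refl[OF x0X] v0(1)] by simp
          show "min_nbhd X x\<^sub>0 \<times> ?V \<subseteq> ?k -` B \<inter> topspace ?P"
          proof clarify
            fix x v assume x: "x \<in> min_nbhd X x\<^sub>0" and v: "v \<in> topspace F" "g v \<in> V"
            have le: "alex_le X x x\<^sub>0"
              using x mem_min_nbhd_iff[OF alexandroff x0X] by simp
            have "x \<in> ?U" "alex_le X x z"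
              using alex_le_trans[OF le] x0y x0 U by auto
            then show "(x, v) \<in> ?k -` B \<inter> topspace ?P"
              unfolding topP using app[of x v] v gx[OF le v(1)] by (simp add: B)
          qed
        qed
      qed
    qed
  qed
  moreover have "\<forall>e\<in>topspace ?E. ?k (?h e) = e" "\<forall>e\<in>topspace ?P. ?h (?k e) = e"
    unfolding topE topP using app by auto
  ultimately show ?thesis
    unfolding homeomorphic_maps_def by blast
qed

lemma fiber_bundle_total: "fiber_bundle X F total fst"
  unfolding fiber_bundle_def
proof (intro conjI ballI continuous_map_total_fst)
  fix y assume y: "y \<in> topspace X"
  show "\<exists>U h. openin X U \<and> y \<in> U \<and>
      homeomorphic_map (subtopology total {e \<in> topspace total. fst e \<in> U})
        (prod_topology (subtopology X U) F) h \<and>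
      (\<forall>e\<in>topspace total. fst e \<in> U \<longrightarrow> fst (h e) = fst e)"
    using total_trivialization[OF y] openin_min_nbhd[OF alexandroff y] mem_min_nbhd[of y X]
    by (intro exI[of _ "min_nbhd X y"] exI[of _ "\<lambda>(x, u). (x, \<delta> x y u)"])
       (auto simp: homeomorphic_map_maps)
qed

end

section \<open>Fiberwise homeomorphisms\<close>

text \<open>The specialization preorder, in the direction of \<open>alex_le\<close>: for points of
  \<open>S\<close>, b lies in the closure of a.\<close>

definition specializes :: "'a topology \<Rightarrow> 'a \<Rightarrow> 'a \<Rightarrow> bool" where
  "specializes S a b \<longleftrightarrow> (\<forall>V. openin S V \<and> b \<in> V \<longrightarrow> a \<in> V)"

lemma specializes_continuous:
  assumes "continuous_map S T f" "specializes S a b" "b \<in> topspace S"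
  shows "specializes T (f a) (f b)"
  unfolding specializes_def
proof (intro allI impI)
  fix V assume V: "openin T V \<and> f b \<in> V"
  then have "openin S {p \<in> topspace S. f p \<in> V}"
    using assms(1) by (simp add: continuous_map)
  then have "a \<in> {p \<in> topspace S. f p \<in> V}"
    using assms(2,3) V unfolding specializes_def by blast
  then show "f a \<in> V"
    by simp
qed

lemma specializes_antisym:
  assumes "t0_space S" "specializes S a b" "specializes S b a" "a \<in> topspace S" "b \<in> topspace S"
  shows "a = b"
  using assms unfolding t0_space_def specializes_def by metis

lemma specializes_prod:
  assumes "specializes S a b" "specializes T c d"
  shows "specializes (prod_topology S T) (a, c) (b, d)"
  unfolding specializes_def openin_prod_topology_alt
proof (intro allI impI)
  fix W assume W: "(\<forall>x y. (x, y) \<in> W \<longrightarrow>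
      (\<exists>U V. openin S U \<and> openin T V \<and> x \<in> U \<and> y \<in> V \<and> U \<times> V \<subseteq> W)) \<and> (b, d) \<in> W"
  then obtain U V where "openin S U" "openin T V" "b \<in> U" "d \<in> V" "U \<times> V \<subseteq> W"
    by blast
  then show "(a, c) \<in> W"
    using assms unfolding specializes_def by blast
qed

lemma specializes_refl: "specializes S a a"
  by (simp add: specializes_def)

lemma specializes_subtopology_alex_le:
  "alex_le X z x \<Longrightarrow> z \<in> W \<Longrightarrow> specializes (subtopology X W) z x"
  unfolding specializes_def openin_subtopology using alex_le_open[of X z x] by auto

text \<open>Moving down to \<open>z \<le> x\<close> moves the value of \<open>\<Psi>\<close> down in the specialization order of \<open>F\<close>; the
  same for the inverse of \<open>\<Psi>\<close> moves it up, so that the \<open>T\<^sub>0\<close> axiom gives equality.\<close>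

lemma fiberwise_homeo_constant:
  assumes "t0_space F"
    and hom: "homeomorphic_maps (prod_topology (subtopology X W) F) (prod_topology (subtopology X W) F) \<Psi> \<Phi>"
    and fib: "\<And>z u. z \<in> W \<Longrightarrow> u \<in> topspace F \<Longrightarrow> fst (\<Psi> (z, u)) = z"
    and le: "alex_le X z x" and W: "z \<in> W" "x \<in> W" and u: "u \<in> topspace F"
  shows "snd (\<Psi> (z, u)) = snd (\<Psi> (x, u))"
proof -
  let ?P = "prod_topology (subtopology X W) F"
  have cont: "continuous_map ?P ?P \<Psi>" "continuous_map ?P ?P \<Phi>"
    and inv: "\<And>e. e \<in> topspace ?P \<Longrightarrow> \<Phi> (\<Psi> e) = e" "\<And>e. e \<in> topspace ?P \<Longrightarrow> \<Psi> (\<Phi> e) = e"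
    using hom by (auto simp: homeomorphic_maps_def)
  have X: "z \<in> topspace X" "x \<in> topspace X"
    using alex_le_topspace[OF le] by auto
  have P: "(y, v) \<in> topspace ?P" if "y \<in> {x, z}" "v \<in> topspace F" for y v
    using that X W by auto
  have \<Psi>: "\<Psi> (y, v) = (y, snd (\<Psi> (y, v)))" "snd (\<Psi> (y, v)) \<in> topspace F"
    if "y \<in> {x, z}" "v \<in> topspace F" for y v
  proof -
    show "\<Psi> (y, v) = (y, snd (\<Psi> (y, v)))"
      using fib[of y v] that W by (metis empty_iff insert_iff prod.collapse)
    have "\<Psi> (y, v) \<in> topspace ?P"
      using cont(1) P[OF that] by (auto simp: continuous_map)
    then show "snd (\<Psi> (y, v)) \<in> topspace F"
      by auto
  qed
  have base: "specializes ?P (z, v) (x, v)" for v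
    using specializes_prod[OF specializes_subtopology_alex_le[OF le W(1)] specializes_refl] .
  define v where "v = snd (\<Psi> (x, u))"
  have v: "v \<in> topspace F" "\<Psi> (x, u) = (x, v)"
    using \<Psi>[of x u] u by (auto simp: v_def)
  have down: "specializes F (snd (\<Psi> (z, u))) v"
    using specializes_continuous[OF continuous_map_compose[OF cont(1) continuous_map_snd] base[of u]]
      P[of x u] u by (simp add: v_def)
  \<comment> \<open>The point of the fiber over z that \<open>\<Psi>\<close> sends to
    \<open>v\<close>. Continuity of \<open>\<Phi>\<close> puts it below \<open>u\<close>, and
    applying \<open>\<Psi>\<close> within the fiber over z puts \<open>v\<close> below the value at
    \<open>u\<close>.\<close>
  define w where "w = snd (\<Phi> (z, v))"
  have "\<Phi> (z, v) \<in> topspace ?P"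
    using cont(2) P[of z v] v by (auto simp: continuous_map)
  then obtain z' where z': "\<Phi> (z, v) = (z', w)" "z' \<in> W" and w: "w \<in> topspace F"
    by (cases "\<Phi> (z, v)") (auto simp: w_def)
  have "\<Psi> (z', w) = (z, v)"
    using inv(2)[OF P[of z v]] v z' by simp
  then have zw: "z' = z" "\<Psi> (z, w) = (z, v)"
    using fib[OF z'(2) w] by auto
  have "\<Phi> (x, v) = (x, u)"
    using inv(1)[OF P[of x u]] u v(2) by simp
  then have "specializes F w u"
    using specializes_continuous[OF continuous_map_compose[OF cont(2) continuous_map_snd] base[of v]]
      P[of x v] v(1) by (simp add: w_def)
  then have "specializes ?P (z, w) (z, u)"
    by (rule specializes_prod[OF specializes_refl])
  then have up: "specializes F v (snd (\<Psi> (z, u)))"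
    using specializes_continuous[OF continuous_map_compose[OF cont(1) continuous_map_snd], of "(z, w)" "(z, u)"]
      P[of z u] u zw by simp
  show ?thesis
    using specializes_antisym[OF assms(1) down up] \<Psi>(2)[of z u] u v(1) by (simp add: v_def)
qed

text \<open>The inverse of the slice is the slice of \<open>\<Phi>\<close>, which preserves the
  first coordinate because \<open>\<Psi>\<close> does.\<close>

lemma fiberwise_homeo_slice:
  assumes hom: "homeomorphic_maps (prod_topology (subtopology X W) F) (prod_topology (subtopology X W) F) \<Psi> \<Phi>"
    and fib: "\<And>z u. z \<in> W \<Longrightarrow> u \<in> topspace F \<Longrightarrow> fst (\<Psi> (z, u)) = z"
    and x: "x \<in> W" "x \<in> topspace X"
  shows "(\<lambda>u\<in>topspace F. snd (\<Psi> (x, u))) \<in> carrier (homeo_group F)"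
proof -
  let ?P = "prod_topology (subtopology X W) F"
  have cont: "continuous_map ?P ?P \<Psi>" "continuous_map ?P ?P \<Phi>"
    and inv: "\<And>e. e \<in> topspace ?P \<Longrightarrow> \<Phi> (\<Psi> e) = e" "\<And>e. e \<in> topspace ?P \<Longrightarrow> \<Psi> (\<Phi> e) = e"
    using hom by (auto simp: homeomorphic_maps_def)
  have slice: "continuous_map F ?P (\<lambda>u. (x, u))"
    using x by (intro continuous_map_pairedI) auto
  have P: "(x, v) \<in> topspace ?P" if "v \<in> topspace F" for v
    using that x by auto
  have \<Psi>: "\<Psi> (x, v) = (x, snd (\<Psi> (x, v)))" if "v \<in> topspace F" for v
    using fib[OF x(1) that] by (metis prod.collapse)
  have \<Phi>: "\<Phi> (x, v) = (x, snd (\<Phi> (x, v)))" if v: "v \<in> topspace F" for v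
  proof -
    have "\<Phi> (x, v) \<in> topspace ?P"
      using cont(2) P[OF v] by (auto simp: continuous_map)
    then obtain z w where zw: "\<Phi> (x, v) = (z, w)" "z \<in> W" "w \<in> topspace F"
      by (cases "\<Phi> (x, v)") auto
    then show ?thesis
      using fib[OF zw(2,3)] inv(2)[OF P[OF v]] by simp
  qed
  have "homeomorphic_maps F F (\<lambda>u. snd (\<Psi> (x, u))) (\<lambda>u. snd (\<Phi> (x, u)))"
    unfolding homeomorphic_maps_def
  proof (intro conjI ballI)
    show "continuous_map F F (\<lambda>u. snd (\<Psi> (x, u)))" "continuous_map F F (\<lambda>u. snd (\<Phi> (x, u)))"
      using continuous_map_compose[OF continuous_map_compose[OF slice cont(1)] continuous_map_snd]
        continuous_map_compose[OF continuous_map_compose[OF slice cont(2)] continuous_map_snd]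
      by (simp_all add: comp_def)
    show "snd (\<Phi> (x, snd (\<Psi> (x, v)))) = v" if "v \<in> topspace F" for v
      using \<Psi>[OF that] inv(1)[OF P[OF that]] by simp
    show "snd (\<Psi> (x, snd (\<Phi> (x, v)))) = v" if "v \<in> topspace F" for v
      using \<Phi>[OF that] inv(2)[OF P[OF that]] by simp
  qed
  then have "homeomorphic_map F F (\<lambda>u. snd (\<Psi> (x, u)))"
    unfolding homeomorphic_map_maps by blast
  then show ?thesis
    by (simp add: homeo_group_simps homeomorphic_map_restrict)
qed

section \<open>Classification of fiber bundles by functors\<close>

text \<open>Continuity, openness and surjectivity are local over the base. So is injectivity: points
  with the same image lie over the same base point, as \<open>\<Phi>\<close> respects the
  projections.\<close>

lemma homeomorphic_map_over_min_nbhds: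
  assumes X: "alexandroff_space X" and p: "continuous_map E X p" and q: "continuous_map E' X q"
    and over: "\<And>e. e \<in> topspace E \<Longrightarrow> q (\<Phi> e) = p e"
    and hom: "\<And>y. y \<in> topspace X \<Longrightarrow>
      homeomorphic_map (subtopology E {e \<in> topspace E. p e \<in> min_nbhd X y})
        (subtopology E' {e \<in> topspace E'. q e \<in> min_nbhd X y}) \<Phi>"
  shows "homeomorphic_map E E' \<Phi>"
proof -
  define V where "V y = {e \<in> topspace E. p e \<in> min_nbhd X y}" for y
  define V' where "V' y = {e \<in> topspace E'. q e \<in> min_nbhd X y}" for y
  have V: "openin E (V y)" and V': "openin E' (V' y)" if "y \<in> topspace X" for y
    using p q openin_min_nbhd[OF X that] unfolding V_def V'_def continuous_map by auto
  note hom = hom[folded V_def V'_def]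
  have top: "topspace (subtopology E (V y)) = V y" "topspace (subtopology E' (V' y)) = V' y" for y
    by (auto simp: V_def V'_def)
  have pX: "p e \<in> topspace X" "e \<in> V (p e)" if "e \<in> topspace E" for e
    using p that by (auto simp: continuous_map V_def mem_min_nbhd)
  have qX: "q e \<in> topspace X" "e \<in> V' (q e)" if "e \<in> topspace E'" for e
    using q that by (auto simp: continuous_map V'_def mem_min_nbhd)
  have im: "\<Phi> ` V y = V' y" and inj: "inj_on \<Phi> (V y)" if "y \<in> topspace X" for y
    using homeomorphic_imp_surjective_map[OF hom[OF that]] homeomorphic_imp_injective_map[OF hom[OF that]]
    unfolding top by simp_all
  have \<Phi>E: "\<Phi> e \<in> topspace E'" if "e \<in> topspace E" for e
    using im[OF pX(1)[OF that]] pX(2)[OF that] by (auto simp: V'_def)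
  show ?thesis
  proof (rule bijective_open_imp_homeomorphic_map)
    show "continuous_map E E' \<Phi>"
      unfolding continuous_map_def
    proof (intro conjI allI impI)
      fix W assume W: "openin E' W"
      have "{e \<in> topspace E. \<Phi> e \<in> W} = (\<Union>y\<in>topspace X. {e \<in> V y. \<Phi> e \<in> W})"
        using pX by (auto simp: V_def)
      moreover have "openin E {e \<in> V y. \<Phi> e \<in> W}" if y: "y \<in> topspace X" for y
      proof -
        have "openin (subtopology E' (V' y)) (W \<inter> V' y)"
          using W by (auto simp: openin_subtopology)
        then have "openin (subtopology E (V y)) {e \<in> topspace (subtopology E (V y)). \<Phi> e \<in> W \<inter> V' y}"
          using homeomorphic_imp_continuous_map[OF hom[OF y]] unfolding continuous_map by blast
        moreover have "{e \<in> topspace (subtopology E (V y)). \<Phi> e \<in> W \<inter> V' y} = {e \<in> V y. \<Phi> e \<in> W}"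
          unfolding top using im[OF y] by auto
        ultimately show ?thesis
          using openin_open_subtopology[OF V[OF y]] by auto
      qed
      ultimately show "openin E {e \<in> topspace E. \<Phi> e \<in> W}"
        by auto
    qed (use \<Phi>E in auto)
    show "open_map E E' \<Phi>"
      unfolding open_map_def
    proof (intro allI impI)
      fix W assume W: "openin E W"
      then have WE: "W \<subseteq> topspace E"
        by (rule openin_subset)
      have "\<Phi> ` W = (\<Union>y\<in>topspace X. \<Phi> ` (W \<inter> V y))"
        using pX WE by blast
      moreover have "openin E' (\<Phi> ` (W \<inter> V y))" if y: "y \<in> topspace X" for y
      proof -
        have "openin (subtopology E (V y)) (W \<inter> V y)"
          using W by (auto simp: openin_subtopology)
        then have "openin (subtopology E' (V' y)) (\<Phi> ` (W \<inter> V y))"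
          using homeomorphic_imp_open_map[OF hom[OF y]] unfolding open_map_def by blast
        then show ?thesis
          using openin_open_subtopology[OF V'[OF y]] by auto
      qed
      ultimately show "openin E' (\<Phi> ` W)"
        by auto
    qed
    show "\<Phi> ` topspace E = topspace E'"
    proof (intro equalityI subsetI)
      fix e' assume e': "e' \<in> topspace E'"
      then have "e' \<in> \<Phi> ` V (q e')"
        using im qX by blast
      then show "e' \<in> \<Phi> ` topspace E"
        by (auto simp: V_def)
    qed (use \<Phi>E in auto)
    show "inj_on \<Phi> (topspace E)"
    proof (rule inj_onI)
      fix e f assume ef: "e \<in> topspace E" "f \<in> topspace E" "\<Phi> e = \<Phi> f"
      then have "p e = p f"
        using over[of e] over[of f] by simp
      then show "e = f"
        using inj_onD[OF inj[OF pX(1)[OF ef(1)]] ef(3)] pX(2)[OF ef(1)] pX(2)[OF ef(2)] by simp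
    qed
  qed
qed

context homeo_system
begin

text \<open>The \<open>h y\<close> are charts and the \<open>a y\<close> changes of coordinates on
  the fiber; \<open>nat\<close> says that the resulting local maps fit together. The lemma serves
  twice: with a natural isomorphism as \<open>a\<close> it compares two systems, and with identities
  it recognizes a bundle from its charts.\<close>

lemma bundle_iso_totalI:
  fixes E :: "'e topology" and h :: "'a \<Rightarrow> 'e \<Rightarrow> 'a \<times> 'f"
  assumes p: "continuous_map E X p"
    and hom: "\<And>y. y \<in> topspace X \<Longrightarrow>
      homeomorphic_map (subtopology E {e \<in> topspace E. p e \<in> min_nbhd X y})
        (prod_topology (subtopology X (min_nbhd X y)) F) (h y)"
    and fst: "\<And>y e. e \<in> topspace E \<Longrightarrow> alex_le X (p e) y \<Longrightarrow> fst (h y e) = p e"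
    and a: "\<And>x. x \<in> topspace X \<Longrightarrow> a x \<in> carrier (homeo_group F)"
    and nat: "\<And>y e. e \<in> topspace E \<Longrightarrow> alex_le X (p e) y \<Longrightarrow>
      a y (snd (h y e)) = \<delta> (p e) y (a (p e) (snd (h (p e) e)))"
  shows "bundle_iso E p total fst"
proof -
  \<comment> \<open>Each point is read in the chart of its own base point. The chart of a larger y
    gives the same result by \<open>nat\<close>.\<close>
  define \<Phi> where "\<Phi> e = (p e, a (p e) (snd (h (p e) e)))" for e
  have locally: "homeomorphic_map (subtopology E {e \<in> topspace E. p e \<in> min_nbhd X y})
      (subtopology total {e \<in> topspace total. fst e \<in> min_nbhd X y}) \<Phi>" if y: "y \<in> topspace X" for y
  proof -
    let ?U = "min_nbhd X y"
    let ?V = "{e \<in> topspace E. p e \<in> ?U}"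
    let ?P = "prod_topology (subtopology X ?U) F"
    let ?k = "\<lambda>(x, v). (x, (inv\<^bsub>homeo_group F\<^esub> (\<delta> x y)) v)"
    let ?g = "\<lambda>(x, v). (x, a y v)"
    note U = mem_min_nbhd_iff[OF alexandroff y]
    have "homeomorphic_map F F (a y)"
      using a[OF y] by (simp add: homeo_group_simps)
    then obtain b where "homeomorphic_maps F F (a y) b"
      by (auto simp: homeomorphic_map_maps)
    then have "homeomorphic_maps ?P ?P ?g (\<lambda>(x, v). (x, b v))"
      using homeomorphic_maps_prod[of "subtopology X ?U" F "subtopology X ?U" F "\<lambda>x. x" "a y" "\<lambda>x. x" b]
      by (simp add: homeomorphic_maps_def)
    then have g: "homeomorphic_map ?P ?P ?g"
      unfolding homeomorphic_map_maps by blast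
    have k: "homeomorphic_map ?P (subtopology total {e \<in> topspace total. fst e \<in> ?U}) ?k"
      using total_trivialization[OF y] homeomorphic_maps_sym unfolding homeomorphic_map_maps by blast
    have "homeomorphic_map (subtopology E ?V) (subtopology total {e \<in> topspace total. fst e \<in> ?U})
        (?k \<circ> (?g \<circ> h y))"
      by (intro homeomorphic_map_compose[OF _ k] homeomorphic_map_compose[OF hom[OF y] g])
    then show ?thesis
    proof (rule homeomorphic_map_eq)
      fix e assume "e \<in> topspace (subtopology E ?V)"
      then have e: "e \<in> topspace E" "alex_le X (p e) y"
        using U by auto
      have px: "p e \<in> topspace X"
        using alex_le_topspace[OF e(2)] by simp
      have "e \<in> topspace (subtopology E {e' \<in> topspace E. p e' \<in> min_nbhd X (p e)})"
        using e(1) mem_min_nbhd by simp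
      then have "h (p e) e \<in> topspace (prod_topology (subtopology X (min_nbhd X (p e))) F)"
        using homeomorphic_imp_surjective_map[OF hom[OF px]] by blast
      then have "snd (h (p e) e) \<in> topspace F"
        by auto
      then have v: "a (p e) (snd (h (p e) e)) \<in> topspace F"
        by (rule homeo_group_apply(1)[OF a[OF px]])
      have he: "h y e = (p e, snd (h y e))"
        using fst[OF e] by (metis prod.collapse)
      have "(?k \<circ> (?g \<circ> h y)) e = (p e, (inv\<^bsub>homeo_group F\<^esub> (\<delta> (p e) y)) (a y (snd (h y e))))"
        by (simp add: case_prod_beta fst[OF e])
      also have "\<dots> = \<Phi> e"
        unfolding \<Phi>_def nat[OF e] using homeo_group_apply(3)[OF act_closed[OF e(2)] v] by simp
      finally show "(?k \<circ> (?g \<circ> h y)) e = \<Phi> e" .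
    qed
  qed
  have "homeomorphic_map E total \<Phi>"
    by (rule homeomorphic_map_over_min_nbhds[OF alexandroff p continuous_map_total_fst _ locally])
       (simp add: \<Phi>_def)
  then show ?thesis
    unfolding bundle_iso_def by (intro exI[of _ \<Phi>]) (simp add: \<Phi>_def)
qed

text \<open>The components are the restrictions of an isomorphism to the fibers. Naturality says
  that in the charts over a minimal neighbourhood the isomorphism does not vary with the base point,
  and this is where \<open>t0_space F\<close> enters.\<close>

lemma bundle_iso_total_iff_natural:
  assumes D': "homeo_system F X \<delta>'" and "t0_space F"
  shows "bundle_iso total fst (homeo_system.total F X \<delta>') fst \<longleftrightarrow>
    (\<exists>a. (\<forall>x\<in>topspace X. a x \<in> carrier (homeo_group F)) \<and>
      (\<forall>x y. alex_le X x y \<longrightarrow>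
        a y \<otimes>\<^bsub>homeo_group F\<^esub> \<delta> x y = \<delta>' x y \<otimes>\<^bsub>homeo_group F\<^esub> a x))"
proof -
  interpret D': homeo_system F X \<delta>'
    by (rule D')
  show ?thesis
  proof
    assume "\<exists>a. (\<forall>x\<in>topspace X. a x \<in> carrier (homeo_group F)) \<and>
      (\<forall>x y. alex_le X x y \<longrightarrow>
        a y \<otimes>\<^bsub>homeo_group F\<^esub> \<delta> x y = \<delta>' x y \<otimes>\<^bsub>homeo_group F\<^esub> a x)"
    then obtain a where a: "\<And>x. x \<in> topspace X \<Longrightarrow> a x \<in> carrier (homeo_group F)"
      "\<And>x y. alex_le X x y \<Longrightarrow> a y \<otimes>\<^bsub>homeo_group F\<^esub> \<delta> x y = \<delta>' x y \<otimes>\<^bsub>homeo_group F\<^esub> a x"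
      by blast
    let ?h = "\<lambda>y. \<lambda>(x, u). (x, \<delta> x y u)"
    show "bundle_iso total fst D'.total fst"
    proof (rule D'.bundle_iso_totalI[where h = ?h and a = a])
      show "homeomorphic_map (subtopology total {e \<in> topspace total. fst e \<in> min_nbhd X y})
          (prod_topology (subtopology X (min_nbhd X y)) F) (?h y)" if "y \<in> topspace X" for y
        using total_trivialization[OF that] unfolding homeomorphic_map_maps by blast
      fix y e assume e: "e \<in> topspace total" and le: "alex_le X (fst e) y"
      obtain x u where xu: "e = (x, u)"
        by (cases e)
      have x: "x \<in> topspace X" "u \<in> topspace F" "alex_le X x y"
        using e le by (auto simp: xu topspace_total)
      have "\<delta> x x u = u"
        using x by (simp add: act_refl homeo_group_simps)
      moreover have "a y (\<delta> x y u) = \<delta>' x y (a x u)"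
        using homeo_group_apply(2)[OF act_closed[OF x(3)] x(2), of "a y"]
          homeo_group_apply(2)[OF a(1)[OF x(1)] x(2), of "\<delta>' x y"] a(2)[OF x(3)] by simp
      ultimately show "a y (snd (?h y e)) = \<delta>' (fst e) y (a (fst e) (snd (?h (fst e) e)))"
        by (simp add: xu)
    qed (auto simp: continuous_map_total_fst a)
  next
    assume "bundle_iso total fst D'.total fst"
    then obtain \<alpha> where \<alpha>: "homeomorphic_map total D'.total \<alpha>"
      "\<And>e. e \<in> topspace total \<Longrightarrow> fst (\<alpha> e) = fst e"
      unfolding bundle_iso_def by blast
    define a where "a x = (\<lambda>u\<in>topspace F. snd (\<alpha> (x, u)))" for x
    have key: "a y \<in> carrier (homeo_group F) \<and> (\<forall>x u. alex_le X x y \<and> u \<in> topspace F \<longrightarrow>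
        a y (\<delta> x y u) = \<delta>' x y (a x u))" if y: "y \<in> topspace X" for y
    proof -
      let ?U = "min_nbhd X y"
      let ?P = "prod_topology (subtopology X ?U) F"
      let ?k = "\<lambda>(x, v). (x, (inv\<^bsub>homeo_group F\<^esub> (\<delta> x y)) v)"
      let ?h' = "\<lambda>(x, u). (x, \<delta>' x y u)"
      note U = mem_min_nbhd_iff[OF alexandroff y]
      have k: "homeomorphic_map ?P (subtopology total {e \<in> topspace total. fst e \<in> ?U}) ?k"
        using total_trivialization[OF y] homeomorphic_maps_sym unfolding homeomorphic_map_maps by blast
      have h': "homeomorphic_map (subtopology D'.total {e \<in> topspace D'.total. fst e \<in> ?U}) ?P ?h'"
        using D'.total_trivialization[OF y] unfolding homeomorphic_map_maps by blast
      have \<alpha>': "homeomorphic_map (subtopology total {e \<in> topspace total. fst e \<in> ?U})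
          (subtopology D'.total {e \<in> topspace D'.total. fst e \<in> ?U}) \<alpha>"
        by (rule homeomorphic_map_subtopologies_alt[OF \<alpha>(1)]) (use \<alpha>(2) in auto)
      \<comment> \<open>The isomorphism \<open>\<alpha>\<close> in the charts of both bundles over
        the minimal neighbourhood of \<open>y\<close>.\<close>
      define \<Psi> where "\<Psi> = ?h' \<circ> (\<alpha> \<circ> ?k)"
      have "homeomorphic_map ?P ?P \<Psi>"
        unfolding \<Psi>_def by (intro homeomorphic_map_compose[OF _ h'] homeomorphic_map_compose[OF k \<alpha>'])
      then obtain \<Phi> where hom: "homeomorphic_maps ?P ?P \<Psi> \<Phi>"
        by (auto simp: homeomorphic_map_maps)
      have \<Psi>: "\<Psi> (x, v) = (x, \<delta>' x y (a x ((inv\<^bsub>homeo_group F\<^esub> (\<delta> x y)) v)))"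
        if "x \<in> ?U" "v \<in> topspace F" for x v
      proof -
        have le: "alex_le X x y"
          using that U by simp
        have w: "(inv\<^bsub>homeo_group F\<^esub> (\<delta> x y)) v \<in> topspace F"
          using homeo_group_apply(1)[OF inv_closed[OF act_closed[OF le]] that(2)] .
        have "fst (\<alpha> (x, (inv\<^bsub>homeo_group F\<^esub> (\<delta> x y)) v)) = x"
          using \<alpha>(2)[of "(x, (inv\<^bsub>homeo_group F\<^esub> (\<delta> x y)) v)"] w alex_le_topspace[OF le]
          by (simp add: topspace_total)
        then show ?thesis
          using w by (simp add: \<Psi>_def a_def case_prod_beta)
      qed
      have fib: "fst (\<Psi> (x, v)) = x" if "x \<in> ?U" "v \<in> topspace F" for x v
        using \<Psi>[OF that] by simp
      have at_y: "snd (\<Psi> (y, v)) = a y v" if v: "v \<in> topspace F" for v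
      proof -
        have "\<one>\<^bsub>homeo_group F\<^esub> v = v"
          using v by (simp add: homeo_group_simps)
        then have "snd (\<Psi> (y, v)) = \<delta>' y y (a y v)"
          using \<Psi>[OF mem_min_nbhd v] act_refl[OF y] by simp
        also have "\<dots> = a y v"
        proof -
          have "\<alpha> (y, v) \<in> topspace D'.total"
            using homeomorphic_imp_surjective_map[OF \<alpha>(1)] y v topspace_total by blast
          then have "a y v \<in> topspace F"
            using v by (auto simp: a_def D'.topspace_total)
          then show ?thesis
            using D'.act_refl[OF y] by (simp add: homeo_group_simps)
        qed
        finally show ?thesis .
      qed
      have "(\<lambda>u\<in>topspace F. snd (\<Psi> (y, u))) = a y"
        using at_y by (auto simp: a_def)
      then have "a y \<in> carrier (homeo_group F)"
        using fiberwise_homeo_slice[OF hom fib mem_min_nbhd y] by simp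
      moreover have "a y (\<delta> x y u) = \<delta>' x y (a x u)" if le: "alex_le X x y" and u: "u \<in> topspace F" for x u
      proof -
        have v: "\<delta> x y u \<in> topspace F"
          by (rule homeo_group_apply(1)[OF act_closed[OF le] u])
        have x: "x \<in> ?U"
          using le U by simp
        \<comment> \<open>The left side is \<open>\<delta>' x y\<close> applied to
          \<open>a x u\<close>. Over \<open>y\<close> itself both charts are the identity on the
          fiber, so the right side is a value of \<open>a y\<close>.\<close>
        have "snd (\<Psi> (x, \<delta> x y u)) = snd (\<Psi> (y, \<delta> x y u))"
          by (rule fiberwise_homeo_constant[OF assms(2) hom fib le x mem_min_nbhd v])
        then show ?thesis
          using at_y[OF v] \<Psi>[OF x v] homeo_group_apply(3)[OF act_closed[OF le] u] by simp
      qed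
      ultimately show ?thesis
        by blast
    qed
    have "a y \<otimes>\<^bsub>homeo_group F\<^esub> \<delta> x y = \<delta>' x y \<otimes>\<^bsub>homeo_group F\<^esub> a x"
      if le: "alex_le X x y" for x y
    proof -
      have X: "x \<in> topspace X" "y \<in> topspace X"
        using alex_le_topspace[OF le] by auto
      note c = act_closed[OF le] D'.act_closed[OF le] conjunct1[OF key[OF X(1)]] conjunct1[OF key[OF X(2)]]
      show ?thesis
      proof (rule homeo_group_eqI)
        fix u assume u: "u \<in> topspace F"
        show "(a y \<otimes>\<^bsub>homeo_group F\<^esub> \<delta> x y) u = (\<delta>' x y \<otimes>\<^bsub>homeo_group F\<^esub> a x) u"
          using homeo_group_apply(2)[OF c(1) u] homeo_group_apply(2)[OF c(3) u] key[OF X(2)] le u by simp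
      qed (use c in auto)
    qed
    then show "\<exists>a. (\<forall>x\<in>topspace X. a x \<in> carrier (homeo_group F)) \<and>
      (\<forall>x y. alex_le X x y \<longrightarrow>
        a y \<otimes>\<^bsub>homeo_group F\<^esub> \<delta> x y = \<delta>' x y \<otimes>\<^bsub>homeo_group F\<^esub> a x)"
      using key by blast
  qed
qed

end

section \<open>Recovering a system of transition maps from a fiber bundle\<close>

lemma homeomorphic_maps_mem:
  assumes "homeomorphic_maps X Y f g" "x \<in> topspace X"
  shows "f x \<in> topspace Y" "g (f x) = x"
  using assms by (auto simp: homeomorphic_maps_def continuous_map)

text \<open>Needed to shrink a chart to a minimal neighbourhood, and again to compare the charts
  chosen for x \<le> y over the smaller neighbourhood. The pair \<open>h\<close>, \<open>k\<close>
  is kept, so the chosen inverses remain valid.\<close>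

lemma trivialization_restrict:
  assumes hom: "homeomorphic_maps (subtopology E {e \<in> topspace E. p e \<in> U})
      (prod_topology (subtopology X U) F) h k"
    and fst: "\<And>e. e \<in> topspace E \<Longrightarrow> p e \<in> U \<Longrightarrow> fst (h e) = p e" and "W \<subseteq> U"
  shows "homeomorphic_maps (subtopology E {e \<in> topspace E. p e \<in> W})
      (prod_topology (subtopology X W) F) h k"
proof -
  let ?E = "subtopology E {e \<in> topspace E. p e \<in> U}" and ?P = "prod_topology (subtopology X U) F"
  have P: "subtopology ?P (W \<times> UNIV) = prod_topology (subtopology X W) F"
    using assms(3) subtopology_Times[of "subtopology X U" F W UNIV]
    by (simp add: subtopology_subtopology inf.absorb2)
  have E: "subtopology ?E {e \<in> topspace E. p e \<in> W} = subtopology E {e \<in> topspace E. p e \<in> W}"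
    unfolding subtopology_subtopology using assms(3) by (intro arg_cong2[of _ _ _ _ subtopology]) auto
  have "homeomorphic_maps (subtopology ?E {e \<in> topspace E. p e \<in> W}) (subtopology ?P (W \<times> UNIV)) h k"
  proof (rule homeomorphic_maps_subtopologies_alt[OF hom])
    show "h ` (topspace ?E \<inter> {e \<in> topspace E. p e \<in> W}) \<subseteq> W \<times> UNIV"
    proof (rule image_subsetI)
      fix e assume "e \<in> topspace ?E \<inter> {e \<in> topspace E. p e \<in> W}"
      then have "fst (h e) \<in> W"
        using fst[of e] by auto
      then show "h e \<in> W \<times> UNIV"
        by (simp add: mem_Times_iff)
    qed
    show "k ` (topspace ?P \<inter> W \<times> UNIV) \<subseteq> {e \<in> topspace E. p e \<in> W}"
    proof
      fix e assume "e \<in> k ` (topspace ?P \<inter> W \<times> UNIV)"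
      then obtain b where b: "b \<in> topspace ?P" "fst b \<in> W" "e = k b"
        by auto
      have "e \<in> topspace ?E" "h e = b"
        using homeomorphic_maps_mem[OF hom[unfolded homeomorphic_maps_sym[of ?E]] b(1)] b(3) by auto
      then show "e \<in> {e \<in> topspace E. p e \<in> W}"
        using fst[of e] b by auto
    qed
  qed
  then show ?thesis
    by (simp only: P E)
qed

text \<open>For x \<le> y the charts chosen for x and y are both defined over the minimal
  neighbourhood of x. The transition between them does not vary there, so one homeomorphism of
  \<open>F\<close> records it, and the cocycle condition for transition maps becomes
  functoriality.\<close>

lemma fiber_bundle_homeo_system:
  fixes E :: "'e topology" and X :: "'a topology" and F :: "'f topology"
  assumes X: "alexandroff_space X" and F: "t0_space F" and E: "fiber_bundle X F E p"
  shows "\<exists>\<delta>. homeo_system F X \<delta> \<and> bundle_iso E p (homeo_system.total F X \<delta>) fst"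
proof -
  have p: "continuous_map E X p"
    using E by (simp add: fiber_bundle_def)
  let ?E = "\<lambda>y. subtopology E {e \<in> topspace E. p e \<in> min_nbhd X y}"
  let ?P = "\<lambda>y. prod_topology (subtopology X (min_nbhd X y)) F"
  have "\<exists>h k. homeomorphic_maps (?E y) (?P y) h k \<and>
      (\<forall>e\<in>topspace E. p e \<in> min_nbhd X y \<longrightarrow> fst (h e) = p e)" if "y \<in> topspace X" for y
  proof -
    obtain U h where U: "openin X U" "y \<in> U"
      and h: "homeomorphic_map (subtopology E {e \<in> topspace E. p e \<in> U}) (prod_topology (subtopology X U) F) h"
      and fst: "\<And>e. e \<in> topspace E \<Longrightarrow> p e \<in> U \<Longrightarrow> fst (h e) = p e"
      using E \<open>y \<in> topspace X\<close> unfolding fiber_bundle_def by meson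
    obtain k where k: "homeomorphic_maps (subtopology E {e \<in> topspace E. p e \<in> U})
        (prod_topology (subtopology X U) F) h k"
      using h by (auto simp: homeomorphic_map_maps)
    have "min_nbhd X y \<subseteq> U"
      using U by (rule min_nbhd_subset)
    then show ?thesis
      using trivialization_restrict[OF k fst] fst by blast
  qed
  then obtain h k where hk: "\<And>y. y \<in> topspace X \<Longrightarrow> homeomorphic_maps (?E y) (?P y) (h y) (k y)"
    and fst: "\<And>y e. y \<in> topspace X \<Longrightarrow> e \<in> topspace E \<Longrightarrow> p e \<in> min_nbhd X y \<Longrightarrow> fst (h y e) = p e"
    by metis
  \<comment> \<open>The transition is sampled in the fiber over x, a greatest point of the smaller
    neighbourhood; \<open>transition\<close> shows that it is the same over all points below
    x.\<close>
  define \<delta> where "\<delta> x y = (\<lambda>u\<in>topspace F. snd (h y (k x (x, u))))" for x y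
  have k: "k x (z, u) \<in> topspace E" "p (k x (z, u)) = z" "h x (k x (z, u)) = (z, u)"
    if "z \<in> min_nbhd X x" "x \<in> topspace X" "u \<in> topspace F" for x z u
  proof -
    have zu: "(z, u) \<in> topspace (?P x)"
      using that topspace_restriction[OF that(2)] by simp
    note kh = homeomorphic_maps_mem[OF hk[OF that(2), unfolded homeomorphic_maps_sym[of "?E x"]] zu]
    show "h x (k x (z, u)) = (z, u)" and kE: "k x (z, u) \<in> topspace E"
      using kh by auto
    have "p (k x (z, u)) \<in> min_nbhd X x"
      using kh(1) by auto
    then show "p (k x (z, u)) = z"
      using fst[OF that(2) kE] \<open>h x (k x (z, u)) = (z, u)\<close> by simp
  qed
  have transition: "\<delta> x y \<in> carrier (homeo_group F) \<and>
      (\<forall>e\<in>topspace E. alex_le X (p e) x \<longrightarrow> snd (h y e) = \<delta> x y (snd (h x e)))"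
    if le: "alex_le X x y" for x y
  proof -
    have xy: "x \<in> topspace X" "y \<in> topspace X"
      using alex_le_topspace[OF le] by auto
    have sub: "min_nbhd X x \<subseteq> min_nbhd X y"
      using le by (simp add: alex_le_def)
    have "homeomorphic_maps (?E x) (?P x) (h y) (k y)"
      by (rule trivialization_restrict[OF hk[OF xy(2)] fst[OF xy(2)] sub])
    then have hom: "homeomorphic_maps (?P x) (?P x) (h y \<circ> k x) (h x \<circ> k y)"
      using hk[OF xy(1)] homeomorphic_maps_sym homeomorphic_maps_compose by blast
    have fib: "fst ((h y \<circ> k x) (z, u)) = z" if "z \<in> min_nbhd X x" "u \<in> topspace F" for z u
      using k[OF that(1) xy(1) that(2)] fst[OF xy(2), of "k x (z, u)"] that(1) sub by auto
    have "\<delta> x y \<in> carrier (homeo_group F)"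
      using fiberwise_homeo_slice[OF hom fib mem_min_nbhd xy(1)] by (simp add: \<delta>_def)
    moreover have "snd (h y e) = \<delta> x y (snd (h x e))" if e: "e \<in> topspace E" "alex_le X (p e) x" for e
    proof -
      have pe: "p e \<in> min_nbhd X x"
        using e(2) mem_min_nbhd_iff[OF X xy(1)] by simp
      have eE: "e \<in> topspace (?E x)"
        using e pe by simp
      have "h x e \<in> topspace (?P x)" and khe: "k x (h x e) = e"
        using homeomorphic_maps_mem[OF hk[OF xy(1)] eE] .
      then have u: "snd (h x e) \<in> topspace F"
        by auto
      have he: "h x e = (p e, snd (h x e))"
        using fst[OF xy(1) e(1) pe] by (metis prod.collapse)
      have "snd ((h y \<circ> k x) (p e, snd (h x e))) = snd ((h y \<circ> k x) (x, snd (h x e)))"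
        by (rule fiberwise_homeo_constant[OF F hom fib e(2) pe mem_min_nbhd u])
      then show ?thesis
        using khe he u by (simp add: \<delta>_def)
    qed
    ultimately show ?thesis
      by blast
  qed
  have "local_system (homeo_group F) X \<delta>"
  proof (intro local_system.intro local_system_axioms.intro group_homeo_group X)
    show "\<delta> x y \<in> carrier (homeo_group F)" if "alex_le X x y" for x y
      using transition[OF that] by blast
    show "\<delta> x x = \<one>\<^bsub>homeo_group F\<^esub>" if "x \<in> topspace X" for x
      using k(3)[OF mem_min_nbhd that] by (auto simp: \<delta>_def homeo_group_simps)
    fix x y z assume le: "alex_le X x y" "alex_le X y z"
    note xz = alex_le_trans[OF le]
    have x: "x \<in> topspace X"
      using alex_le_topspace[OF le(1)] by simp
    interpret group "homeo_group F"
      by (rule group_homeo_group)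
    show "\<delta> x z = \<delta> y z \<otimes>\<^bsub>homeo_group F\<^esub> \<delta> x y"
    proof (rule homeo_group_eqI)
      fix u assume u: "u \<in> topspace F"
      \<comment> \<open>The point over x with coordinate u in the chart of x; functoriality is
        obtained by reading it in the charts of y and z.\<close>
      let ?e = "k x (x, u)"
      note e = k[OF mem_min_nbhd x u]
      have "\<delta> x z u = snd (h z ?e)" "\<delta> x y u = snd (h y ?e)"
        using u by (auto simp: \<delta>_def)
      then show "\<delta> x z u = (\<delta> y z \<otimes>\<^bsub>homeo_group F\<^esub> \<delta> x y) u"
        using transition[OF le(2)] transition[OF le(1)] e le(1) homeo_group_apply(2)[of "\<delta> x y" F u "\<delta> y z"] u
        by auto
    qed (use transition[OF xz] transition[OF le(1)] transition[OF le(2)] in auto)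
  qed
  then interpret homeo_system F X \<delta>
    by (rule homeo_system.intro)
  have "bundle_iso E p total fst"
  \<comment> \<open>With identity components the compatibility condition is just the change of
    charts proved in \<open>transition\<close>.\<close>
  proof (rule bundle_iso_totalI[where h = h and a = "\<lambda>_. \<one>\<^bsub>homeo_group F\<^esub>"])
    show "homeomorphic_map (?E y) (?P y) (h y)" if "y \<in> topspace X" for y
      using hk[OF that] unfolding homeomorphic_map_maps by blast
    fix y e assume e: "e \<in> topspace E" and le: "alex_le X (p e) y"
    have y: "y \<in> topspace X" and px: "p e \<in> topspace X"
      using alex_le_topspace[OF le] by auto
    show "fst (h y e) = p e"
      using fst[OF y e] le mem_min_nbhd_iff[OF X y] by simp
    have F': "snd (h x e) \<in> topspace F" if x: "x \<in> topspace X" "alex_le X (p e) x" for x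
    proof -
      have "h x e \<in> topspace (?P x)"
        using e x(2) mem_min_nbhd_iff[OF X x(1)] by (intro homeomorphic_maps_mem[OF hk[OF x(1)]]) simp
      then show ?thesis
        by auto
    qed
    have "snd (h y e) = \<delta> (p e) y (snd (h (p e) e))"
      using transition[OF le] e alex_le_refl[OF px] by blast
    then show "\<one>\<^bsub>homeo_group F\<^esub> (snd (h y e)) =
        \<delta> (p e) y (\<one>\<^bsub>homeo_group F\<^esub> (snd (h (p e) e)))"
      using F'[OF y le] F'[OF px alex_le_refl[OF px]] by (simp add: homeo_group_simps)
  qed (auto simp: p)
  with homeo_system_axioms show ?thesis
    by blast
qed

section \<open>Maps into the cofibrant replacement\<close>

lemma homeo_system_funct:
  assumes "alexandroff_space X"
    and "D \<in> funct (alex_cat X :: ('a, 'm) cat) (aut_cat F :: ('o, 'f \<Rightarrow> 'f) cat)"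
  shows "homeo_system F X (\<lambda>x y. amap D x y arr)"
  using local_system_funct[OF assms(1) group_homeo_group assms(2)[unfolded aut_cat_def]]
  by (rule homeo_system.intro)

lemma grothendieck_space_eq_total:
  assumes "homeo_system F X \<delta>" "\<And>x y. alex_le X x y \<Longrightarrow> amap D x y arr = \<delta> x y"
  shows "grothendieck_space X F D = homeo_system.total F X \<delta>"
proof -
  have "{(x, u). alex_le X x y \<and> u \<in> topspace F \<and> amap D x y arr u \<in> V} =
      {(x, u). alex_le X x y \<and> u \<in> topspace F \<and> \<delta> x y u \<in> V}" for y V
    using assms(2) by auto
  then show ?thesis
    unfolding grothendieck_space_def homeo_system.total_def[OF assms(1)] by simp
qed

text \<open>The lifting property of \<open>U\<close> is about functors, so a system extracted from a
  bundle has to be packaged as one.\<close>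

lemma funct_of_homeo_system:
  fixes X :: "'a topology" and F :: "'f topology"
  assumes "homeo_system F X \<delta>"
  shows "\<exists>D \<in> funct (alex_cat X :: ('a, 'm) cat) (aut_cat F :: ('o, 'f \<Rightarrow> 'f) cat).
    \<forall>x y. alex_le X x y \<longrightarrow> amap D x y arr = \<delta> x y"
proof -
  interpret homeo_system F X \<delta>
    by (rule assms)
  define D :: "('a, 'm, 'o, 'f \<Rightarrow> 'f) cfunctor" where
    "D = \<lparr>omap = (\<lambda>x\<in>topspace X. undefined),
      amap = (\<lambda>x y. \<lambda>_\<in>Hom (alex_cat X :: ('a, 'm) cat) x y. \<delta> x y)\<rparr>"
  have om: "omap D x = undefined" if "x \<in> topspace X" for x
    using that by (simp add: D_def)
  have am: "amap D x y arr = \<delta> x y" if "alex_le X x y" for x y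
    using that by (simp add: D_def Hom_alex_cat)
  have HomD: "f \<in> Hom (alex_cat X :: ('a, 'm) cat) x y \<longleftrightarrow> alex_le X x y \<and> f = arr" for x y f
    by (simp add: Hom_alex_cat)
  have "D \<in> funct (alex_cat X :: ('a, 'm) cat) (aut_cat F :: ('o, 'f \<Rightarrow> 'f) cat)"
    unfolding aut_cat_def
  proof (rule functI)
    show "omap D \<in> Obj (alex_cat X :: ('a, 'm) cat) \<rightarrow>\<^sub>E Obj (group_cat (homeo_group F) :: ('o, 'f \<Rightarrow> 'f) cat)"
      by (simp add: D_def Obj_alex_cat group_cat_simps)
    show "amap D x y \<in> Hom (alex_cat X :: ('a, 'm) cat) x y \<rightarrow>\<^sub>E
        Hom (group_cat (homeo_group F) :: ('o, 'f \<Rightarrow> 'f) cat) (omap D x) (omap D y)" for x y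
    proof (rule PiE_I)
      fix f :: 'm assume "f \<in> Hom (alex_cat X) x y"
      then have "alex_le X x y" "f = arr"
        by (simp_all add: HomD)
      then show "amap D x y f \<in> Hom (group_cat (homeo_group F)) (omap D x) (omap D y)"
        using alex_le_topspace[of X x y] by (simp add: am om group_cat_simps)
    qed (simp add: D_def)
    show "amap D x x (Ident (alex_cat X :: ('a, 'm) cat) x) =
        Ident (group_cat (homeo_group F) :: ('o, 'f \<Rightarrow> 'f) cat) (omap D x)"
      if "x \<in> Obj (alex_cat X :: ('a, 'm) cat)" for x
      using that by (simp add: Obj_alex_cat alex_cat_simps group_cat_simps am alex_le_refl act_refl)
    show "amap D x z (Comp (alex_cat X :: ('a, 'm) cat) x y z g f) =
        Comp (group_cat (homeo_group F) :: ('o, 'f \<Rightarrow> 'f) cat) (omap D x) (omap D y) (omap D z)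
          (amap D y z g) (amap D x y f)"
      if "f \<in> Hom (alex_cat X) x y" "g \<in> Hom (alex_cat X) y z" for x y z f g
      using that alex_le_trans[of X x y z]
      by (simp add: HomD alex_cat_simps group_cat_simps am act_trans[of x y z])
  qed
  with am show ?thesis
    by blast
qed

text \<open>The arrow map into a thin category is forced and functors are extensional, so a functor
  is recovered from its object map. This turns the lift that cofibrancy provides into a continuous
  map.\<close>

lemma continuous_map_alex_functor:
  fixes X Q :: "'u topology"
  assumes "alexandroff_space X" "alexandroff_space Q"
    and "w \<in> funct (alex_cat X :: ('u, 'm) cat) (alex_cat Q :: ('u, 'm) cat)"
  shows "omap w \<in> maps X Q" "w = thin_functor (alex_cat X :: ('u, 'm) cat) (omap w)"
proof -
  have om: "omap w \<in> topspace X \<rightarrow>\<^sub>E topspace Q"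
    using functD(1)[OF assms(3)] by (simp add: Obj_alex_cat)
  have le: "alex_le Q (omap w x) (omap w y) \<and> amap w x y arr = arr" if "alex_le X x y" for x y
  proof -
    have "amap w x y arr \<in> Hom (alex_cat Q) (omap w x) (omap w y)"
      using PiE_mem[OF functD(2)[OF assms(3)]] that by (simp add: Hom_alex_cat)
    then show ?thesis
      by (auto simp: Hom_alex_cat split: if_splits)
  qed
  then show "omap w \<in> maps X Q"
    using om unfolding maps_def continuous_map_alexandroff_iff[OF assms(1,2)] by (auto simp: PiE_def)
  show "w = thin_functor (alex_cat X :: ('u, 'm) cat) (omap w)"
  proof (rule cfunctor_eqI)
    show "omap w = omap (thin_functor (alex_cat X :: ('u, 'm) cat) (omap w) :: ('u, 'm, 'u, 'm) cfunctor)"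
      using om by (auto simp: thin_functor_def Obj_alex_cat PiE_def extensional_restrict)
    show "amap w = amap (thin_functor (alex_cat X :: ('u, 'm) cat) (omap w) :: ('u, 'm, 'u, 'm) cfunctor)"
    proof (intro ext)
      fix x y and f :: 'm
      show "amap w x y f =
          amap (thin_functor (alex_cat X :: ('u, 'm) cat) (omap w) :: ('u, 'm, 'u, 'm) cfunctor) x y f"
      proof (cases "f \<in> Hom (alex_cat X) x y")
        case True
        then have "alex_le X x y" "f = arr"
          by (auto simp: Hom_alex_cat split: if_splits)
        then show ?thesis
          using le by (simp add: thin_functor_def Hom_alex_cat)
      next
        case False
        then show ?thesis
          using PiE_arb[OF functD(2)[OF assms(3)] False] by (simp add: thin_functor_def)
      qed
    qed
  qed
qed

lemma thin_functor_funct: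
  fixes X Q :: "'u topology"
  assumes "alexandroff_space X" "alexandroff_space Q" "f \<in> maps X Q"
  shows "(thin_functor (alex_cat X :: ('u, 'm) cat) f :: ('u, 'm, 'u, 'm) cfunctor)
    \<in> funct (alex_cat X) (alex_cat Q)"
proof -
  have f: "f \<in> topspace X \<rightarrow> topspace Q" "\<And>x y. alex_le X x y \<Longrightarrow> alex_le Q (f x) (f y)"
    using assms(3) unfolding maps_def continuous_map_alexandroff_iff[OF assms(1,2)] by auto
  show ?thesis
  proof (rule functI)
    show "amap (thin_functor (alex_cat X :: ('u, 'm) cat) f) x y \<in> Hom (alex_cat X) x y \<rightarrow>\<^sub>E
      Hom (alex_cat Q :: ('u, 'm) cat)
        (omap (thin_functor (alex_cat X :: ('u, 'm) cat) f :: ('u, 'm, 'u, 'm) cfunctor) x)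
        (omap (thin_functor (alex_cat X :: ('u, 'm) cat) f :: ('u, 'm, 'u, 'm) cfunctor) y)" for x y
      using f(2)[of x y] alex_le_topspace[of X x y]
      by (simp add: thin_functor_def Hom_alex_cat Obj_alex_cat)
  qed (use f alex_le_trans[of X] in \<open>auto simp: thin_functor_def Hom_alex_cat Obj_alex_cat alex_cat_simps
      alex_le_refl split: if_splits\<close>)
qed

lemma func_comp_funct:
  assumes "S \<in> funct C D" "T \<in> funct B C" "category B"
  shows "func_comp B S T \<in> funct B D"
proof -
  have cat: "\<And>x y f. f \<in> Hom B x y \<Longrightarrow> x \<in> Obj B \<and> y \<in> Obj B"
    "\<And>x. x \<in> Obj B \<Longrightarrow> Ident B x \<in> Hom B x x"
    "\<And>x y z f g. f \<in> Hom B x y \<Longrightarrow> g \<in> Hom B y z \<Longrightarrow> Comp B x y z g f \<in> Hom B x z"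
    using assms(3) unfolding category_def by blast+
  note oT = PiE_mem[OF functD(1)[OF assms(2)]] and aT = PiE_mem[OF functD(2)[OF assms(2)]]
  note oS = PiE_mem[OF functD(1)[OF assms(1)]] and aS = PiE_mem[OF functD(2)[OF assms(1)]]
  show ?thesis
  proof (rule functI)
    show "omap (func_comp B S T) \<in> Obj B \<rightarrow>\<^sub>E Obj D"
      using oT oS by (auto simp: func_comp_def)
    show "amap (func_comp B S T) x y \<in> Hom B x y \<rightarrow>\<^sub>E Hom D (omap (func_comp B S T) x) (omap (func_comp B S T) y)"
      for x y
      using aT aS cat(1)[of _ x y] by (auto simp: func_comp_def)
    show "amap (func_comp B S T) x x (Ident B x) = Ident D (omap (func_comp B S T) x)" if "x \<in> Obj B" for x
      using that cat(2) functD(3)[OF assms(2) that] functD(3)[OF assms(1) oT[OF that]]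
      by (simp add: func_comp_def)
    fix x y z f g assume fg: "f \<in> Hom B x y" "g \<in> Hom B y z"
    then show "amap (func_comp B S T) x z (Comp B x y z g f) =
        Comp D (omap (func_comp B S T) x) (omap (func_comp B S T) y) (omap (func_comp B S T) z)
          (amap (func_comp B S T) y z g) (amap (func_comp B S T) x y f)"
      using cat(1)[OF fg(1)] cat(1)[OF fg(2)] cat(3)[OF fg] functD(4)[OF assms(2) fg]
        functD(4)[OF assms(1) aT[OF fg(1)] aT[OF fg(2)]]
      by (simp add: func_comp_def)
  qed
qed

text \<open>The lifting square starts at the empty category, so it commutes trivially, and its
  diagonal is a functor from \<open>X\<close> to \<open>Q\<close> over \<open>D\<close>. Lifting is
  tested within one type of categories, which is why \<open>D\<close> takes values in the copy of
  \<open>aut_cat F\<close> in that type.\<close>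

lemma along_surj:
  fixes X Q F :: "'u topology"
  assumes "alexandroff_space X" "alexandroff_space Q"
    and tf: "trivial_fibration (alex_cat Q) (aut_cat F) U"
    and cof: "cofibrant (alex_cat X :: ('u, 'u \<Rightarrow> 'u) cat)"
    and D: "D \<in> funct (alex_cat X :: ('u, 'u \<Rightarrow> 'u) cat) (aut_cat F :: ('u, 'u \<Rightarrow> 'u) cat)"
  shows "\<exists>f\<in>maps X Q. along X U f = D"
proof -
  let ?O = "empty_cat :: ('u, 'u \<Rightarrow> 'u) cat"
  let ?X = "alex_cat X :: ('u, 'u \<Rightarrow> 'u) cat"
  let ?i = "thin_functor ?O id :: ('u, 'u \<Rightarrow> 'u, 'u, 'u \<Rightarrow> 'u) cfunctor"
  have empty: "Obj ?O = {}" "Hom ?O x y = {}" for x y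
    by (simp_all add: empty_cat_def thin_cat_def)
  have u: "?i \<in> funct ?O (alex_cat Q)"
    by (rule functI) (auto simp: thin_functor_def empty)
  have eq: "func_comp ?O U ?i = func_comp ?O D ?i"
    by (simp add: func_comp_def empty restrict_def)
  have "cofibration ?O ?X ?i"
    using cof by (simp add: cofibrant_def)
  then obtain w where w: "w \<in> funct ?X (alex_cat Q)" "func_comp ?X U w = D"
    unfolding cofibration_def using tf u D eq by meson
  then show ?thesis
    using continuous_map_alex_functor[OF assms(1,2) w(1)] by (metis along_def)
qed

section \<open>The classifying bijection\<close>

lemma bundle_iso_refl: "bundle_iso E p E p"
  unfolding bundle_iso_def using homeomorphic_map_id[of E E] by (intro exI[of _ id]) simp

lemma bundle_iso_sym:
  assumes "bundle_iso E p E' q"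
  shows "bundle_iso E' q E p"
proof -
  obtain \<alpha> where \<alpha>: "homeomorphic_map E E' \<alpha>" "\<And>e. e \<in> topspace E \<Longrightarrow> q (\<alpha> e) = p e"
    using assms unfolding bundle_iso_def by blast
  obtain \<beta> where \<beta>: "homeomorphic_maps E E' \<alpha> \<beta>"
    using \<alpha>(1) by (auto simp: homeomorphic_map_maps)
  have "homeomorphic_map E' E \<beta>"
    using \<beta> homeomorphic_maps_sym unfolding homeomorphic_map_maps by blast
  moreover have "p (\<beta> e) = q e" if "e \<in> topspace E'" for e
    using \<alpha>(2)[of "\<beta> e"] \<beta> that by (auto simp: homeomorphic_maps_def continuous_map)
  ultimately show ?thesis
    unfolding bundle_iso_def by blast
qed

lemma bundle_iso_trans:
  assumes "bundle_iso E p E' q" "bundle_iso E' q E'' r"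
  shows "bundle_iso E p E'' r"
proof -
  obtain \<alpha> where \<alpha>: "homeomorphic_map E E' \<alpha>" "\<And>e. e \<in> topspace E \<Longrightarrow> q (\<alpha> e) = p e"
    using assms(1) unfolding bundle_iso_def by blast
  obtain \<beta> where \<beta>: "homeomorphic_map E' E'' \<beta>" "\<And>e. e \<in> topspace E' \<Longrightarrow> r (\<beta> e) = q e"
    using assms(2) unfolding bundle_iso_def by blast
  have "r ((\<beta> \<circ> \<alpha>) e) = p e" if "e \<in> topspace E" for e
    using \<alpha>(2)[OF that] \<beta>(2)[of "\<alpha> e"] homeomorphic_imp_surjective_map[OF \<alpha>(1)] that by auto
  then show ?thesis
    unfolding bundle_iso_def using homeomorphic_map_compose[OF \<alpha>(1) \<beta>(1)] by blast
qed

lemma equiv_bundle_iso_rel: "equiv (bundles X F) (bundle_iso_rel X F)"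
proof (rule equivI)
  show "bundle_iso_rel X F \<subseteq> bundles X F \<times> bundles X F"
    by (auto simp: bundle_iso_rel_def)
  show "refl_on (bundles X F) (bundle_iso_rel X F)"
    unfolding refl_on_def by (auto simp: bundle_iso_rel_def bundle_iso_refl)
  show "sym (bundle_iso_rel X F)"
    unfolding sym_def bundle_iso_rel_def using bundle_iso_sym by blast
  show "trans (bundle_iso_rel X F)"
    unfolding trans_def bundle_iso_rel_def using bundle_iso_trans by blast
qed

text \<open>\<open>R\<close> is the pullback of \<open>S\<close> along \<open>b\<close>, which gives
  injectivity on classes, and \<open>surj\<close> is surjectivity up to \<open>S\<close>. By
  transitivity the union over a class \<open>K\<close> is a single class of
  \<open>S\<close>.\<close>

lemma bij_betw_quotient:
  assumes S: "equiv B S" and b: "b \<in> M \<rightarrow> B"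
    and R: "R = {(f, g). f \<in> M \<and> g \<in> M \<and> (b f, b g) \<in> S}"
    and surj: "\<And>y. y \<in> B \<Longrightarrow> \<exists>f\<in>M. (b f, y) \<in> S"
  shows "bij_betw (\<lambda>K. S `` (b ` K)) (M // R) (B // S)"
proof -
  have cls: "S `` (b ` (R `` {f})) = S `` {b f}" if f: "f \<in> M" for f
  proof -
    have bf: "(b f, b f) \<in> S"
      using S b f by (auto simp: equiv_def refl_on_def)
    have S_trans: "(b f, y) \<in> S" if "(b f, z) \<in> S" "(z, y) \<in> S" for y z
      using S that unfolding equiv_def by (meson transD)
    show ?thesis
    proof (intro equalityI subsetI)
      fix y assume "y \<in> S `` (b ` (R `` {f}))"
      then obtain g where "(b f, b g) \<in> S" "(b g, y) \<in> S"
        unfolding R by blast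
      then show "y \<in> S `` {b f}"
        using S_trans by simp
    next
      fix y assume "y \<in> S `` {b f}"
      moreover have "f \<in> R `` {f}"
        unfolding R using f bf by simp
      ultimately show "y \<in> S `` (b ` (R `` {f}))"
        by blast
    qed
  qed
  show ?thesis
    unfolding bij_betw_def
  proof
    show "inj_on (\<lambda>K. S `` (b ` K)) (M // R)"
    proof (rule inj_onI)
      fix K L assume K: "K \<in> M // R" and L: "L \<in> M // R" and eq: "S `` (b ` K) = S `` (b ` L)"
      obtain f where f: "f \<in> M" "K = R `` {f}"
        using K by (auto simp: quotient_def)
      obtain g where g: "g \<in> M" "L = R `` {g}"
        using L by (auto simp: quotient_def)
      have fg: "S `` {b f} = S `` {b g}"
        using eq cls f g by simp
      have "(b f, y) \<in> S \<longleftrightarrow> (b g, y) \<in> S" for y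
        using eqset_imp_iff[OF fg, of y] by simp
      then have "R `` {f} = R `` {g}"
        unfolding R using f(1) g(1) by auto
      then show "K = L"
        using f(2) g(2) by simp
    qed
    show "(\<lambda>K. S `` (b ` K)) ` (M // R) = B // S"
    proof (intro equalityI subsetI)
      fix Y assume "Y \<in> (\<lambda>K. S `` (b ` K)) ` (M // R)"
      then obtain f where "f \<in> M" "Y = S `` {b f}"
        using cls by (auto simp: quotient_def)
      then show "Y \<in> B // S"
        using b by (auto simp: quotient_def)
    next
      fix Y assume "Y \<in> B // S"
      then obtain y where y: "y \<in> B" "Y = S `` {y}"
        by (auto simp: quotient_def)
      obtain f where f: "f \<in> M" "(b f, y) \<in> S"
        using surj[OF y(1)] by blast
      then have "Y = S `` (b ` (R `` {f}))"
        using cls[OF f(1)] y equiv_class_eq[OF S f(2)] by simp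
      then show "Y \<in> (\<lambda>K. S `` (b ` K)) ` (M // R)"
        using f(1) by (auto simp: quotient_def)
    qed
  qed
qed

text \<open>The type of the total space is left free: at the product type this gives surjectivity on
  isomorphism classes, and at an arbitrary type it shows that the product type represents every
  bundle.\<close>

lemma fiber_bundle_iso_along:
  fixes E :: "'e topology" and X Q F :: "'u topology"
  assumes X: "alexandroff_space X" and Q: "alexandroff_space Q" and F: "t0_space F"
    and tf: "trivial_fibration (alex_cat Q) (aut_cat F) U"
    and cof: "cofibrant (alex_cat X :: ('u, 'u \<Rightarrow> 'u) cat)"
    and E: "fiber_bundle X F E p"
  shows "\<exists>f\<in>maps X Q. bundle_iso E p (grothendieck_space X F (along X U f)) fst"
proof -
  obtain \<delta> where \<delta>: "homeo_system F X \<delta>" "bundle_iso E p (homeo_system.total F X \<delta>) fst"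
    using fiber_bundle_homeo_system[OF X F E] by blast
  obtain D where D: "D \<in> funct (alex_cat X :: ('u, 'u \<Rightarrow> 'u) cat) (aut_cat F :: ('u, 'u \<Rightarrow> 'u) cat)"
    "\<And>x y. alex_le X x y \<Longrightarrow> amap D x y arr = \<delta> x y"
    using funct_of_homeo_system[OF \<delta>(1)] by blast
  obtain f where f: "f \<in> maps X Q" "along X U f = D"
    using along_surj[OF X Q tf cof D(1)] by blast
  then show ?thesis
    using \<delta>(2) grothendieck_space_eq_total[OF \<delta>(1) D(2)] by (intro bexI[of _ f]) simp_all
qed

text \<open>\<open>induced_hom\<close> takes the class of a loop to its transport, so comparison
  through an inner automorphism is the conjugacy in \<open>natural_iff_conjugate\<close>.\<close>

lemma natural_iff_induced_hom:
  fixes X :: "'a topology" and F :: "'f topology"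
    and D D' :: "('a, 'm, 'o, 'f \<Rightarrow> 'f) cfunctor"
  assumes X: "alexandroff_space X" and A: "component_transversal X A"
    and D: "D \<in> funct (alex_cat X) (aut_cat F)" and D': "D' \<in> funct (alex_cat X) (aut_cat F)"
  shows "(\<exists>a. (\<forall>x\<in>topspace X. a x \<in> carrier (homeo_group F)) \<and>
      (\<forall>x y. alex_le X x y \<longrightarrow>
        a y \<otimes>\<^bsub>homeo_group F\<^esub> amap D x y arr = amap D' x y arr \<otimes>\<^bsub>homeo_group F\<^esub> a x)) \<longleftrightarrow>
    (\<forall>x\<^sub>0\<in>A. \<exists>\<nu>\<in>inner_automorphisms (homeo_group F).
       \<forall>c\<in>pi1 X x\<^sub>0. induced_hom X F D' x\<^sub>0 c = \<nu> (induced_hom X F D x\<^sub>0 c))"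
proof -
  let ?G = "homeo_group F"
  have sys: "local_system ?G X (\<lambda>x y. amap D x y arr)" "local_system ?G X (\<lambda>x y. amap D' x y arr)"
    using local_system_funct[OF X group_homeo_group] D D' unfolding aut_cat_def by blast+
  interpret D: local_system ?G X "\<lambda>x y. amap D x y arr"
    by (rule sys)
  interpret D': local_system ?G X "\<lambda>x y. amap D' x y arr"
    by (rule sys)
  have pi1: "c \<in> pi1 X x \<longleftrightarrow> (\<exists>\<gamma>. c = path_class X \<gamma> \<and> pathin X \<gamma> \<and> \<gamma> 0 = x \<and> \<gamma> 1 = x)" for c x
    by (auto simp: pi1_def fundamental_groupoid_simps)
  have ind: "induced_hom X F D x (path_class X \<gamma>) = D.transport \<gamma>"
    "induced_hom X F D' x (path_class X \<gamma>) = D'.transport \<gamma>"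
    if "pathin X \<gamma>" "\<gamma> 0 = x" "\<gamma> 1 = x" for \<gamma> x
  proof -
    have "path_class X \<gamma> \<in> pi1 X x"
      using that pi1 by blast
    then show "induced_hom X F D x (path_class X \<gamma>) = D.transport \<gamma>"
      "induced_hom X F D' x (path_class X \<gamma>) = D'.transport \<gamma>"
      using groupoid_extension_eq_transport[OF X group_homeo_group D[unfolded aut_cat_def] that(1)]
        groupoid_extension_eq_transport[OF X group_homeo_group D'[unfolded aut_cat_def] that(1)] that(2,3)
      by (simp_all add: induced_hom_def aut_cat_def)
  qed
  have "(\<exists>\<nu>\<in>inner_automorphisms ?G. \<forall>c\<in>pi1 X x. induced_hom X F D' x c = \<nu> (induced_hom X F D x c)) \<longleftrightarrow>
    (\<exists>c\<in>carrier ?G. \<forall>\<gamma>. pathin X \<gamma> \<and> \<gamma> 0 = x \<and> \<gamma> 1 = x \<longrightarrow>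
      D'.transport \<gamma> = c \<otimes>\<^bsub>?G\<^esub> D.transport \<gamma> \<otimes>\<^bsub>?G\<^esub> inv\<^bsub>?G\<^esub> c)" for x
  proof -
    have "(\<forall>c\<in>pi1 X x. induced_hom X F D' x c =
          (\<lambda>g\<in>carrier ?G. k \<otimes>\<^bsub>?G\<^esub> g \<otimes>\<^bsub>?G\<^esub> inv\<^bsub>?G\<^esub> k) (induced_hom X F D x c)) \<longleftrightarrow>
        (\<forall>\<gamma>. pathin X \<gamma> \<and> \<gamma> 0 = x \<and> \<gamma> 1 = x \<longrightarrow>
          D'.transport \<gamma> = k \<otimes>\<^bsub>?G\<^esub> D.transport \<gamma> \<otimes>\<^bsub>?G\<^esub> inv\<^bsub>?G\<^esub> k)" for k
    proof -
      have "(\<forall>c\<in>pi1 X x. P c) \<longleftrightarrow>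
          (\<forall>\<gamma>. pathin X \<gamma> \<and> \<gamma> 0 = x \<and> \<gamma> 1 = x \<longrightarrow> P (path_class X \<gamma>))" for P
        using pi1 by auto
      then show ?thesis
        by (simp add: ind)
    qed
    then show ?thesis
      unfolding inner_automorphisms_def by blast
  qed
  then show ?thesis
    unfolding natural_iff_conjugate[OF sys A] by simp
qed

theorem theorem5p6:
  fixes F Q X :: "'u topology"
    and U :: "('u, 'u \<Rightarrow> 'u, 'u, 'u \<Rightarrow> 'u) cfunctor"
    and A :: "'u set"
  assumes "infinite (UNIV :: 'u set)"
    and "t0_space F"
    and "alexandroff_space Q"
    and "cofibrant_replacement (aut_cat F) (alex_cat Q) U"
    and "alexandroff_space X"
    and "topspace X \<noteq> {}"
    and "cofibrant (alex_cat X :: ('u, 'u \<Rightarrow> 'u) cat)"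
    and "component_transversal X A"
  shows "bij_betw (classifying_bijection X F U)
           (maps X Q // map_equiv_rel X F Q U A) (bundles X F // bundle_iso_rel X F) \<and>
         (\<forall>(E :: 'e topology) p. fiber_bundle X F E p \<longrightarrow>
            (\<exists>(E', p') \<in> bundles X F. bundle_iso E p E' p'))"
proof
  note X = assms(5) and Q = assms(3) and F = assms(2)
  let ?X = "alex_cat X :: ('u, 'u \<Rightarrow> 'u) cat" and ?Aut = "aut_cat F :: ('u, 'u \<Rightarrow> 'u) cat"
  have tf: "trivial_fibration (alex_cat Q) ?Aut U"
    using assms(4) by (simp add: cofibrant_replacement_def)
  then have U: "U \<in> funct (alex_cat Q) ?Aut"
    by (simp add: trivial_fibration_def fibration_def)
  have catX: "category ?X"
    using assms(7) by (simp add: cofibrant_def)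
  have along: "along X U f \<in> funct ?X ?Aut" if "f \<in> maps X Q" for f
    unfolding along_def by (rule func_comp_funct[OF U thin_functor_funct[OF X Q that] catX])
  have bundles: "bundle_of X F U f \<in> bundles X F" if "f \<in> maps X Q" for f
    using homeo_system.fiber_bundle_total[OF homeo_system_funct[OF X along[OF that]]]
      grothendieck_space_eq_total[OF homeo_system_funct[OF X along[OF that]] HOL.refl]
    by (simp add: bundle_of_def bundles_def)
  \<comment> \<open>Both sides mean natural isomorphism of \<open>along X U f\<close> and
    \<open>along X U g\<close>, seen through holonomy on the left and through total spaces on the
    right. This exhibits the relation on maps as the pullback that \<open>bij_betw_quotient\<close>
    asks for.\<close>
  have rel: "map_equiv_rel X F Q U A =
      {(f, g). f \<in> maps X Q \<and> g \<in> maps X Q \<and> (bundle_of X F U f, bundle_of X F U g) \<in> bundle_iso_rel X F}"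
  proof -
    have "(\<forall>x\<^sub>0\<in>A. \<exists>\<nu>\<in>inner_automorphisms (homeo_group F). \<forall>c\<in>pi1 X x\<^sub>0.
          induced_hom X F (along X U g) x\<^sub>0 c = \<nu> (induced_hom X F (along X U f) x\<^sub>0 c)) \<longleftrightarrow>
        (bundle_of X F U f, bundle_of X F U g) \<in> bundle_iso_rel X F"
      if f: "f \<in> maps X Q" and g: "g \<in> maps X Q" for f g
    proof -
      note S = homeo_system_funct[OF X along[OF f]] and S' = homeo_system_funct[OF X along[OF g]]
      show ?thesis
        using bundles[OF f] bundles[OF g]
        unfolding natural_iff_induced_hom[OF X assms(8) along[OF f] along[OF g], symmetric]
          homeo_system.bundle_iso_total_iff_natural[OF S S' F, symmetric]
        by (simp add: bundle_iso_rel_def bundle_of_def grothendieck_space_eq_total[OF S HOL.refl]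
            grothendieck_space_eq_total[OF S' HOL.refl])
    qed
    then show ?thesis
      unfolding map_equiv_rel_def by blast
  qed
  \<comment> \<open>Applied to two types of total space: \<open>'u \<times> 'u\<close> for
    surjectivity, \<open>'e\<close> for the second claim.\<close>
  note realize = fiber_bundle_iso_along[OF X Q F tf assms(7)]
  have "\<exists>f\<in>maps X Q. (bundle_of X F U f, (E, p)) \<in> bundle_iso_rel X F" if "(E, p) \<in> bundles X F" for E p
  proof -
    have "fiber_bundle X F E p"
      using that by (simp add: bundles_def)
    then obtain f where f: "f \<in> maps X Q" "bundle_iso E p (grothendieck_space X F (along X U f)) fst"
      using realize by blast
    then show ?thesis
      using bundles[OF f(1)] that bundle_iso_sym[OF f(2)]
      by (intro bexI[of _ f]) (simp_all add: bundle_iso_rel_def bundle_of_def)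
  qed
  then have "bij_betw (\<lambda>K. bundle_iso_rel X F `` (bundle_of X F U ` K))
      (maps X Q // map_equiv_rel X F Q U A) (bundles X F // bundle_iso_rel X F)"
    using bundles by (intro bij_betw_quotient[OF equiv_bundle_iso_rel _ rel]) auto
  then show "bij_betw (classifying_bijection X F U)
      (maps X Q // map_equiv_rel X F Q U A) (bundles X F // bundle_iso_rel X F)"
    unfolding classifying_bijection_def .
  show "\<forall>(E :: 'e topology) p. fiber_bundle X F E p \<longrightarrow>
      (\<exists>(E', p') \<in> bundles X F. bundle_iso E p E' p')"
  proof (intro allI impI)
    fix E :: "'e topology" and p assume "fiber_bundle X F E p"
    then obtain f where f: "f \<in> maps X Q" "bundle_iso E p (grothendieck_space X F (along X U f)) fst"
      using realize by blast
    \<comment> \<open>The representative in the product type is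
      \<open>bundle_of X F U f\<close>.\<close>
    then show "\<exists>(E', p') \<in> bundles X F. bundle_iso E p E' p'"
      using bundles[OF f(1)] by (auto simp: bundle_of_def)
  qed
qed

end
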